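(* Let $n\ge1$, let $\mathfrak p_0\in A=\mathbb F_q[T]$ be monic irreducible of degree $r$ with $\gcd(n,r)=1$, let $t\in\mathbb F_{q^r}$ be a root of $\mathfrak p_0$, let $\phi$ be the Drinfeld module with $\phi_T=t+\tau^n$, let $\mathfrak p\neq\mathfrak p_0$ be a monic irreducible element of $A$ of degree $d$, and let $m\mid n$. Assume $\gcd(m,d)=1$ and identify $R=K[y;\sigma]/(y^n-c)$ (notation of the context). Let $C\subseteq R$ be a nonzero left ideal. There is a unique monic $g\in K[y;\sigma]$ of minimal $y$-degree whose class lies in $C$, and $C=Rg$. There is a unique $h\in K[y;\sigma]$ with $y^n-c=hg=gh$. Moreover: (1) $f\in C$ if and only if $g$ divides $f$ on the right in $K[y;\sigma]$. (2) $\dim_KC=n-\deg_yg$, with basis $g,yg,\dots,y^{k-1}g$, where $k=n-\deg_yg$. (3) $f\in C$ if and only if $fh=0$ in $R$.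
   Context: $q$ is a prime power, $A=\mathbb F_q[T]$, $\overline{\mathbb F}_q$ a fixed algebraic closure, $[i]=q^i$, $\beta^{[i]}=\beta^{q^i}$. Twisted polynomials in $\tau$ satisfy $\tau a=a^q\tau$ and act on $\overline{\mathbb F}_q$ with $\tau$ acting as $x\mapsto x^q$ and constants by multiplication. $\phi\colon A\to\mathbb F_{q^r}\{\tau\}$, $a\mapsto\phi_a$, is the $\mathbb F_q$-algebra homomorphism with $\phi_T=t+\tau^n$. Put $\kappa=A/\mathfrak p\cong\mathbb F_{q^d}$ and $M=\phi[\mathfrak p]=\{v\in\overline{\mathbb F}_q:\phi_{\mathfrak p}(v)=0\}$, a $\kappa$-vector space of dimension $n$ via $a\cdot v=\phi_a(v)$; $E=\operatorname{End}_\kappa(M)$; $c=\mathfrak p_0\bmod\mathfrak p\in\kappa^\times$; $\pi=\tau^r$, acting on $M$ by $v\mapsto v^{[r]}$; $R_0=\kappa[\pi^m|_M]$; $R=\operatorname{Cent}_E(R_0)$; $L=\mathbb F_{q^m}\subseteq R$ acting on $M$ by scalar multiplication; $K\subseteq R$ the image of $L\otimes_{\mathbb F_q}\kappa$ under multiplication. When $\gcd(m,d)=1$, $K\cong\mathbb F_{q^{md}}$ is a field, conjugation by $\pi$ induces an automorphism $\sigma$ of $K$ that is the identity on $\kappa$ and $\zeta\mapsto\zeta^{[r]}$ on $L$ (of order $m$, fixed field $\kappa$), and, with $K[y;\sigma]$ the twisted polynomial ring satisfying $yx=\sigma(x)y$ for $x\in K$, the assignment $y\mapsto\pi$ induces an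 isomorphism $K[y;\sigma]/(y^n-c)\cong R$, with $y^n-c$ central; this is the identification used. Elements $f\in R$ are represented by polynomials in $K[y;\sigma]$ modulo $y^n-c$; dimension over $K$ refers to the left $K$-vector space structure. *)

theory Defs
  imports
    "HOL-Algebra.Algebra"
    "HOL-Algebra.Algebraic_Closure_Type"
    "HOL-Library.Cardinality"
begin

section \<open>Skew polynomial rings, endomorphism rings, centralizers, left ideals\<close>

text \<open>
  The ring \<open>S[y;s]\<close>: coefficients are written on the left and \<open>y x = s(x) y\<close>.
  An element is its coefficient function, so that
  \<open>(a y\<^sup>i) (b y\<^sup>j) = a s\<^sup>i(b) y^(i+j)\<close>.
\<close>

definition skew_poly_ring ::
    "('k, 'z) ring_scheme \<Rightarrow> ('k \<Rightarrow> 'k) \<Rightarrow> (nat \<Rightarrow> 'k) ring" where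
  "skew_poly_ring S s =
     \<lparr> carrier = {f. (\<forall>i. f i \<in> carrier S) \<and> finite {i. f i \<noteq> \<zero>\<^bsub>S\<^esub>}},
       monoid.mult = (\<lambda>f g k. \<Oplus>\<^bsub>S\<^esub>i\<in>{..k}. f i \<otimes>\<^bsub>S\<^esub> (s ^^ i) (g (k - i))),
       one = (\<lambda>i. if i = 0 then \<one>\<^bsub>S\<^esub> else \<zero>\<^bsub>S\<^esub>),
       ring.zero = (\<lambda>i. \<zero>\<^bsub>S\<^esub>),
       add = (\<lambda>f g i. f i \<oplus>\<^bsub>S\<^esub> g i) \<rparr>"

definition skew_monom :: "('k, 'z) ring_scheme \<Rightarrow> 'k \<Rightarrow> nat \<Rightarrow> (nat \<Rightarrow> 'k)" where
  "skew_monom S a j = (\<lambda>i. if i = j then a else \<zero>\<^bsub>S\<^esub>)"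

text \<open>As for \<^const>\<open>Polynomial.degree\<close>, the zero polynomial gets degree 0.\<close>

definition skew_degree :: "('k, 'z) ring_scheme \<Rightarrow> (nat \<Rightarrow> 'k) \<Rightarrow> nat" where
  "skew_degree S f = (LEAST k. \<forall>i>k. f i = \<zero>\<^bsub>S\<^esub>)"

definition skew_monic :: "('k, 'z) ring_scheme \<Rightarrow> (nat \<Rightarrow> 'k) \<Rightarrow> bool" where
  "skew_monic S f \<longleftrightarrow> f (skew_degree S f) = \<one>\<^bsub>S\<^esub>"

definition End_ring ::
    "('r, 'y) ring_scheme \<Rightarrow> ('r, 'v, 'z) module_scheme \<Rightarrow> ('v \<Rightarrow> 'v) ring" where
  "End_ring S V =
     \<lparr> carrier = {f \<in> carrier V \<rightarrow>\<^sub>E carrier V.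
          (\<forall>x\<in>carrier V. \<forall>y\<in>carrier V. f (x \<oplus>\<^bsub>V\<^esub> y) = f x \<oplus>\<^bsub>V\<^esub> f y) \<and>
          (\<forall>a\<in>carrier S. \<forall>x\<in>carrier V. f (a \<odot>\<^bsub>V\<^esub> x) = a \<odot>\<^bsub>V\<^esub> f x)},
       monoid.mult = (\<lambda>f g. compose (carrier V) f g),
       one = (\<lambda>x\<in>carrier V. x),
       ring.zero = (\<lambda>x\<in>carrier V. \<zero>\<^bsub>V\<^esub>),
       add = (\<lambda>f g. \<lambda>x\<in>carrier V. f x \<oplus>\<^bsub>V\<^esub> g x) \<rparr>"

definition centralizer :: "('b, 'z) ring_scheme \<Rightarrow> 'b set \<Rightarrow> 'b set" where
  "centralizer S H = {x \<in> carrier S. \<forall>h\<in>H. x \<otimes>\<^bsub>S\<^esub> h = h \<otimes>\<^bsub>S\<^esub> x}"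

definition left_ideal :: "'b set \<Rightarrow> ('b, 'z) ring_scheme \<Rightarrow> bool" where
  "left_ideal I S \<longleftrightarrow> additive_subgroup I S \<and> (\<forall>x\<in>carrier S. \<forall>a\<in>I. x \<otimes>\<^bsub>S\<^esub> a \<in> I)"


section \<open>The Drinfeld module and its torsion\<close>

text \<open>
  \<open>\<F>\<^sub>q\<close> is a finite field type \<^typ>\<open>'a\<close> with \<open>q = CARD('a)\<close>, and its fixed algebraic
  closure is the type \<^typ>\<open>'a alg_closure\<close>. The field with \<open>q\<^sup>i\<close> elements is the set of
  roots of \<open>x^(q^i) - x\<close> in it.
\<close>

definition Fq_ext :: "nat \<Rightarrow> ('a :: {field, finite}) alg_closure set" where
  "Fq_ext i = {x. x ^ (CARD('a) ^ i) = x}"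

definition Fq_ext_ring :: "nat \<Rightarrow> ('a :: {field, finite}) alg_closure ring" where
  "Fq_ext_ring i = ring_of_type_algebra \<lparr>carrier := Fq_ext i\<rparr>"

text \<open>Twisted polynomials in \<open>\<tau>\<close> over the field of \<open>q\<^sup>r\<close> elements, \<open>\<tau> a = a\<^sup>q \<tau>\<close>.\<close>

definition twisted_ring :: "nat \<Rightarrow> (nat \<Rightarrow> ('a :: {field, finite}) alg_closure) ring" where
  "twisted_ring r = skew_poly_ring (Fq_ext_ring r) (\<lambda>x. x ^ CARD('a))"

definition twisted_act ::
    "(nat \<Rightarrow> ('a :: {field, finite}) alg_closure) \<Rightarrow> 'a alg_closure \<Rightarrow> 'a alg_closure" where
  "twisted_act f x = (\<Sum>i | f i \<noteq> 0. f i * x ^ (CARD('a) ^ i))"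

text \<open>\<open>\<phi>\<^sub>T = t + \<tau>\<^sup>n\<close>, extended to the \<open>\<F>\<^sub>q\<close>-algebra homomorphism \<open>a \<mapsto> \<phi>\<^sub>a\<close>.\<close>

definition drinfeld_T ::
    "nat \<Rightarrow> nat \<Rightarrow> ('a :: {field, finite}) alg_closure \<Rightarrow> nat \<Rightarrow> 'a alg_closure" where
  "drinfeld_T r n t =
     skew_monom (Fq_ext_ring r) t 0 \<oplus>\<^bsub>twisted_ring r\<^esub> skew_monom (Fq_ext_ring r) 1 n"

definition drinfeld ::
    "nat \<Rightarrow> nat \<Rightarrow> ('a :: {field, finite}) alg_closure \<Rightarrow> 'a poly \<Rightarrow> nat \<Rightarrow> 'a alg_closure" where
  "drinfeld r n t a =
     (\<Oplus>\<^bsub>twisted_ring r\<^esub>i\<in>{..Polynomial.degree a}.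
        skew_monom (Fq_ext_ring r) (to_ac (Polynomial.coeff a i)) 0
          \<otimes>\<^bsub>twisted_ring r\<^esub> (drinfeld_T r n t [^]\<^bsub>twisted_ring r\<^esub> i))"

text \<open>The residue field \<open>A/\<pp>\<close>; its elements are cosets.\<close>

definition residue_class :: "('a :: {field, finite}) poly \<Rightarrow> 'a poly \<Rightarrow> 'a poly set" where
  "residue_class p a =
     (PIdl\<^bsub>ring_of_type_algebra\<^esub> p) +>\<^bsub>ring_of_type_algebra\<^esub> a"

definition residue_field :: "('a :: {field, finite}) poly \<Rightarrow> 'a poly set ring" where
  "residue_field p = ring_of_type_algebra Quot (PIdl\<^bsub>ring_of_type_algebra\<^esub> p)"

text \<open>
  \<open>M = \<phi>[\<pp>]\<close> as a module over the residue field. A coset acts through any of its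
  representatives, since \<open>\<phi>\<^sub>a\<close> acts as zero on \<open>M\<close> for \<open>a\<close> in the ideal of \<open>\<pp>\<close>.
  The multiplicative part of the module record plays no role.
\<close>

definition torsion_module ::
    "nat \<Rightarrow> nat \<Rightarrow> ('a :: {field, finite}) alg_closure \<Rightarrow> 'a poly
      \<Rightarrow> ('a poly set, 'a alg_closure) module" where
  "torsion_module r n t p =
     \<lparr> carrier = {v. twisted_act (drinfeld r n t p) v = 0},
       monoid.mult = undefined, monoid.one = undefined,
       ring.zero = 0, ring.add = (+),
       module.smult = (\<lambda>u v. twisted_act (drinfeld r n t (SOME a. a \<in> u)) v) \<rparr>"


section \<open>The rings \<open>E\<close>, \<open>R\<close>, \<open>K\<close> and the evaluation map\<close>

definition E_ring ::
    "nat \<Rightarrow> nat \<Rightarrow> ('a :: {field, finite}) alg_closure \<Rightarrow> 'a poly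
      \<Rightarrow> ('a alg_closure \<Rightarrow> 'a alg_closure) ring" where
  "E_ring r n t p = End_ring (residue_field p) (torsion_module r n t p)"

definition frob ::
    "nat \<Rightarrow> nat \<Rightarrow> ('a :: {field, finite}) alg_closure \<Rightarrow> 'a poly
      \<Rightarrow> 'a alg_closure \<Rightarrow> 'a alg_closure" where
  "frob r n t p = (\<lambda>v\<in>carrier (torsion_module r n t p). v ^ (CARD('a) ^ r))"

text \<open>The embedding of the residue field into \<open>E\<close> by its scalar action on \<open>M\<close>.\<close>

definition kappa_scalar ::
    "nat \<Rightarrow> nat \<Rightarrow> ('a :: {field, finite}) alg_closure \<Rightarrow> 'a poly
      \<Rightarrow> 'a poly set \<Rightarrow> 'a alg_closure \<Rightarrow> 'a alg_closure" where
  "kappa_scalar r n t p u =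
     (\<lambda>v\<in>carrier (torsion_module r n t p). u \<odot>\<^bsub>torsion_module r n t p\<^esub> v)"

definition R0 ::
    "nat \<Rightarrow> nat \<Rightarrow> ('a :: {field, finite}) alg_closure \<Rightarrow> 'a poly \<Rightarrow> nat
      \<Rightarrow> ('a alg_closure \<Rightarrow> 'a alg_closure) set" where
  "R0 r n t p m =
     generate_ring (E_ring r n t p)
       (kappa_scalar r n t p ` carrier (residue_field p)
          \<union> {frob r n t p [^]\<^bsub>E_ring r n t p\<^esub> m})"

definition R_ring ::
    "nat \<Rightarrow> nat \<Rightarrow> ('a :: {field, finite}) alg_closure \<Rightarrow> 'a poly \<Rightarrow> nat
      \<Rightarrow> ('a alg_closure \<Rightarrow> 'a alg_closure) ring" where
  "R_ring r n t p m =
     (E_ring r n t p) \<lparr>carrier := centralizer (E_ring r n t p) (R0 r n t p m)\<rparr>"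

definition L_scalars ::
    "nat \<Rightarrow> nat \<Rightarrow> ('a :: {field, finite}) alg_closure \<Rightarrow> 'a poly \<Rightarrow> nat
      \<Rightarrow> ('a alg_closure \<Rightarrow> 'a alg_closure) set" where
  "L_scalars r n t p m =
     (\<lambda>z. \<lambda>v\<in>carrier (torsion_module r n t p). z * v) ` Fq_ext m"

text \<open>
  The image of the tensor product of \<open>L\<close> and the residue field under multiplication is the
  additive subgroup generated by the products.
\<close>

definition K_set ::
    "nat \<Rightarrow> nat \<Rightarrow> ('a :: {field, finite}) alg_closure \<Rightarrow> 'a poly \<Rightarrow> nat
      \<Rightarrow> ('a alg_closure \<Rightarrow> 'a alg_closure) set" where
  "K_set r n t p m =
     generate (add_monoid (E_ring r n t p))
       {l \<otimes>\<^bsub>E_ring r n t p\<^esub> kappa_scalar r n t p u | l u.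
          l \<in> L_scalars r n t p m \<and> u \<in> carrier (residue_field p)}"

definition K_ring ::
    "nat \<Rightarrow> nat \<Rightarrow> ('a :: {field, finite}) alg_closure \<Rightarrow> 'a poly \<Rightarrow> nat
      \<Rightarrow> ('a alg_closure \<Rightarrow> 'a alg_closure) ring" where
  "K_ring r n t p m = (E_ring r n t p) \<lparr>carrier := K_set r n t p m\<rparr>"

definition conj_frob ::
    "nat \<Rightarrow> nat \<Rightarrow> ('a :: {field, finite}) alg_closure \<Rightarrow> 'a poly
      \<Rightarrow> ('a alg_closure \<Rightarrow> 'a alg_closure) \<Rightarrow> ('a alg_closure \<Rightarrow> 'a alg_closure)" where
  "conj_frob r n t p x =
     frob r n t p \<otimes>\<^bsub>E_ring r n t p\<^esub> x
       \<otimes>\<^bsub>E_ring r n t p\<^esub> inv\<^bsub>E_ring r n t p\<^esub> (frob r n t p)"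

definition K_skew ::
    "nat \<Rightarrow> nat \<Rightarrow> ('a :: {field, finite}) alg_closure \<Rightarrow> 'a poly \<Rightarrow> nat
      \<Rightarrow> (nat \<Rightarrow> 'a alg_closure \<Rightarrow> 'a alg_closure) ring" where
  "K_skew r n t p m = skew_poly_ring (K_ring r n t p m) (conj_frob r n t p)"

definition skew_y ::
    "nat \<Rightarrow> nat \<Rightarrow> ('a :: {field, finite}) alg_closure \<Rightarrow> 'a poly \<Rightarrow> nat
      \<Rightarrow> (nat \<Rightarrow> 'a alg_closure \<Rightarrow> 'a alg_closure)" where
  "skew_y r n t p m = skew_monom (K_ring r n t p m) \<one>\<^bsub>K_ring r n t p m\<^esub> 1"

text \<open>
  The class in \<open>R\<close> of a polynomial in \<open>K[y;\<sigma>]\<close>: the map that is the identity on \<open>K\<close> and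
  sends \<open>y\<close> to the Frobenius. It realizes the identification of \<open>K[y;\<sigma>]/(y\<^sup>n - c)\<close> with \<open>R\<close>.
\<close>

definition skew_eval ::
    "nat \<Rightarrow> nat \<Rightarrow> ('a :: {field, finite}) alg_closure \<Rightarrow> 'a poly \<Rightarrow> nat
      \<Rightarrow> (nat \<Rightarrow> 'a alg_closure \<Rightarrow> 'a alg_closure) \<Rightarrow> ('a alg_closure \<Rightarrow> 'a alg_closure)" where
  "skew_eval r n t p m f =
     (\<Oplus>\<^bsub>R_ring r n t p m\<^esub>i\<in>{i. f i \<noteq> \<zero>\<^bsub>R_ring r n t p m\<^esub>}.
        f i \<otimes>\<^bsub>R_ring r n t p m\<^esub> (frob r n t p [^]\<^bsub>R_ring r n t p m\<^esub> i))"

text \<open>\<open>y\<^sup>n - c\<close>, where \<open>c\<close> is the residue class of \<open>\<pp>\<^sub>0\<close>, viewed in \<open>K\<close>.\<close>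

definition yn_minus_c ::
    "nat \<Rightarrow> nat \<Rightarrow> ('a :: {field, finite}) alg_closure \<Rightarrow> 'a poly \<Rightarrow> 'a poly \<Rightarrow> nat
      \<Rightarrow> (nat \<Rightarrow> 'a alg_closure \<Rightarrow> 'a alg_closure)" where
  "yn_minus_c r n t p0 p m =
     (skew_y r n t p m [^]\<^bsub>K_skew r n t p m\<^esub> n)
       \<ominus>\<^bsub>K_skew r n t p m\<^esub>
       skew_monom (K_ring r n t p m) (kappa_scalar r n t p (residue_class p p0)) 0"

text \<open>
  A monic polynomial with class in \<open>C\<close> whose degree is least among the nonzero polynomials
  with class in \<open>C\<close>.
\<close>

definition min_monic ::
    "nat \<Rightarrow> nat \<Rightarrow> ('a :: {field, finite}) alg_closure \<Rightarrow> 'a poly \<Rightarrow> nat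
      \<Rightarrow> ('a alg_closure \<Rightarrow> 'a alg_closure) set
      \<Rightarrow> (nat \<Rightarrow> 'a alg_closure \<Rightarrow> 'a alg_closure) \<Rightarrow> bool" where
  "min_monic r n t p m C g \<longleftrightarrow>
     g \<in> carrier (K_skew r n t p m) \<and> skew_monic (K_ring r n t p m) g \<and>
     skew_eval r n t p m g \<in> C \<and>
     (\<forall>f\<in>carrier (K_skew r n t p m).
        f \<noteq> \<zero>\<^bsub>K_skew r n t p m\<^esub> \<longrightarrow> skew_eval r n t p m f \<in> C \<longrightarrow>
        skew_degree (K_ring r n t p m) g \<le> skew_degree (K_ring r n t p m) f)"

end

theory Submission
  imports Defs "HOL-Number_Theory.Residues" "HOL-Library.Function_Algebras"
begin

text \<open>
  The description of left ideals is that of a principal left ideal ring modulo a central element. Over a field \<open>K\<close> with an automorphism \<open>s\<close>, right division by a monic polynomial works in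
  \<open>K[y;s]\<close> (\<open>division_right\<close>), so the polynomials whose class lies in \<open>C\<close> are the left multiples of
  the monic one of least degree, \<open>g\<close> (\<open>minimal_dvd\<close>). The polynomial \<open>N = y^n - c\<close> has class zero,
  so \<open>N = h g\<close>; as \<open>N\<close> is central and \<open>g\<close> cancels on the right, also \<open>N = g h\<close>
  (\<open>minimal_cofactor\<close>). Degree counting gives the basis of \<open>C\<close> (\<open>minimal_basis\<close>), and
  \<open>f h = v N = v g h\<close> implies \<open>f = v g\<close>, which is the annihilator description
  (\<open>cofactor_annihilates\<close>). All of this is done in the locale \<open>cyclic_skew\<close>, whose assumptions say
  that \<open>R\<close> has the left \<open>K\<close>-basis \<open>1, \<pi>, \<dots>, \<pi>^(n-1)\<close> with \<open>\<pi> x = s(x) \<pi>\<close> and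
  \<open>\<pi>^n = c\<close>.

  The remaining work is to see that the centralizer \<open>R\<close> of \<open>\<kappa>[\<pi>^m]\<close> in the endomorphism ring of
  \<open>M\<close> has this shape. Write \<open>F\<close> for the algebraic closure. A polynomial \<open>w\<close> over \<open>F\<close> acts on \<open>F\<close>
  with its variable \<open>X\<close> acting as \<open>\<phi>\<^sub>T = t + \<tau>^n\<close>. The key fact is that the \<open>n d\<close> maps
  \<open>\<phi>\<^sub>T^a \<pi>^i\<close> with \<open>a < d\<close> and \<open>i < n\<close> form an \<open>F\<close>-basis of the \<open>\<F>\<^sub>q\<close>-linear maps from
  \<open>M\<close> to \<open>F\<close>. Indeed \<open>M\<close> has \<open>q^(n d)\<close> elements (\<open>card_M\<close>), so \<open>1, \<tau>, \<dots>, \<tau>^(n d - 1)\<close> are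
  independent on \<open>M\<close> and span all linear maps; and every power of \<open>\<tau>\<close> equals, on \<open>M\<close>, some
  \<open>\<tau>^(n j + r i)\<close> with \<open>i < n\<close>, because \<open>n\<close> and \<open>r\<close> are coprime and \<open>\<pi> = \<tau>^r\<close> has
  finite order there, while \<open>\<tau>^n = \<phi>\<^sub>T - t\<close> turns \<open>\<tau>^(n j)\<close> into a polynomial in \<open>\<phi>\<^sub>T\<close>
  (\<open>tau_map_in_span\<close>). Counting makes this spanning set a basis (\<open>free_family_exchange\<close>).

  In these coordinates an element of \<open>R\<close> is a sum of operators \<open>w\<^sub>i \<pi>^i\<close> in which commuting with
  \<open>\<phi>\<^sub>T\<close> and with \<open>\<pi>^m\<close> forces the coefficients of \<open>w\<^sub>i\<close> into the field with \<open>q^m\<close> elements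
  (\<open>centralizer_representation\<close>). Such polynomials modulo \<open>\<pp>\<close> are exactly \<open>K\<close>, which is a field
  because \<open>\<pp>\<close> remains irreducible over that field (\<open>inverse_mod_irreducible\<close>, \<open>subfield_K\<close>).
  Finally \<open>\<pi>^n = \<tau>^(n r)\<close> is the polynomial \<open>\<pp>\<^sub>0\<close> in \<open>\<phi>\<^sub>T\<close>, since the product of the
  \<open>X - \<tau>^(n i)(t)\<close> over \<open>i < r\<close> is Frobenius invariant and vanishes at \<open>t\<close>
  (\<open>opX_characteristic\<close>).
\<close>

section \<open>Skew polynomial rings\<close>

text \<open>
  Exchanges antidiagonals and rows in a sum over the triangle \<open>i + j \<le> n\<close>. Associativity of the
  skew product and multiplicativity of evaluation at \<open>\<pi>\<close> are both instances of this reordering.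
\<close>
lemma (in abelian_monoid) finsum_triangle:
  fixes n :: nat
  assumes "\<And>i j. i + j \<le> n \<Longrightarrow> F i j \<in> carrier G"
  shows "(\<Oplus>i\<in>{..n}. \<Oplus>j\<in>{..i}. F j (i - j)) = (\<Oplus>i\<in>{..n}. \<Oplus>j\<in>{..n - i}. F i j)"
  using assms
proof (induction n)
  case 0
  then show ?case by simp
next
  case (Suc n)
  note cl = Suc.prems
  have "(\<Oplus>i\<in>{..n}. \<Oplus>j\<in>{..Suc n - i}. F i j)
      = (\<Oplus>i\<in>{..n}. F i (Suc n - i) \<oplus> (\<Oplus>j\<in>{..n - i}. F i j))"
    by (intro finsum_cong' refl) (auto simp: Suc_diff_le Pi_iff intro!: cl finsum_Suc finsum_closed a_closed)
  also have "\<dots> = (\<Oplus>i\<in>{..n}. F i (Suc n - i)) \<oplus> (\<Oplus>i\<in>{..n}. \<Oplus>j\<in>{..n - i}. F i j)"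
    by (intro finsum_addf) (auto intro!: cl finsum_closed)
  also have "(\<Oplus>i\<in>{..n}. \<Oplus>j\<in>{..n - i}. F i j) = (\<Oplus>i\<in>{..n}. \<Oplus>j\<in>{..i}. F j (i - j))"
    by (rule Suc.IH[symmetric]) (auto intro!: cl)
  finally have *: "(\<Oplus>i\<in>{..n}. \<Oplus>j\<in>{..Suc n - i}. F i j) =
      (\<Oplus>i\<in>{..n}. F i (Suc n - i)) \<oplus> (\<Oplus>i\<in>{..n}. \<Oplus>j\<in>{..i}. F j (i - j))" .
  have c1: "(\<lambda>i. F i (Suc n - i)) \<in> {..n} \<rightarrow> carrier G" by (auto intro!: cl)
  have c2: "(\<Oplus>i\<in>{..n}. \<Oplus>j\<in>{..i}. F j (i - j)) \<in> carrier G"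
    by (auto intro!: cl finsum_closed)
  have c3: "(\<Oplus>i\<in>{..n}. F i (Suc n - i)) \<in> carrier G" using c1 by (rule finsum_closed)
  have c4: "F (Suc n) 0 \<in> carrier G" by (rule cl) simp
  have "(\<Oplus>i\<in>{..Suc n}. \<Oplus>j\<in>{..i}. F j (i - j))
      = (\<Oplus>j\<in>{..Suc n}. F j (Suc n - j)) \<oplus> (\<Oplus>i\<in>{..n}. \<Oplus>j\<in>{..i}. F j (i - j))"
    by (rule finsum_Suc) (auto intro!: cl finsum_closed)
  also have "(\<Oplus>j\<in>{..Suc n}. F j (Suc n - j)) = F (Suc n) 0 \<oplus> (\<Oplus>i\<in>{..n}. F i (Suc n - i))"
    by (subst finsum_Suc) (auto intro!: cl)
  also have "\<dots> \<oplus> (\<Oplus>i\<in>{..n}. \<Oplus>j\<in>{..i}. F j (i - j)) =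
     F (Suc n) 0 \<oplus> ((\<Oplus>i\<in>{..n}. F i (Suc n - i)) \<oplus> (\<Oplus>i\<in>{..n}. \<Oplus>j\<in>{..i}. F j (i - j)))"
    by (rule a_assoc[OF c4 c3 c2])
  also have "\<dots> = F (Suc n) 0 \<oplus> (\<Oplus>i\<in>{..n}. \<Oplus>j\<in>{..Suc n - i}. F i j)"
    by (simp only: *)
  also have "F (Suc n) 0 = (\<Oplus>j\<in>{..Suc n - Suc n}. F (Suc n) j)"
    using c4 by simp
  also have "(\<Oplus>j\<in>{..Suc n - Suc n}. F (Suc n) j) \<oplus> (\<Oplus>i\<in>{..n}. \<Oplus>j\<in>{..Suc n - i}. F i j)
     = (\<Oplus>i\<in>{..Suc n}. \<Oplus>j\<in>{..Suc n - i}. F i j)"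
    by (rule finsum_Suc[symmetric]) (auto intro!: cl finsum_closed)
  finally show ?case .
qed

locale skew_poly = ring S for S (structure) +
  fixes s
  assumes s_hom: "s \<in> ring_hom S S"
begin

abbreviation "P \<equiv> skew_poly_ring S s"

lemma s_pow_closed [simp, intro]: "a \<in> carrier S \<Longrightarrow> (s ^^ i) a \<in> carrier S"
  by (induction i) (auto intro: ring_hom_closed[OF s_hom])

lemma s_pow_add: "a \<in> carrier S \<Longrightarrow> b \<in> carrier S \<Longrightarrow> (s ^^ i) (a \<oplus> b) = (s ^^ i) a \<oplus> (s ^^ i) b"
  by (induction i) (auto simp: ring_hom_add[OF s_hom])

lemma s_pow_mult: "a \<in> carrier S \<Longrightarrow> b \<in> carrier S \<Longrightarrow> (s ^^ i) (a \<otimes> b) = (s ^^ i) a \<otimes> (s ^^ i) b"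
  by (induction i) (auto simp: ring_hom_mult[OF s_hom])

lemma s_pow_one [simp]: "(s ^^ i) \<one> = \<one>"
  by (induction i) (auto simp: ring_hom_one[OF s_hom])

lemma s_pow_zero [simp]: "(s ^^ i) \<zero> = \<zero>"
proof -
  have "(s ^^ i) \<zero> \<oplus> (s ^^ i) \<zero> = (s ^^ i) \<zero>"
    using s_pow_add[OF zero_closed zero_closed, of i] by simp
  moreover have "(s ^^ i) \<zero> \<in> carrier S" by (rule s_pow_closed) (rule zero_closed)
  ultimately show ?thesis by (metis add.r_cancel_one)
qed

lemma s_pow_finsum:
  "finite A \<Longrightarrow> f \<in> A \<rightarrow> carrier S \<Longrightarrow> (s ^^ i) (\<Oplus>x\<in>A. f x) = (\<Oplus>x\<in>A. (s ^^ i) (f x))"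
proof (induction A rule: finite_induct)
  case (insert x A)
  then have "(s ^^ i) (f x \<oplus> (\<Oplus>x\<in>A. f x)) = (s ^^ i) (f x) \<oplus> (\<Oplus>x\<in>A. (s ^^ i) (f x))"
    by (subst s_pow_add) auto
  with insert show ?case by (simp add: Pi_iff)
qed simp

lemma carrier_iff:
  "f \<in> carrier P \<longleftrightarrow> (\<forall>i. f i \<in> carrier S) \<and> (\<exists>N. \<forall>i>N. f i = \<zero>)"
proof -
  have "finite {i. f i \<noteq> \<zero>} \<longleftrightarrow> (\<exists>N. \<forall>i>N. f i = \<zero>)"
    unfolding finite_nat_set_iff_bounded_le by (auto simp flip: not_le)
  then show ?thesis by (simp add: skew_poly_ring_def)
qed

lemma coeff_closed: "f \<in> carrier P \<Longrightarrow> f i \<in> carrier S"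
  using carrier_iff[of f] by blast

lemma mult_coeff: "(f \<otimes>\<^bsub>P\<^esub> g) k = (\<Oplus>i\<in>{..k}. f i \<otimes> (s ^^ i) (g (k - i)))"
  by (simp add: skew_poly_ring_def)

lemma add_coeff: "(f \<oplus>\<^bsub>P\<^esub> g) k = f k \<oplus> g k"
  by (simp add: skew_poly_ring_def)

lemma zero_coeff: "\<zero>\<^bsub>P\<^esub> k = \<zero>"
  by (simp add: skew_poly_ring_def)

lemma one_coeff: "\<one>\<^bsub>P\<^esub> k = (if k = 0 then \<one> else \<zero>)"
  by (simp add: skew_poly_ring_def)

lemma mult_coeff_zero:
  assumes "f \<in> carrier P" "g \<in> carrier P" "\<forall>i>a. f i = \<zero>" "\<forall>i>b. g i = \<zero>" "k > a + b"
  shows "(f \<otimes>\<^bsub>P\<^esub> g) k = \<zero>"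
proof -
  note [simp] = coeff_closed[OF assms(1)] coeff_closed[OF assms(2)]
  have "f i \<otimes> (s ^^ i) (g (k - i)) = \<zero>" if "i \<le> k" for i
  proof (cases "i > a")
    case False
    then have "k - i > b" using assms(5) that by linarith
    then show ?thesis using assms by simp
  qed (use assms in simp)
  then show ?thesis unfolding mult_coeff by (auto intro!: add.finprod_one_eqI)
qed

lemma mult_closed: assumes "f \<in> carrier P" "g \<in> carrier P" shows "f \<otimes>\<^bsub>P\<^esub> g \<in> carrier P"
proof -
  note [simp] = coeff_closed[OF assms(1)] coeff_closed[OF assms(2)]
  obtain a b where ab: "\<forall>i>a. f i = \<zero>" "\<forall>i>b. g i = \<zero>" using assms carrier_iff by metis
  have "\<forall>k>a + b. (f \<otimes>\<^bsub>P\<^esub> g) k = \<zero>" using mult_coeff_zero[OF assms ab] by blast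
  moreover have "(f \<otimes>\<^bsub>P\<^esub> g) k \<in> carrier S" for k
    unfolding mult_coeff using assms by (auto intro!: finsum_closed)
  ultimately show ?thesis unfolding carrier_iff by blast
qed

lemma add_closed: assumes "f \<in> carrier P" "g \<in> carrier P" shows "f \<oplus>\<^bsub>P\<^esub> g \<in> carrier P"
proof -
  note [simp] = coeff_closed[OF assms(1)] coeff_closed[OF assms(2)]
  obtain a b where ab: "\<forall>i>a. f i = \<zero>" "\<forall>i>b. g i = \<zero>" using assms carrier_iff by metis
  have "\<forall>k>max a b. (f \<oplus>\<^bsub>P\<^esub> g) k = \<zero>" using ab by (simp add: add_coeff)
  moreover have "(f \<oplus>\<^bsub>P\<^esub> g) k \<in> carrier S" for k by (simp add: add_coeff)
  ultimately show ?thesis unfolding carrier_iff by blast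
qed

text \<open>
  After distributing, both coefficients of \<open>y^k\<close> are sums of the same terms
  \<open>f\<^sub>i s^i(g\<^sub>j) s^(i+j)(h\<^sub>l)\<close> with \<open>i + j + l = k\<close>, in two different orders.
\<close>
lemma mult_assoc:
  assumes "f \<in> carrier P" "g \<in> carrier P" "h \<in> carrier P"
  shows "(f \<otimes>\<^bsub>P\<^esub> g) \<otimes>\<^bsub>P\<^esub> h = f \<otimes>\<^bsub>P\<^esub> (g \<otimes>\<^bsub>P\<^esub> h)"
proof
  fix k
  note cl = coeff_closed[OF assms(1)] coeff_closed[OF assms(2)] coeff_closed[OF assms(3)]
  let ?F = "\<lambda>i j. f i \<otimes> ((s ^^ i) (g j) \<otimes> (s ^^ (i + j)) (h (k - (i + j))))"
  note [simp] = cl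
  have 1: "(\<Oplus>j\<in>{..i}. f j \<otimes> (s ^^ j) (g (i - j))) \<otimes> (s ^^ i) (h (k - i))
      = (\<Oplus>j\<in>{..i}. ?F j (i - j))" for i
    by (subst finsum_ldistr) (auto simp: m_assoc intro!: finsum_cong')
  have 2: "f i \<otimes> (s ^^ i) (\<Oplus>j\<in>{..k - i}. g j \<otimes> (s ^^ j) (h (k - i - j)))
      = (\<Oplus>j\<in>{..k - i}. ?F i j)" for i
  proof -
    have "f i \<otimes> (s ^^ i) (\<Oplus>j\<in>{..k - i}. g j \<otimes> (s ^^ j) (h (k - i - j)))
       = f i \<otimes> (\<Oplus>j\<in>{..k - i}. (s ^^ i) (g j) \<otimes> (s ^^ (i + j)) (h (k - (i + j))))"
      by (subst s_pow_finsum) (auto simp: s_pow_mult funpow_add)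
    also have "\<dots> = (\<Oplus>j\<in>{..k - i}. ?F i j)"
      by (rule finsum_rdistr) auto
    finally show ?thesis .
  qed
  have "((f \<otimes>\<^bsub>P\<^esub> g) \<otimes>\<^bsub>P\<^esub> h) k = (\<Oplus>i\<in>{..k}. \<Oplus>j\<in>{..i}. ?F j (i - j))"
    unfolding mult_coeff 1 ..
  also have "\<dots> = (\<Oplus>i\<in>{..k}. \<Oplus>j\<in>{..k - i}. ?F i j)"
    by (rule finsum_triangle) auto
  also have "\<dots> = (f \<otimes>\<^bsub>P\<^esub> (g \<otimes>\<^bsub>P\<^esub> h)) k"
    unfolding mult_coeff 2 ..
  finally show "((f \<otimes>\<^bsub>P\<^esub> g) \<otimes>\<^bsub>P\<^esub> h) k = (f \<otimes>\<^bsub>P\<^esub> (g \<otimes>\<^bsub>P\<^esub> h)) k" .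
qed

lemma coeff_skew_monom: "skew_monom S a j i = (if i = j then a else \<zero>)"
  by (simp add: skew_monom_def)

lemma monom_closed: "a \<in> carrier S \<Longrightarrow> skew_monom S a j \<in> carrier P"
  unfolding carrier_iff coeff_skew_monom by auto

lemma monom_mult_coeff:
  assumes "a \<in> carrier S" "g \<in> carrier P"
  shows "(skew_monom S a j \<otimes>\<^bsub>P\<^esub> g) k = (if k < j then \<zero> else a \<otimes> (s ^^ j) (g (k - j)))"
proof -
  note [simp] = coeff_closed[OF assms(2)]
  have "(skew_monom S a j \<otimes>\<^bsub>P\<^esub> g) k =
      (\<Oplus>i\<in>{..k}. if j = i then a \<otimes> (s ^^ j) (g (k - j)) else \<zero>)"
    unfolding mult_coeff coeff_skew_monom using assms by (intro finsum_cong') auto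
  also have "\<dots> = (if k < j then \<zero> else a \<otimes> (s ^^ j) (g (k - j)))"
  proof (cases "k < j")
    case True
    then show ?thesis by (auto intro!: add.finprod_one_eqI)
  next
    case False
    then show ?thesis
      using assms add.finprod_singleton[of j "{..k}" "\<lambda>_. a \<otimes> (s ^^ j) (g (k - j))"] by auto
  qed
  finally show ?thesis .
qed

lemma one_eq_monom: "\<one>\<^bsub>P\<^esub> = skew_monom S \<one> 0"
  by (auto simp: one_coeff coeff_skew_monom)

lemma is_ring: "ring P"
proof (intro ringI abelian_groupI monoidI)
  fix f g h assume f: "f \<in> carrier P" and g: "g \<in> carrier P" and h: "h \<in> carrier P"
  note [simp] = coeff_closed[OF f] coeff_closed[OF g] coeff_closed[OF h]
  show "f \<otimes>\<^bsub>P\<^esub> g \<in> carrier P" by (rule mult_closed[OF f g])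
  show "f \<oplus>\<^bsub>P\<^esub> g \<in> carrier P" by (rule add_closed[OF f g])
  show "f \<oplus>\<^bsub>P\<^esub> g \<oplus>\<^bsub>P\<^esub> h = f \<oplus>\<^bsub>P\<^esub> (g \<oplus>\<^bsub>P\<^esub> h)"
    using f g h by (auto simp: add_coeff a_assoc)
  show "f \<oplus>\<^bsub>P\<^esub> g = g \<oplus>\<^bsub>P\<^esub> f"
    using f g by (auto simp: add_coeff a_comm)
  show "f \<otimes>\<^bsub>P\<^esub> g \<otimes>\<^bsub>P\<^esub> h = f \<otimes>\<^bsub>P\<^esub> (g \<otimes>\<^bsub>P\<^esub> h)" by (rule mult_assoc[OF f g h])
  show "(f \<oplus>\<^bsub>P\<^esub> g) \<otimes>\<^bsub>P\<^esub> h = f \<otimes>\<^bsub>P\<^esub> h \<oplus>\<^bsub>P\<^esub> g \<otimes>\<^bsub>P\<^esub> h"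
    using f g h by (auto simp: add_coeff mult_coeff l_distr finsum_addf fun_eq_iff)
  show "h \<otimes>\<^bsub>P\<^esub> (f \<oplus>\<^bsub>P\<^esub> g) = h \<otimes>\<^bsub>P\<^esub> f \<oplus>\<^bsub>P\<^esub> h \<otimes>\<^bsub>P\<^esub> g"
    using f g h by (auto simp: add_coeff mult_coeff r_distr finsum_addf s_pow_add fun_eq_iff)
next
  show "\<one>\<^bsub>P\<^esub> \<in> carrier P" unfolding one_eq_monom by (rule monom_closed) simp
  show "\<zero>\<^bsub>P\<^esub> \<in> carrier P" unfolding carrier_iff by (simp add: zero_coeff)
next
  fix f assume f: "f \<in> carrier P"
  note [simp] = coeff_closed[OF f]
  show "\<zero>\<^bsub>P\<^esub> \<oplus>\<^bsub>P\<^esub> f = f" using f by (auto simp: add_coeff zero_coeff)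
  show "\<one>\<^bsub>P\<^esub> \<otimes>\<^bsub>P\<^esub> f = f"
    using f by (auto simp: one_eq_monom monom_mult_coeff)
  show "f \<otimes>\<^bsub>P\<^esub> \<one>\<^bsub>P\<^esub> = f"
  proof
    fix k
    have "(f \<otimes>\<^bsub>P\<^esub> \<one>\<^bsub>P\<^esub>) k = (\<Oplus>i\<in>{..k}. if k = i then f i else \<zero>)"
      unfolding mult_coeff one_coeff using f by (intro finsum_cong') auto
    also have "\<dots> = f k" using f add.finprod_singleton[of k "{..k}" f] by auto
    finally show "(f \<otimes>\<^bsub>P\<^esub> \<one>\<^bsub>P\<^esub>) k = f k" .
  qed
  obtain N where "\<forall>i>N. f i = \<zero>" using f carrier_iff by metis
  then have "(\<lambda>i. \<ominus> f i) \<in> carrier P" using f unfolding carrier_iff by auto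
  moreover have "(\<lambda>i. \<ominus> f i) \<oplus>\<^bsub>P\<^esub> f = \<zero>\<^bsub>P\<^esub>"
    using f by (auto simp: add_coeff zero_coeff l_neg)
  ultimately show "\<exists>g\<in>carrier P. g \<oplus>\<^bsub>P\<^esub> f = \<zero>\<^bsub>P\<^esub>" by blast
qed

sublocale P: ring P by (rule is_ring)

lemma a_inv_coeff: assumes "f \<in> carrier P" shows "(\<ominus>\<^bsub>P\<^esub> f) k = \<ominus> (f k)"
proof -
  note [simp] = coeff_closed[OF assms] coeff_closed[OF P.a_inv_closed[OF assms]]
  have "(\<ominus>\<^bsub>P\<^esub> f \<oplus>\<^bsub>P\<^esub> f) k = \<zero>" using assms by (simp add: P.l_neg zero_coeff)
  then show ?thesis using assms by (simp add: add_coeff minus_equality)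
qed

lemma minus_coeff:
  assumes "f \<in> carrier P" "g \<in> carrier P" shows "(f \<ominus>\<^bsub>P\<^esub> g) k = f k \<ominus> g k"
  using assms by (simp add: a_minus_def add_coeff a_inv_coeff)

lemma monom_mult_monom:
  assumes "a \<in> carrier S" "b \<in> carrier S"
  shows "skew_monom S a i \<otimes>\<^bsub>P\<^esub> skew_monom S b j = skew_monom S (a \<otimes> (s ^^ i) b) (i + j)"
  using assms by (auto simp: monom_mult_coeff monom_closed coeff_skew_monom fun_eq_iff)

lemma monom_pow: "skew_monom S \<one> 1 [^]\<^bsub>P\<^esub> (i::nat) = skew_monom S \<one> i"
  by (induction i) (auto simp: one_eq_monom monom_mult_monom)

lemma degree_gt: assumes "f \<in> carrier P" "i > skew_degree S f" shows "f i = \<zero>"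
proof -
  obtain N where "\<forall>i>N. f i = \<zero>" using assms carrier_iff by metis
  then have "\<forall>i>skew_degree S f. f i = \<zero>" unfolding skew_degree_def by (rule LeastI)
  then show ?thesis using assms by simp
qed

lemma degree_le: assumes "\<And>i. i > N \<Longrightarrow> f i = \<zero>" shows "skew_degree S f \<le> N"
  unfolding skew_degree_def by (rule Least_le) (use assms in auto)

lemma degree_ge: assumes "f \<in> carrier P" "f i \<noteq> \<zero>" shows "i \<le> skew_degree S f"
  using degree_gt[OF assms(1), of i] assms(2) by force

lemma lead_nonzero: assumes "f \<in> carrier P" "f \<noteq> \<zero>\<^bsub>P\<^esub>" shows "f (skew_degree S f) \<noteq> \<zero>"
proof
  assume z: "f (skew_degree S f) = \<zero>"
  obtain i where i: "f i \<noteq> \<zero>" using assms(2) by (auto simp: zero_coeff fun_eq_iff)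
  then have "i \<le> skew_degree S f" by (rule degree_ge[OF assms(1)])
  then have pos: "skew_degree S f > 0" using i z by (cases "i = skew_degree S f") auto
  have "skew_degree S f \<le> skew_degree S f - 1"
  proof (rule degree_le)
    fix j assume "skew_degree S f - 1 < j"
    then show "f j = \<zero>" using z degree_gt[OF assms(1), of j] by (cases "j = skew_degree S f") auto
  qed
  then show False using pos by simp
qed

lemma degree_less:
  assumes "f \<in> carrier P" "f \<noteq> \<zero>\<^bsub>P\<^esub>" "\<And>i. i \<ge> N \<Longrightarrow> f i = \<zero>" shows "skew_degree S f < N"
  by (rule ccontr) (use lead_nonzero[OF assms(1,2)] assms(3)[of "skew_degree S f"] in simp)

text \<open>
  All other terms of the coefficient at \<open>a + b\<close> vanish: one of the two indices exceeds its bound.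
  The degree of a product is read off from this coefficient.
\<close>
lemma mult_coeff_top:
  assumes "f \<in> carrier P" "g \<in> carrier P" "\<forall>i>a. f i = \<zero>" "\<forall>i>b. g i = \<zero>"
  shows "(f \<otimes>\<^bsub>P\<^esub> g) (a + b) = f a \<otimes> (s ^^ a) (g b)"
proof -
  note [simp] = coeff_closed[OF assms(1)] coeff_closed[OF assms(2)]
  have "(f \<otimes>\<^bsub>P\<^esub> g) (a + b) = (\<Oplus>i\<in>{..a + b}. if a = i then f a \<otimes> (s ^^ a) (g b) else \<zero>)"
    unfolding mult_coeff
  proof (intro finsum_cong')
    fix i assume "i \<in> {..a + b}"
    consider "i < a" | "i = a" | "i > a" by linarith
    then show "f i \<otimes> (s ^^ i) (g (a + b - i)) = (if a = i then f a \<otimes> (s ^^ a) (g b) else \<zero>)"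
    proof cases
      case 1
      then have "a + b - i > b" by simp
      then have "g (a + b - i) = \<zero>" using assms(4) by blast
      then show ?thesis using assms(1) 1 by simp
    next
      case 3
      then have "f i = \<zero>" using assms(3) by blast
      then show ?thesis using assms(2) 3 by simp
    qed simp
  qed (use assms(1,2) in auto)
  also have "\<dots> = f a \<otimes> (s ^^ a) (g b)"
    by (rule add.finprod_singleton) (use assms(1,2) in auto)
  finally show ?thesis .
qed

text \<open>
  If \<open>a\<close> is the leading coefficient of \<open>f\<close>, subtracting \<open>a y^j g\<close> with \<open>j = deg f - deg g\<close>
  cancels the leading term, because the leading coefficient of \<open>y^j g\<close> is \<open>s^j(1) = 1\<close>. The
  condition on the remainder is stated by coefficients because the zero polynomial has degree 0.
\<close>
lemma division_right:
  assumes g: "g \<in> carrier P" "skew_monic S g" and f: "f \<in> carrier P"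
  shows "\<exists>u\<in>carrier P. \<exists>r\<in>carrier P. f = u \<otimes>\<^bsub>P\<^esub> g \<oplus>\<^bsub>P\<^esub> r \<and> (\<forall>i\<ge>skew_degree S g. r i = \<zero>)"
proof -
  have "\<exists>u\<in>carrier P. \<exists>r\<in>carrier P. f = u \<otimes>\<^bsub>P\<^esub> g \<oplus>\<^bsub>P\<^esub> r \<and> (\<forall>i\<ge>skew_degree S g. r i = \<zero>)"
    if "f \<in> carrier P" "\<forall>i\<ge>N. f i = \<zero>" for N f
    using that
  proof (induction N arbitrary: f)
    case 0
    then have "f = \<zero>\<^bsub>P\<^esub>" by (auto simp: zero_coeff)
    then have "f = \<zero>\<^bsub>P\<^esub> \<otimes>\<^bsub>P\<^esub> g \<oplus>\<^bsub>P\<^esub> \<zero>\<^bsub>P\<^esub>" using g(1) by simp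
    moreover have "\<forall>i\<ge>skew_degree S g. \<zero>\<^bsub>P\<^esub> i = \<zero>" by (simp add: zero_coeff)
    ultimately show ?case using P.zero_closed by blast
  next
    case (Suc N)
    note f = Suc.prems(1)
    note [simp] = coeff_closed[OF f] coeff_closed[OF g(1)]
    show ?case
    proof (cases "N < skew_degree S g")
      case True
      then show ?thesis using Suc.prems g
        by (intro bexI[of _ "\<zero>\<^bsub>P\<^esub>"] bexI[of _ f]) auto
    next
      case False
      define j where "j = N - skew_degree S g"
      define q where "q = skew_monom S (f N) j"
      have q: "q \<in> carrier P" unfolding q_def by (rule monom_closed) simp
      have qg: "(q \<otimes>\<^bsub>P\<^esub> g) k = (if k < j then \<zero> else f N \<otimes> (s ^^ j) (g (k - j)))" for k
        unfolding q_def by (rule monom_mult_coeff) (simp_all add: g)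
      have mc: "(f \<ominus>\<^bsub>P\<^esub> q \<otimes>\<^bsub>P\<^esub> g) k = f k \<ominus> (q \<otimes>\<^bsub>P\<^esub> g) k" for k
        by (rule minus_coeff) (use f q g in auto)
      have "(f \<ominus>\<^bsub>P\<^esub> q \<otimes>\<^bsub>P\<^esub> g) k = \<zero>" if "k \<ge> N" for k
      proof (cases "k = N")
        case True
        then have "k - j = skew_degree S g" using False by (simp add: j_def)
        then have "(q \<otimes>\<^bsub>P\<^esub> g) k = f k"
          using g(2) True False by (auto simp: qg skew_monic_def j_def)
        then show ?thesis unfolding mc by (simp add: a_minus_def r_neg)
      next
        case k: False
        then have "skew_degree S g < k - j" using that False by (simp add: j_def)
        then have "g (k - j) = \<zero>" by (rule degree_gt[OF g(1)])
        then have "(q \<otimes>\<^bsub>P\<^esub> g) k = \<zero>" by (simp add: qg)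
        moreover have "f k = \<zero>" using Suc.prems(2) that k by simp
        ultimately show ?thesis unfolding mc by (simp add: a_minus_def)
      qed
      moreover have "f \<ominus>\<^bsub>P\<^esub> q \<otimes>\<^bsub>P\<^esub> g \<in> carrier P" using f q g by simp
      ultimately obtain u r where ur: "u \<in> carrier P" "r \<in> carrier P"
        "f \<ominus>\<^bsub>P\<^esub> q \<otimes>\<^bsub>P\<^esub> g = u \<otimes>\<^bsub>P\<^esub> g \<oplus>\<^bsub>P\<^esub> r" "\<forall>i\<ge>skew_degree S g. r i = \<zero>"
        using Suc.IH[of "f \<ominus>\<^bsub>P\<^esub> q \<otimes>\<^bsub>P\<^esub> g"] by blast
      have "f = q \<otimes>\<^bsub>P\<^esub> g \<oplus>\<^bsub>P\<^esub> (f \<ominus>\<^bsub>P\<^esub> q \<otimes>\<^bsub>P\<^esub> g)"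
        using f q g by (simp add: a_minus_def P.a_lcomm P.r_neg)
      also have "\<dots> = (q \<oplus>\<^bsub>P\<^esub> u) \<otimes>\<^bsub>P\<^esub> g \<oplus>\<^bsub>P\<^esub> r"
        unfolding ur(3) using q g(1) ur(1,2) by (simp add: P.l_distr P.a_assoc)
      finally show ?thesis using q ur by (intro bexI[of _ "q \<oplus>\<^bsub>P\<^esub> u"] bexI[of _ r]) auto
    qed
  qed
  moreover obtain N where "\<forall>i>N. f i = \<zero>" using f carrier_iff by metis
  then have "\<forall>i\<ge>Suc N. f i = \<zero>" by simp
  ultimately show ?thesis using f by blast
qed

text \<open>
  The coefficient of \<open>u g\<close> in the top degree is \<open>a s^i(1) = a\<close>, where \<open>a\<close> is the leading
  coefficient of \<open>u\<close> and \<open>i\<close> its degree; monic polynomials are therefore right cancellable over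
  any coefficient ring.
\<close>
lemma mult_monic:
  assumes "u \<in> carrier P" "g \<in> carrier P" "skew_monic S g" "u \<noteq> \<zero>\<^bsub>P\<^esub>"
  shows "(u \<otimes>\<^bsub>P\<^esub> g) (skew_degree S u + skew_degree S g) = u (skew_degree S u)"
    and "skew_degree S (u \<otimes>\<^bsub>P\<^esub> g) = skew_degree S u + skew_degree S g"
    and "u \<otimes>\<^bsub>P\<^esub> g \<noteq> \<zero>\<^bsub>P\<^esub>"
proof -
  note [simp] = coeff_closed[OF assms(1)]
  have *: "\<forall>i>skew_degree S u. u i = \<zero>" "\<forall>i>skew_degree S g. g i = \<zero>"
    using degree_gt assms(1,2) by blast+
  show 1: "(u \<otimes>\<^bsub>P\<^esub> g) (skew_degree S u + skew_degree S g) = u (skew_degree S u)"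
    using mult_coeff_top[OF assms(1,2) *] assms(3) by (simp add: skew_monic_def)
  with lead_nonzero[OF assms(1,4)]
  have 2: "(u \<otimes>\<^bsub>P\<^esub> g) (skew_degree S u + skew_degree S g) \<noteq> \<zero>" by simp
  then show "u \<otimes>\<^bsub>P\<^esub> g \<noteq> \<zero>\<^bsub>P\<^esub>" by (auto simp: zero_coeff)
  show "skew_degree S (u \<otimes>\<^bsub>P\<^esub> g) = skew_degree S u + skew_degree S g"
  proof (rule antisym)
    show "skew_degree S (u \<otimes>\<^bsub>P\<^esub> g) \<le> skew_degree S u + skew_degree S g"
      by (rule degree_le) (rule mult_coeff_zero[OF assms(1,2) *])
    show "skew_degree S u + skew_degree S g \<le> skew_degree S (u \<otimes>\<^bsub>P\<^esub> g)"
      by (rule degree_ge[of "u \<otimes>\<^bsub>P\<^esub> g", OF _ 2]) (use assms in simp)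
  qed
qed

lemma monic_cancel:
  assumes "u \<in> carrier P" "v \<in> carrier P" "g \<in> carrier P" "skew_monic S g"
    "u \<otimes>\<^bsub>P\<^esub> g = v \<otimes>\<^bsub>P\<^esub> g"
  shows "u = v"
proof (rule ccontr)
  assume "u \<noteq> v"
  then have "u \<ominus>\<^bsub>P\<^esub> v \<noteq> \<zero>\<^bsub>P\<^esub>" using assms by simp
  moreover have "(u \<ominus>\<^bsub>P\<^esub> v) \<otimes>\<^bsub>P\<^esub> g = u \<otimes>\<^bsub>P\<^esub> g \<ominus>\<^bsub>P\<^esub> v \<otimes>\<^bsub>P\<^esub> g"
    using assms(1-3) by (simp add: a_minus_def P.l_distr P.l_minus)
  then have "(u \<ominus>\<^bsub>P\<^esub> v) \<otimes>\<^bsub>P\<^esub> g = \<zero>\<^bsub>P\<^esub>" using assms by simp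
  ultimately show False using mult_monic(3)[of "u \<ominus>\<^bsub>P\<^esub> v" g] assms by simp
qed

lemma mult_monom_coeff:
  assumes "a \<in> carrier S" "f \<in> carrier P"
  shows "(f \<otimes>\<^bsub>P\<^esub> skew_monom S a j) k = (if k < j then \<zero> else f (k - j) \<otimes> (s ^^ (k - j)) a)"
proof -
  note [simp] = coeff_closed[OF assms(2)]
  have "(f \<otimes>\<^bsub>P\<^esub> skew_monom S a j) k =
      (\<Oplus>i\<in>{..k}. if k - j = i \<and> j \<le> k then f (k - j) \<otimes> (s ^^ (k - j)) a else \<zero>)"
    unfolding mult_coeff coeff_skew_monom using assms by (intro finsum_cong') auto
  also have "\<dots> = (if k < j then \<zero> else f (k - j) \<otimes> (s ^^ (k - j)) a)"
  proof (cases "k < j")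
    case True
    then show ?thesis by (auto intro!: add.finprod_one_eqI)
  next
    case False
    then show ?thesis
      using assms add.finprod_singleton[of "k - j" "{..k}" "\<lambda>_. f (k - j) \<otimes> (s ^^ (k - j)) a"]
      by auto
  qed
  finally show ?thesis .
qed

end

section \<open>Left ideals of a cyclic quotient of a skew polynomial ring\<close>

text \<open>
  This is the shape of the identification of \<open>R\<close> with \<open>K[y;s]/(y^n - c)\<close>: the powers
  \<open>1, \<pi>, \<dots>, \<pi>^(n-1)\<close> form a basis of \<open>R\<close> over the subfield \<open>K\<close>, conjugation by \<open>\<pi>\<close>
  is \<open>s\<close> on \<open>K\<close>, and \<open>\<pi>^n = c\<close>. The quotient ring itself is never formed; evaluation at
  \<open>\<pi>\<close> takes the place of the quotient map.
\<close>
locale cyclic_skew = ring R for R (structure) +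
  fixes K s \<pi> c and n :: nat
  assumes K: "subfield K R"
    and s_hom: "s \<in> ring_hom (R\<lparr>carrier := K\<rparr>) (R\<lparr>carrier := K\<rparr>)"
    and pi_closed [simp, intro]: "\<pi> \<in> carrier R"
    and pi_comm: "x \<in> K \<Longrightarrow> \<pi> \<otimes> x = s x \<otimes> \<pi>"
    and n_pos: "n \<ge> 1"
    and c_closed: "c \<in> K" and c_nonzero: "c \<noteq> \<zero>"
    and pi_pow: "\<pi> [^] n = c"
    and normal_form: "x \<in> carrier R \<Longrightarrow> \<exists>f. (\<forall>i. f i \<in> K) \<and> x = (\<Oplus>i\<in>{..<n}. f i \<otimes> \<pi> [^] i)"
    and normal_form_unique:
      "(\<And>i. f i \<in> K) \<Longrightarrow> (\<Oplus>i\<in>{..<n}. f i \<otimes> \<pi> [^] i) = \<zero> \<Longrightarrow> i < n \<Longrightarrow> f i = \<zero>"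
begin

abbreviation "KR \<equiv> R\<lparr>carrier := K\<rparr>"

lemma K_subring: "subring K R" by (rule subfieldE(1)[OF K])
lemma K_carrier [simp, intro]: "x \<in> K \<Longrightarrow> x \<in> carrier R" using subfieldE(3)[OF K] by blast

sublocale S: skew_poly KR s
  by (intro skew_poly.intro skew_poly_axioms.intro subring_is_ring[OF K_subring] s_hom)

abbreviation "P \<equiv> skew_poly_ring KR s"

text \<open>
  The sums run in different carriers, and each is unspecified once a summand leaves its carrier;
  hence the hypothesis.
\<close>
lemma finsum_K:
  assumes "f \<in> A \<rightarrow> K" shows "finsum KR f A = finsum R f A"
proof (cases "finite A")
  case True
  then show ?thesis using assms
    by (induction A rule: finite_induct) (auto simp: Pi_iff)
next
  case False
  then show ?thesis by (simp add: finsum_def finprod_def)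
qed

lemma pi_pow_comm: "x \<in> K \<Longrightarrow> \<pi> [^] (i::nat) \<otimes> x = (s ^^ i) x \<otimes> \<pi> [^] i"
proof (induction i)
  case (Suc i)
  then have sx: "(s ^^ i) x \<in> K" using S.s_pow_closed[of x i] by simp
  then have ssx: "s ((s ^^ i) x) \<in> K" using S.s_pow_closed[of "(s ^^ i) x" 1] by simp
  have pow: "\<pi> [^] Suc i = \<pi> \<otimes> \<pi> [^] i" by (rule nat_pow_Suc2) simp
  have "\<pi> [^] Suc i \<otimes> x = \<pi> \<otimes> (\<pi> [^] i \<otimes> x)"
    unfolding pow using Suc.prems by (simp add: m_assoc)
  also have "\<dots> = (\<pi> \<otimes> (s ^^ i) x) \<otimes> \<pi> [^] i"
    using Suc sx by (simp add: m_assoc)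
  also have "\<dots> = s ((s ^^ i) x) \<otimes> \<pi> [^] Suc i"
    unfolding pow using sx ssx by (simp add: pi_comm m_assoc)
  finally show ?case by simp
qed simp

lemma coeff_K: "f \<in> carrier P \<Longrightarrow> f i \<in> K"
  using S.coeff_closed[of f i] by simp

definition eval_pi where "eval_pi f = (\<Oplus>i\<in>{i. f i \<noteq> \<zero>}. f i \<otimes> \<pi> [^] (i::nat))"

lemma eval_pi_bound:
  assumes "f \<in> carrier P" "finite A" "\<And>i. i \<notin> A \<Longrightarrow> f i = \<zero>"
  shows "eval_pi f = (\<Oplus>i\<in>A. f i \<otimes> \<pi> [^] i)"
  unfolding eval_pi_def
  by (rule add.finprod_mono_neutral_cong_left) (use assms coeff_K[OF assms(1)] in auto)

lemma eval_pi_closed [simp]: "f \<in> carrier P \<Longrightarrow> eval_pi f \<in> carrier R"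
  unfolding eval_pi_def by (rule finsum_closed) (auto dest: coeff_K)

lemma eval_pi_add: assumes "f \<in> carrier P" "g \<in> carrier P"
  shows "eval_pi (f \<oplus>\<^bsub>P\<^esub> g) = eval_pi f \<oplus> eval_pi g"
proof -
  note [simp] = coeff_K[OF assms(1)] coeff_K[OF assms(2)]
  obtain a b where ab: "\<forall>i>a. f i = \<zero>" "\<forall>i>b. g i = \<zero>"
    using assms S.carrier_iff by auto
  have "eval_pi (f \<oplus>\<^bsub>P\<^esub> g) = (\<Oplus>i\<in>{..max a b}. (f i \<otimes> \<pi> [^] i) \<oplus> (g i \<otimes> \<pi> [^] i))"
    using assms ab
    by (subst eval_pi_bound[of _ "{..max a b}"]) (auto simp: S.add_coeff l_distr intro!: finsum_cong')
  also have "\<dots> = eval_pi f \<oplus> eval_pi g"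
    using assms ab
    by (subst (1 2) eval_pi_bound[of _ "{..max a b}"]) (auto intro!: finsum_addf)
  finally show ?thesis .
qed

text \<open>
  Moving \<open>\<pi>^i\<close> past \<open>g\<^sub>j\<close> gives \<open>(f\<^sub>i \<pi>^i)(g\<^sub>j \<pi>^j) = f\<^sub>i s^i(g\<^sub>j) \<pi>^(i+j)\<close>, which is the
  twist in the definition of the skew product; the rest is a reordering of the double sum.
\<close>
lemma eval_pi_mult: assumes "f \<in> carrier P" "g \<in> carrier P"
  shows "eval_pi (f \<otimes>\<^bsub>P\<^esub> g) = eval_pi f \<otimes> eval_pi g"
proof -
  note [simp] = coeff_K[OF assms(1)] coeff_K[OF assms(2)]
  obtain a b where a: "\<And>i. i > a \<Longrightarrow> f i = \<zero>" and b: "\<And>i. i > b \<Longrightarrow> g i = \<zero>"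
    using assms S.carrier_iff by auto
  have fg: "(f \<otimes>\<^bsub>P\<^esub> g) k = \<zero>" if "k > a + b" for k
    using S.mult_coeff_zero[OF assms _ _ that] a b by simp
  have sK [simp]: "(s ^^ i) (g j) \<in> K" for i j using S.s_pow_closed[of "g j" i] by simp
  have KK [simp]: "x \<otimes> y \<in> K" if "x \<in> K" "y \<in> K" for x y
    using subringE(6)[OF K_subring] that by blast
  let ?F = "\<lambda>i j. (f i \<otimes> \<pi> [^] i) \<otimes> (g j \<otimes> \<pi> [^] j)"
  have F: "?F i j = f i \<otimes> (s ^^ i) (g j) \<otimes> \<pi> [^] (i + j)" for i j
  proof -
    have "?F i j = f i \<otimes> (\<pi> [^] i \<otimes> g j) \<otimes> \<pi> [^] j" by (simp add: m_assoc)
    also have "\<dots> = f i \<otimes> (s ^^ i) (g j) \<otimes> \<pi> [^] (i + j)"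
      by (simp add: pi_pow_comm m_assoc nat_pow_mult[symmetric])
    finally show ?thesis .
  qed
  have "eval_pi (f \<otimes>\<^bsub>P\<^esub> g) = (\<Oplus>k\<in>{..a + b}. (f \<otimes>\<^bsub>P\<^esub> g) k \<otimes> \<pi> [^] k)"
    by (rule eval_pi_bound) (use assms fg in auto)
  also have "\<dots> = (\<Oplus>k\<in>{..a + b}. \<Oplus>i\<in>{..k}. ?F i (k - i))"
  proof (intro finsum_cong' refl)
    fix k
    have "(f \<otimes>\<^bsub>P\<^esub> g) k = (\<Oplus>i\<in>{..k}. f i \<otimes> (s ^^ i) (g (k - i)))"
      unfolding S.mult_coeff by (subst finsum_K) auto
    then have "(f \<otimes>\<^bsub>P\<^esub> g) k \<otimes> \<pi> [^] k = (\<Oplus>i\<in>{..k}. f i \<otimes> (s ^^ i) (g (k - i)) \<otimes> \<pi> [^] k)"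
      by (simp add: finsum_ldistr)
    also have "\<dots> = (\<Oplus>i\<in>{..k}. ?F i (k - i))"
      by (intro finsum_cong' refl) (auto simp: F)
    finally show "(f \<otimes>\<^bsub>P\<^esub> g) k \<otimes> \<pi> [^] k = (\<Oplus>i\<in>{..k}. ?F i (k - i))" .
  qed (auto intro!: finsum_closed)
  also have "\<dots> = (\<Oplus>i\<in>{..a + b}. \<Oplus>j\<in>{..a + b - i}. ?F i j)"
    by (rule finsum_triangle) auto
  also have "\<dots> = (\<Oplus>i\<in>{..a + b}. (f i \<otimes> \<pi> [^] i) \<otimes> eval_pi g)"
  proof (intro finsum_cong' refl)
    fix i
    show "(\<Oplus>j\<in>{..a + b - i}. ?F i j) = (f i \<otimes> \<pi> [^] i) \<otimes> eval_pi g"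
    proof (cases "i > a")
      case True
      then show ?thesis using assms a by (auto intro!: add.finprod_one_eqI)
    next
      case False
      then have "eval_pi g = (\<Oplus>j\<in>{..a + b - i}. g j \<otimes> \<pi> [^] j)"
        by (intro eval_pi_bound) (use assms b in auto)
      then show ?thesis by (simp add: finsum_rdistr)
    qed
  qed (use assms in auto)
  also have "\<dots> = (\<Oplus>i\<in>{..a + b}. f i \<otimes> \<pi> [^] i) \<otimes> eval_pi g"
    by (rule finsum_ldistr[symmetric]) (use assms in auto)
  also have "(\<Oplus>i\<in>{..a + b}. f i \<otimes> \<pi> [^] i) = eval_pi f"
    by (rule eval_pi_bound[symmetric]) (use assms a in auto)
  finally show ?thesis .
qed

lemma eval_pi_monom: assumes "a \<in> K" shows "eval_pi (skew_monom KR a j) = a \<otimes> \<pi> [^] j"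
proof -
  have "eval_pi (skew_monom KR a j) = (\<Oplus>i\<in>{j}. skew_monom KR a j i \<otimes> \<pi> [^] i)"
    by (rule eval_pi_bound) (use assms S.monom_closed[of a j] in \<open>auto simp: S.coeff_skew_monom\<close>)
  then show ?thesis using assms by (simp add: S.coeff_skew_monom)
qed

lemma eval_pi_hom: "eval_pi \<in> ring_hom P R"
proof (rule ring_hom_memI)
  have "\<one> \<in> K" using subringE(3)[OF K_subring] .
  then show "eval_pi \<one>\<^bsub>P\<^esub> = \<one>" unfolding S.one_eq_monom by (simp add: eval_pi_monom)
qed (auto simp: eval_pi_add eval_pi_mult)

sublocale ev: ring_hom_ring P R eval_pi
  by (intro ring_hom_ringI2 S.is_ring ring_axioms eval_pi_hom)

definition "modulus = (skew_monom KR \<one> 1 [^]\<^bsub>P\<^esub> n) \<ominus>\<^bsub>P\<^esub> skew_monom KR c 0"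

lemma one_K [simp, intro]: "\<one> \<in> K" by (rule subringE(3)[OF K_subring])
lemma zero_K [simp, intro]: "\<zero> \<in> K" by (rule subringE(2)[OF K_subring])

lemma one_neq_zero: "\<one> \<noteq> \<zero>" by (rule subfieldE(6)[OF K])

lemma K_comm: "x \<in> K \<Longrightarrow> y \<in> K \<Longrightarrow> x \<otimes> y = y \<otimes> x"
  using subfieldE(4)[OF K] by blast

lemma K_cancel:
  assumes "x \<in> K" "y \<in> K" "z \<in> K" "z \<noteq> \<zero>" "x \<otimes> z = y \<otimes> z" shows "x = y"
proof -
  have z: "inv z \<in> carrier R" "z \<otimes> inv z = \<one>"
    using subfield_m_inv[OF K, of z] assms by auto
  have "x \<otimes> (z \<otimes> inv z) = y \<otimes> (z \<otimes> inv z)"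
    using assms z(1) by (simp flip: m_assoc)
  then show ?thesis using assms z by simp
qed

lemma modulus_alt: "modulus = skew_monom KR \<one> n \<ominus>\<^bsub>P\<^esub> skew_monom KR c 0"
  unfolding modulus_def using S.monom_pow[of n] by simp

lemma monom_P [simp, intro]: "a \<in> K \<Longrightarrow> skew_monom KR a j \<in> carrier P"
  by (rule S.monom_closed) simp

lemma modulus_closed [simp, intro]: "modulus \<in> carrier P"
  unfolding modulus_alt using c_closed by simp

text \<open>
  The constant \<open>c\<close> does not reach these coefficients, as \<open>n \<ge> 1\<close>.
\<close>
lemma modulus_coeff: "k \<ge> n \<Longrightarrow> modulus k = (if k = n then \<one> else \<zero>)"
proof -
  assume k: "k \<ge> n"
  have "modulus k = skew_monom KR \<one> n k \<ominus>\<^bsub>KR\<^esub> skew_monom KR c 0 k"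
    unfolding modulus_alt by (rule S.minus_coeff) (use c_closed in auto)
  also have "skew_monom KR c 0 k = \<zero>\<^bsub>KR\<^esub>"
    using k n_pos by (simp add: S.coeff_skew_monom)
  finally have "modulus k = skew_monom KR \<one> n k \<oplus>\<^bsub>KR\<^esub> \<zero>\<^bsub>KR\<^esub>"
    by (simp only: a_minus_def S.minus_zero)
  then show ?thesis by (simp add: S.coeff_skew_monom)
qed

lemma modulus_degree: "skew_degree KR modulus = n"
proof (rule antisym)
  show "skew_degree KR modulus \<le> n" by (rule S.degree_le) (simp add: modulus_coeff)
  show "n \<le> skew_degree KR modulus"
    by (intro S.degree_ge) (simp_all add: modulus_coeff one_neq_zero)
qed

lemma modulus_monic: "skew_monic KR modulus"
  unfolding skew_monic_def modulus_degree by (simp add: modulus_coeff)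

lemma eval_modulus: "eval_pi modulus = \<zero>"
  unfolding modulus_alt a_minus_def using c_closed
  by (simp add: eval_pi_monom pi_pow r_neg)

text \<open>
  The power \<open>c\<close> of \<open>\<pi>\<close> commutes with \<open>\<pi>\<close>, so \<open>s(c) \<pi> = c \<pi>\<close>; multiplying by
  \<open>\<pi>^(n-1)\<close> turns \<open>\<pi>\<close> into the invertible element \<open>c\<close> of \<open>K\<close>, which cancels.
\<close>
lemma s_c: "s c = c"
proof -
  have sc: "s c \<in> K" using S.s_pow_closed[of c 1] c_closed by simp
  have pow: "\<pi> [^] n = \<pi> \<otimes> \<pi> [^] (n - 1)"
    using n_pos nat_pow_Suc2[of \<pi> "n - 1"] by simp
  have "s c \<otimes> \<pi> = \<pi> \<otimes> c" using pi_comm c_closed by simp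
  also have "\<dots> = c \<otimes> \<pi>" unfolding pi_pow[symmetric] by (metis nat_pow_Suc nat_pow_Suc2 pi_closed)
  finally have "s c \<otimes> \<pi> \<otimes> \<pi> [^] (n - 1) = c \<otimes> \<pi> \<otimes> \<pi> [^] (n - 1)" by simp
  then have "s c \<otimes> c = c \<otimes> c"
    using sc c_closed pow pi_pow by (simp add: m_assoc)
  then show ?thesis using K_cancel[OF sc c_closed c_closed c_nonzero] by simp
qed

lemma s_pow_c: "(s ^^ i) c = c"
  by (induction i) (simp_all add: s_c)

text \<open>
  The automorphism \<open>s^n\<close> is conjugation by \<open>\<pi>^n = c\<close>, which is trivial because \<open>c\<close> lies in the
  commutative \<open>K\<close>.
\<close>
lemma s_pow_n: assumes "x \<in> K" shows "(s ^^ n) x = x"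
proof (rule K_cancel[OF _ assms c_closed c_nonzero])
  show "(s ^^ n) x \<in> K" using S.s_pow_closed[of x n] assms by simp
  show "(s ^^ n) x \<otimes> c = x \<otimes> c"
    using pi_pow_comm[OF assms, of n] K_comm[OF assms c_closed] by (simp add: pi_pow)
qed

text \<open>
  Commuting with \<open>y^n\<close> is the identity \<open>s^n = 1\<close>, and commuting with the constant \<open>c\<close> is the
  identity \<open>s^k(c) = c\<close> together with commutativity of \<open>K\<close>.
\<close>
lemma modulus_central: assumes "f \<in> carrier P" shows "modulus \<otimes>\<^bsub>P\<^esub> f = f \<otimes>\<^bsub>P\<^esub> modulus"
proof -
  note [simp] = coeff_K[OF assms]
  have 1: "skew_monom KR \<one> n \<otimes>\<^bsub>P\<^esub> f = f \<otimes>\<^bsub>P\<^esub> skew_monom KR \<one> n"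
    using S.monom_mult_coeff[of \<one> f n] S.mult_monom_coeff[of \<one> f n] assms s_pow_n S.s_pow_one
    by (simp add: fun_eq_iff)
  have 2: "skew_monom KR c 0 \<otimes>\<^bsub>P\<^esub> f = f \<otimes>\<^bsub>P\<^esub> skew_monom KR c 0"
    using S.monom_mult_coeff[of c f 0] S.mult_monom_coeff[of c f 0] assms c_closed
    by (simp add: fun_eq_iff s_pow_c K_comm)
  show ?thesis
    unfolding modulus_alt a_minus_def using assms c_closed 1 2
    by (simp add: S.P.l_distr S.P.r_distr S.P.l_minus S.P.r_minus)
qed

lemma eval_pi_zero_small:
  assumes "f \<in> carrier P" "\<And>i. i \<ge> n \<Longrightarrow> f i = \<zero>" "eval_pi f = \<zero>"
  shows "f = \<zero>\<^bsub>P\<^esub>"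
proof -
  have "eval_pi f = (\<Oplus>i\<in>{..<n}. f i \<otimes> \<pi> [^] i)"
    by (rule eval_pi_bound) (use assms in auto)
  then have "f i = \<zero>" if "i < n" for i
    using normal_form_unique[of f i] coeff_K[OF assms(1)] assms(3) that by simp
  then have "f i = \<zero>" for i using assms(2) by (cases "i < n") auto
  then show ?thesis using S.zero_coeff by (auto simp: fun_eq_iff)
qed

text \<open>
  The remainder of \<open>f\<close> modulo \<open>y^n - c\<close> also evaluates to zero, and a polynomial of degree
  below \<open>n\<close> is determined by its value.
\<close>
lemma eval_pi_kernel:
  assumes "f \<in> carrier P" "eval_pi f = \<zero>"
  shows "\<exists>u\<in>carrier P. f = u \<otimes>\<^bsub>P\<^esub> modulus"
proof -
  obtain u r where ur: "u \<in> carrier P" "r \<in> carrier P" "f = u \<otimes>\<^bsub>P\<^esub> modulus \<oplus>\<^bsub>P\<^esub> r"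
      "\<forall>i\<ge>n. r i = \<zero>"
    using S.division_right[OF modulus_closed modulus_monic assms(1)] modulus_degree by auto
  have "eval_pi f = eval_pi r" using ur by (simp add: eval_modulus)
  then have "r = \<zero>\<^bsub>P\<^esub>" using eval_pi_zero_small[of r] ur assms by simp
  then show ?thesis using ur by auto
qed

lemma eval_pi_surj:
  assumes "x \<in> carrier R"
  shows "\<exists>f\<in>carrier P. x = eval_pi f \<and> (\<forall>i\<ge>n. f i = \<zero>)"
proof -
  obtain f where f: "\<And>i. f i \<in> K" "x = (\<Oplus>i\<in>{..<n}. f i \<otimes> \<pi> [^] i)"
    using normal_form[OF assms] by blast
  define g where "g = (\<lambda>i. if i < n then f i else \<zero>)"
  have g: "g \<in> carrier P" unfolding S.carrier_iff using f by (auto simp: g_def intro!: exI[of _ n])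
  have "eval_pi g = (\<Oplus>i\<in>{..<n}. g i \<otimes> \<pi> [^] i)"
    by (rule eval_pi_bound) (use g in \<open>auto simp: g_def\<close>)
  also have "\<dots> = x" unfolding f(2)
    by (intro finsum_cong') (use f(1) in \<open>auto simp: g_def\<close>)
  finally show ?thesis using g by (intro bexI[of _ g]) (auto simp: g_def)
qed

definition "minimal C g \<longleftrightarrow> g \<in> carrier P \<and> skew_monic KR g \<and> eval_pi g \<in> C \<and>
  (\<forall>f\<in>carrier P. f \<noteq> \<zero>\<^bsub>P\<^esub> \<longrightarrow> eval_pi f \<in> C \<longrightarrow> skew_degree KR g \<le> skew_degree KR f)"

context
  fixes C assumes C: "left_ideal C R" "C \<noteq> {\<zero>}"
begin

lemma C_sub: "subgroup C (add_monoid R)"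
  using C(1) by (simp add: left_ideal_def additive_subgroup_def)

lemma C_minus: "x \<in> C \<Longrightarrow> y \<in> C \<Longrightarrow> x \<ominus> y \<in> C"
  using subgroup.m_closed[OF C_sub] subgroup.m_inv_closed[OF C_sub]
  by (simp add: a_minus_def a_inv_def)

lemma C_zero: "\<zero> \<in> C" using subgroup.one_closed[OF C_sub] by simp

lemma C_mult: "x \<in> carrier R \<Longrightarrow> y \<in> C \<Longrightarrow> x \<otimes> y \<in> C"
  using C(1) by (simp add: left_ideal_def)

lemma C_carrier: "x \<in> C \<Longrightarrow> x \<in> carrier R"
  using subgroup.mem_carrier[OF C_sub] by simp

lemma eval_pi_minus: "f \<in> carrier P \<Longrightarrow> g \<in> carrier P \<Longrightarrow> eval_pi (f \<ominus>\<^bsub>P\<^esub> g) = eval_pi f \<ominus> eval_pi g"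
  by (simp add: a_minus_def)

text \<open>
  Any nonzero polynomial of least degree with class in \<open>C\<close> can be made monic by a left factor from
  the field \<open>K\<close>.
\<close>
lemma minimal_exists: "\<exists>g. minimal C g"
proof -
  let ?I = "\<lambda>f. f \<in> carrier P \<and> f \<noteq> \<zero>\<^bsub>P\<^esub> \<and> eval_pi f \<in> C"
  obtain x where "x \<in> C" "x \<noteq> \<zero>" using C(2) C_zero by blast
  then obtain f0 where "?I f0" using eval_pi_surj[OF C_carrier] ev.hom_zero by metis
  then obtain f where f: "?I f" and min: "\<And>f'. ?I f' \<Longrightarrow> skew_degree KR f \<le> skew_degree KR f'"
    using ex_has_least_nat[of ?I f0 "skew_degree KR"] by blast
  let ?d = "skew_degree KR f"
  define a where "a = inv (f ?d)"
  have fd: "f ?d \<in> K - {\<zero>}" using f S.lead_nonzero[of f] coeff_K by simp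
  have a: "a \<in> K" "a \<otimes> f ?d = \<one>"
    unfolding a_def using subfield_m_inv[OF K fd] by auto
  define g where "g = skew_monom KR a 0 \<otimes>\<^bsub>P\<^esub> f"
  have g: "g \<in> carrier P" unfolding g_def using a f by simp
  have coeff: "g k = a \<otimes> f k" for k
    unfolding g_def using S.monom_mult_coeff[of a f 0 k] a f by simp
  have g0: "g \<noteq> \<zero>\<^bsub>P\<^esub>"
    using coeff[of ?d] a one_neq_zero S.zero_coeff[of ?d] by auto
  have evg: "eval_pi g \<in> C" unfolding g_def using a f by (simp add: C_mult)
  have "skew_degree KR g \<le> ?d"
    by (rule S.degree_le) (use coeff S.degree_gt[of f] f a in simp)
  moreover have "?d \<le> skew_degree KR g" using min g g0 evg by blast
  ultimately have deg: "skew_degree KR g = ?d" by simp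
  then have "skew_monic KR g" unfolding skew_monic_def using coeff a by simp
  then show ?thesis unfolding minimal_def using g evg min deg by metis
qed

lemma minimal_nonzero: assumes "minimal C g" shows "g \<noteq> \<zero>\<^bsub>P\<^esub>"
proof
  assume "g = \<zero>\<^bsub>P\<^esub>"
  then have "g (skew_degree KR g) = \<zero>" using S.zero_coeff by simp
  then show False using assms one_neq_zero by (simp add: minimal_def skew_monic_def)
qed

text \<open>
  The remainder of \<open>f\<close> under right division by \<open>g\<close> still has its class in \<open>C\<close> and has
  smaller degree than \<open>g\<close>, so it is zero.
\<close>
lemma minimal_dvd:
  assumes g: "minimal C g" and f: "f \<in> carrier P"
  shows "eval_pi f \<in> C \<longleftrightarrow> (\<exists>u\<in>carrier P. f = u \<otimes>\<^bsub>P\<^esub> g)"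
proof
  assume fC: "eval_pi f \<in> C"
  have gP: "g \<in> carrier P" "skew_monic KR g" "eval_pi g \<in> C" using g by (auto simp: minimal_def)
  obtain u r where ur: "u \<in> carrier P" "r \<in> carrier P" "f = u \<otimes>\<^bsub>P\<^esub> g \<oplus>\<^bsub>P\<^esub> r"
      "\<forall>i\<ge>skew_degree KR g. r i = \<zero>"
    using S.division_right[OF gP(1,2) f] by auto
  have rr: "r = f \<ominus>\<^bsub>P\<^esub> u \<otimes>\<^bsub>P\<^esub> g"
    using ur gP by (simp add: a_minus_def S.P.a_ac S.P.r_neg)
  have "eval_pi (f \<ominus>\<^bsub>P\<^esub> u \<otimes>\<^bsub>P\<^esub> g) = eval_pi f \<ominus> eval_pi u \<otimes> eval_pi g"
    using f ur(1) gP by (simp add: eval_pi_minus)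
  also have "\<dots> \<in> C" using fC ur(1) gP by (intro C_minus C_mult) auto
  finally have rC: "eval_pi r \<in> C" by (simp only: rr[symmetric])
  have "r = \<zero>\<^bsub>P\<^esub>"
  proof (rule ccontr)
    assume r: "r \<noteq> \<zero>\<^bsub>P\<^esub>"
    then have "skew_degree KR r < skew_degree KR g"
      using S.degree_less[of r] ur by simp
    moreover have "skew_degree KR g \<le> skew_degree KR r"
      using g rC r ur by (simp add: minimal_def)
    ultimately show False by simp
  qed
  then show "\<exists>u\<in>carrier P. f = u \<otimes>\<^bsub>P\<^esub> g" using ur gP by auto
next
  assume "\<exists>u\<in>carrier P. f = u \<otimes>\<^bsub>P\<^esub> g"
  then show "eval_pi f \<in> C" using g by (auto simp: minimal_def C_mult)
qed

lemma minimal_unique: assumes "minimal C g" "minimal C h" shows "g = h"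
proof -
  have P: "g \<in> carrier P" "h \<in> carrier P" "skew_monic KR g" "skew_monic KR h"
    using assms by (auto simp: minimal_def)
  have deg: "skew_degree KR g = skew_degree KR h"
    using assms minimal_nonzero[OF assms(1)] minimal_nonzero[OF assms(2)]
    by (intro antisym) (simp_all add: minimal_def)
  obtain u where u: "u \<in> carrier P" "h = u \<otimes>\<^bsub>P\<^esub> g"
    using minimal_dvd[OF assms(1) P(2)] assms(2) by (auto simp: minimal_def)
  have u0: "u \<noteq> \<zero>\<^bsub>P\<^esub>" using u minimal_nonzero[OF assms(2)] P by auto
  have d0: "skew_degree KR u = 0"
    using S.mult_monic(2)[OF u(1) P(1,3) u0] u(2) deg by simp
  have "u 0 = \<one>"
    using S.mult_monic(1)[OF u(1) P(1,3) u0] u(2) deg d0 P(4) by (simp add: skew_monic_def)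
  then have "u = \<one>\<^bsub>P\<^esub>"
    using S.degree_gt[OF u(1)] d0 S.one_coeff by (auto simp: fun_eq_iff)
  then show ?thesis using u P by simp
qed

lemma minimal_generates:
  assumes "minimal C g" shows "C = {x \<otimes> eval_pi g | x. x \<in> carrier R}"
proof (intro equalityI subsetI)
  have g: "g \<in> carrier P" "eval_pi g \<in> C" using assms by (auto simp: minimal_def)
  fix x assume x: "x \<in> C"
  then obtain f where f: "f \<in> carrier P" "x = eval_pi f" using eval_pi_surj[OF C_carrier] by blast
  then obtain u where "u \<in> carrier P" "f = u \<otimes>\<^bsub>P\<^esub> g" using minimal_dvd[OF assms f(1)] x by auto
  then show "x \<in> {x \<otimes> eval_pi g | x. x \<in> carrier R}" using f g by auto
next
  fix x assume "x \<in> {x \<otimes> eval_pi g | x. x \<in> carrier R}"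
  then show "x \<in> C" using assms by (auto simp: minimal_def C_mult)
qed

text \<open>
  The class of \<open>y^n - c\<close> is \<open>0\<close>, which lies in \<open>C\<close>, so \<open>y^n - c = h g\<close>. Centrality gives
  \<open>(g h) g = g (y^n - c) = (y^n - c) g\<close>, and cancelling \<open>g\<close> gives \<open>g h = y^n - c\<close>.
\<close>
lemma minimal_cofactor:
  assumes "minimal C g"
  shows "\<exists>!h. h \<in> carrier P \<and> modulus = h \<otimes>\<^bsub>P\<^esub> g \<and> modulus = g \<otimes>\<^bsub>P\<^esub> h"
proof -
  have g: "g \<in> carrier P" "skew_monic KR g" using assms by (auto simp: minimal_def)
  obtain h where h: "h \<in> carrier P" "modulus = h \<otimes>\<^bsub>P\<^esub> g"
    using minimal_dvd[OF assms modulus_closed] eval_modulus C_zero by auto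
  have "(g \<otimes>\<^bsub>P\<^esub> h) \<otimes>\<^bsub>P\<^esub> g = modulus \<otimes>\<^bsub>P\<^esub> g"
    using g h modulus_central[OF g(1)] by (simp add: S.P.m_assoc)
  then have "g \<otimes>\<^bsub>P\<^esub> h = modulus"
    using S.monic_cancel[of "g \<otimes>\<^bsub>P\<^esub> h" modulus g] g h(1) by simp
  then show ?thesis using g h S.monic_cancel[of _ _ g] by metis
qed

lemma cofactor_monic:
  assumes "minimal C g" "h \<in> carrier P" "modulus = h \<otimes>\<^bsub>P\<^esub> g"
  shows "skew_monic KR h" "skew_degree KR h + skew_degree KR g = n"
proof -
  have g: "g \<in> carrier P" "skew_monic KR g" using assms by (auto simp: minimal_def)
  have "modulus \<noteq> \<zero>\<^bsub>P\<^esub>"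
    using modulus_coeff[of n] one_neq_zero S.zero_coeff[of n] by auto
  then have h0: "h \<noteq> \<zero>\<^bsub>P\<^esub>" using assms g by auto
  show d: "skew_degree KR h + skew_degree KR g = n"
    using S.mult_monic(2)[OF assms(2) g h0] modulus_degree assms(3) by simp
  show "skew_monic KR h"
    using S.mult_monic(1)[OF assms(2) g h0] assms(3) modulus_coeff[of n] d
    by (simp add: skew_monic_def)
qed

text \<open>
  If \<open>f h\<close> has class zero, then \<open>f h = v (y^n - c) = (v g) h\<close>, and the monic \<open>h\<close> cancels on the
  right; so \<open>g\<close> divides \<open>f\<close> on the right.
\<close>
lemma cofactor_annihilates:
  assumes "minimal C g" "h \<in> carrier P" "modulus = h \<otimes>\<^bsub>P\<^esub> g" "modulus = g \<otimes>\<^bsub>P\<^esub> h"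
    and x: "x \<in> carrier R"
  shows "x \<in> C \<longleftrightarrow> x \<otimes> eval_pi h = \<zero>"
proof -
  have g: "g \<in> carrier P" "skew_monic KR g" using assms by (auto simp: minimal_def)
  obtain f where f: "f \<in> carrier P" "x = eval_pi f" using eval_pi_surj[OF x] by blast
  show ?thesis
  proof
    assume "x \<in> C"
    then obtain u where u: "u \<in> carrier P" "f = u \<otimes>\<^bsub>P\<^esub> g"
      using minimal_dvd[OF assms(1) f(1)] f by auto
    have "x \<otimes> eval_pi h = eval_pi ((u \<otimes>\<^bsub>P\<^esub> g) \<otimes>\<^bsub>P\<^esub> h)"
      unfolding f(2) u(2) using u(1) g(1) assms(2) by simp
    also have "(u \<otimes>\<^bsub>P\<^esub> g) \<otimes>\<^bsub>P\<^esub> h = u \<otimes>\<^bsub>P\<^esub> modulus"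
      unfolding assms(4) using u(1) g(1) assms(2) by (simp add: S.P.m_assoc)
    also have "eval_pi (u \<otimes>\<^bsub>P\<^esub> modulus) = eval_pi u \<otimes> eval_pi modulus"
      using u(1) by (intro eval_pi_mult) auto
    also have "\<dots> = \<zero>" using u by (simp add: eval_modulus)
    finally show "x \<otimes> eval_pi h = \<zero>" .
  next
    assume "x \<otimes> eval_pi h = \<zero>"
    then have "eval_pi (f \<otimes>\<^bsub>P\<^esub> h) = \<zero>" using f assms(2) by simp
    then obtain v where v: "v \<in> carrier P" "f \<otimes>\<^bsub>P\<^esub> h = v \<otimes>\<^bsub>P\<^esub> modulus"
      using eval_pi_kernel[of "f \<otimes>\<^bsub>P\<^esub> h"] f assms(2) by auto
    then have "f \<otimes>\<^bsub>P\<^esub> h = (v \<otimes>\<^bsub>P\<^esub> g) \<otimes>\<^bsub>P\<^esub> h"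
      using v(1) g assms(2) unfolding assms(4) by (simp add: S.P.m_assoc)
    then have "f = v \<otimes>\<^bsub>P\<^esub> g"
      using S.monic_cancel[of f "v \<otimes>\<^bsub>P\<^esub> g" h] f v g assms(2) cofactor_monic[OF assms(1-3)] by simp
    then show "x \<in> C" using minimal_dvd[OF assms(1) f(1)] f v by auto
  qed
qed

text \<open>
  A linear combination of the classes of \<open>y^i g\<close> is the class of \<open>u g\<close>, where \<open>u\<close> has the given
  coefficients. The lower index \<open>j\<close> is variable so that the list can be consumed from the left.
\<close>
lemma combine_eq_eval_pi:
  assumes g: "g \<in> carrier P" and Ks: "set Ks \<subseteq> K"
  shows "combine Ks (map (\<lambda>i. eval_pi ((skew_monom KR \<one> 1 [^]\<^bsub>P\<^esub> i) \<otimes>\<^bsub>P\<^esub> g)) [j..<k]) =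
    eval_pi ((\<lambda>i. if j \<le> i \<and> i < k \<and> i - j < length Ks then Ks ! (i - j) else \<zero>) \<otimes>\<^bsub>P\<^esub> g)"
  using Ks
proof (induction Ks arbitrary: j)
  case Nil
  have "(\<lambda>i. \<zero>) = \<zero>\<^bsub>P\<^esub>" using S.zero_coeff by (auto simp: fun_eq_iff)
  then show ?case using g by simp
next
  case (Cons a Ks)
  have a: "a \<in> K" and Ks: "set Ks \<subseteq> K" using Cons.prems by auto
  let ?u = "\<lambda>j Ks i. if j \<le> i \<and> i < k \<and> i - j < length Ks then Ks ! (i - j) else \<zero>"
  show ?case
  proof (cases "j < k")
    case False
    then have "?u j (a # Ks) = \<zero>\<^bsub>P\<^esub>" using S.zero_coeff by (auto simp: fun_eq_iff)
    then show ?thesis using g False by simp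
  next
    case True
    have uP: "?u (Suc j) Ks \<in> carrier P"
      unfolding S.carrier_iff using Ks by (auto intro!: exI[of _ k] subsetD[OF Ks])
    have split: "?u j (a # Ks) = skew_monom KR a j \<oplus>\<^bsub>P\<^esub> ?u (Suc j) Ks"
    proof
      fix i
      have nth: "Ks ! l \<in> carrier R" if "l < length Ks" for l
        using Ks that by (meson K_carrier nth_mem subsetD)
      consider "i < j" | "i = j" | "i > j" by linarith
      then show "?u j (a # Ks) i = (skew_monom KR a j \<oplus>\<^bsub>P\<^esub> ?u (Suc j) Ks) i"
        using True a nth unfolding S.add_coeff S.coeff_skew_monom
        by cases (auto simp: nth_Cons' Suc_diff_Suc)
    qed
    have "a \<otimes> eval_pi ((skew_monom KR \<one> 1 [^]\<^bsub>P\<^esub> j) \<otimes>\<^bsub>P\<^esub> g) = eval_pi (skew_monom KR a j \<otimes>\<^bsub>P\<^esub> g)"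
      using a g S.monom_pow[of j] by (simp add: eval_pi_monom m_assoc)
    then show ?thesis
      unfolding split upt_conv_Cons[OF True] using Cons.IH[OF Ks, of "Suc j"] uP a g
      by (simp add: S.P.l_distr)
  qed
qed

text \<open>
  For \<open>u\<close> of degree below \<open>k\<close> the product \<open>u g\<close> has degree below \<open>n\<close>; there classes and
  polynomials correspond bijectively. So \<open>u \<mapsto> u g\<close> carries the coefficient vectors of length
  \<open>k\<close> bijectively to the elements of \<open>C\<close>.
\<close>
lemma minimal_basis:
  assumes "minimal C g"
  defines "k \<equiv> n - skew_degree KR g"
  defines "basis \<equiv> map (\<lambda>i. eval_pi ((skew_monom KR \<one> 1 [^]\<^bsub>P\<^esub> i) \<otimes>\<^bsub>P\<^esub> g)) [0..<k]"
  shows "independent K basis" "Span K basis = C" "dimension k K C"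
proof -
  have g: "g \<in> carrier P" "skew_monic KR g" "eval_pi g \<in> C" using assms by (auto simp: minimal_def)
  obtain h where h: "h \<in> carrier P" "modulus = h \<otimes>\<^bsub>P\<^esub> g" using minimal_cofactor[OF assms(1)] by blast
  have kn: "k + skew_degree KR g = n" using cofactor_monic(2)[OF assms(1) h] unfolding k_def by simp
  let ?u = "\<lambda>Ks i. if i < k \<and> i < length Ks then Ks ! i else \<zero>"
  have comb: "combine Ks basis = eval_pi (?u Ks \<otimes>\<^bsub>P\<^esub> g)" if "set Ks \<subseteq> K" for Ks
    using combine_eq_eval_pi[OF g(1) that, of 0 k] unfolding basis_def by (simp cong: if_cong)
  have uP: "?u Ks \<in> carrier P" if "set Ks \<subseteq> K" for Ks
    unfolding S.carrier_iff using that by (auto intro!: exI[of _ k] subsetD[OF that])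
  have yP: "skew_monom KR \<one> 1 [^]\<^bsub>P\<^esub> i \<in> carrier P" for i :: nat
    by (rule S.P.nat_pow_closed) simp
  have basis: "set basis \<subseteq> carrier R" unfolding basis_def using g yP by (auto simp del: eval_pi_mult ev.hom_mult)
  have len: "length basis = k" unfolding basis_def by simp
  show ind: "independent K basis"
  proof (rule trivial_combine_imp_independent[OF K basis])
    fix Ks assume Ks: "set Ks \<subseteq> K" and "combine Ks basis = \<zero>"
    then have ev0: "eval_pi (?u Ks \<otimes>\<^bsub>P\<^esub> g) = \<zero>" using comb by simp
    have u0: "?u Ks = \<zero>\<^bsub>P\<^esub>"
    proof (rule ccontr)
      assume u0: "?u Ks \<noteq> \<zero>\<^bsub>P\<^esub>"
      have "skew_degree KR (?u Ks) < k" by (rule S.degree_less[OF uP[OF Ks] u0]) simp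
      then have "skew_degree KR (?u Ks \<otimes>\<^bsub>P\<^esub> g) < n"
        using S.mult_monic(2)[OF uP[OF Ks] g(1,2) u0] kn by simp
      then have "(?u Ks \<otimes>\<^bsub>P\<^esub> g) i = \<zero>" if "i \<ge> n" for i
        using S.degree_gt[of "?u Ks \<otimes>\<^bsub>P\<^esub> g" i] S.mult_closed[OF uP[OF Ks] g(1)] that by simp
      then have "?u Ks \<otimes>\<^bsub>P\<^esub> g = \<zero>\<^bsub>P\<^esub>"
        using eval_pi_zero_small S.mult_closed[OF uP[OF Ks] g(1)] ev0 by blast
      then show False using S.mult_monic(3)[OF uP[OF Ks] g(1,2) u0] by simp
    qed
    have "?u Ks i = \<zero>" for i using fun_cong[OF u0, of i] S.zero_coeff[of i] by simp
    then have "Ks ! i = \<zero>" if "i < k" "i < length Ks" for i using that by metis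
    then show "set (take (length basis) Ks) \<subseteq> {\<zero>}" unfolding len by (auto simp: in_set_conv_nth)
  qed
  show span: "Span K basis = C"
  proof (intro equalityI subsetI)
    fix x assume "x \<in> Span K basis"
    then obtain Ks where Ks: "set Ks \<subseteq> K" "x = combine Ks basis"
      using Span_mem_iff_length_version[OF K basis] by auto
    then show "x \<in> C" using comb uP g by (simp add: C_mult)
  next
    fix x assume x: "x \<in> C"
    then obtain f where f: "f \<in> carrier P" "x = eval_pi f" "\<forall>i\<ge>n. f i = \<zero>"
      using eval_pi_surj[OF C_carrier] by blast
    then obtain u where u: "u \<in> carrier P" "f = u \<otimes>\<^bsub>P\<^esub> g" using minimal_dvd[OF assms(1) f(1)] x by auto
    have uk: "u i = \<zero>" if "i \<ge> k" for i
    proof (cases "u = \<zero>\<^bsub>P\<^esub>")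
      case True
      then show ?thesis using S.zero_coeff by simp
    next
      case False
      have "f \<noteq> \<zero>\<^bsub>P\<^esub>" unfolding u(2) by (rule S.mult_monic(3)[OF u(1) g(1,2) False])
      then have "skew_degree KR f < n" using S.degree_less[OF f(1)] f(3) by simp
      then have "skew_degree KR u < k" using S.mult_monic(2)[OF u(1) g(1,2) False] u(2) kn by simp
      then show ?thesis using S.degree_gt[OF u(1), of i] that by simp
    qed
    have eq: "?u (map u [0..<k]) = u" using uk by (auto simp: fun_eq_iff)
    have Ks: "set (map u [0..<k]) \<subseteq> K" using coeff_K[OF u(1)] by auto
    have "combine (map u [0..<k]) basis = x"
      unfolding f(2) u(2) using comb[OF Ks] by (simp only: eq)
    then show "x \<in> Span K basis"
      using Ks Span_mem_iff_length_version[OF K basis] len by (metis length_map length_upt diff_zero)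
  qed
  show "dimension k K C" using dimensionI[OF K ind span] len by simp
qed

end

end

section \<open>Frobenius and polynomials over a finite field\<close>

lemma power_CARD_eq_self: "(c :: 'a :: {field, finite}) ^ CARD('a) = c"
proof (cases "c = 0")
  case False
  have "(\<Prod>x\<in>UNIV - {0}. c * x) = (\<Prod>x\<in>UNIV - {0}. x)"
    by (rule prod.reindex_bij_witness[of _ "\<lambda>x. x / c" "\<lambda>x. c * x"]) (use False in auto)
  then have "c ^ card (UNIV - {0 :: 'a}) = 1"
    by (simp add: prod.distrib)
  then have "c ^ (CARD('a) - 1) = 1" by (simp add: card_Diff_singleton)
  moreover have "CARD('a) = Suc (CARD('a) - 1)" using finite_UNIV_card_ge_0[where 'a = 'a] by simp
  ultimately show ?thesis by (metis mult.right_neutral power_Suc)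
qed (use finite_UNIV_card_ge_0[where 'a = 'a] in auto)

lemma CARD_gt_1: "CARD('a :: {field, finite}) > 1"
proof -
  have "card {0, 1 :: 'a} \<le> CARD('a)" by (rule card_mono) auto
  then show ?thesis by simp
qed

text \<open>
  Freshman's dream without writing \<open>q\<close> as a power of the characteristic. Both \<open>(Y + c)^q\<close> and
  \<open>Y^q + c^q\<close> are monic of degree \<open>q\<close>, so they agree once they agree at the \<open>q\<close> elements of
  the base field. For \<open>c\<close> in the base field this is Fermat; that case then supplies the values at
  base field elements for an arbitrary \<open>c\<close>.
\<close>
lemma power_CARD_add:
  fixes x y :: "'a :: {field, finite} alg_closure"
  shows "(x + y) ^ CARD('a) = x ^ CARD('a) + y ^ CARD('a)"
proof -
  define q where "q = CARD('a)"
  have q1: "q > 1" unfolding q_def by (rule CARD_gt_1)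
  have card: "card (range (to_ac :: 'a \<Rightarrow> _)) = q"
    unfolding q_def by (rule card_image) (rule inj_to_ac)
  have fix_ac: "to_ac c ^ q = to_ac c" for c :: 'a
    unfolding q_def by (simp add: power_CARD_eq_self flip: to_ac_power)
  have deg: "degree ([:c, 1:] ^ q) \<le> q" "coeff ([:c, 1:] ^ q) q = 1" for c :: "'a alg_closure"
    using degree_linear_power[of c q] lead_coeff_power[of "[:c, 1:]" q] by auto
  have deg': "degree (monom 1 q + [:c:]) \<le> q" "coeff (monom 1 q + [:c:]) q = 1"
    for c :: "'a alg_closure"
    using q1 by (auto intro!: degree_add_le degree_monom_le simp: coeff_pCons split: nat.splits)
  have step: "poly ([:c, 1:] ^ q) x = poly (monom 1 q + [:c ^ q:]) x"
    if "\<And>z :: 'a. (to_ac z + c) ^ q = to_ac z + c ^ q" for c x :: "'a alg_closure"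
  proof -
    have "[:c, 1:] ^ q = monom 1 q + [:c ^ q:]"
      by (rule poly_eqI_degree_lead_coeff[of _ q _ "range to_ac"])
         (use deg deg' that in \<open>auto simp: card poly_monom fix_ac add.commute\<close>)
    then show ?thesis by simp
  qed
  have 1: "(x + to_ac c) ^ q = x ^ q + to_ac c" for c and x :: "'a alg_closure"
  proof -
    have "poly ([:to_ac c, 1:] ^ q) x = poly (monom 1 q + [:to_ac c ^ q:]) x"
    proof (rule step)
      fix z :: 'a
      show "(to_ac z + to_ac c) ^ q = to_ac z + to_ac c ^ q"
        using fix_ac[of "z + c"] fix_ac[of c] by simp
    qed
    then show ?thesis by (simp add: poly_monom fix_ac add.commute)
  qed
  have "poly ([:y, 1:] ^ q) x = poly (monom 1 q + [:y ^ q:]) x"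
    by (rule step) (use 1[of y] in \<open>simp add: add.commute\<close>)
  then show ?thesis by (simp add: poly_monom q_def add.commute)
qed

lemma of_nat_CARD_eq_0: "of_nat CARD('a) = (0 :: 'a :: {field, finite} alg_closure)"
  using CHAR_dvd_CARD[where 'a = 'a] by (simp add: of_nat_eq_0_iff_char_dvd)

definition Frob :: "nat \<Rightarrow> ('a :: {field, finite}) alg_closure \<Rightarrow> 'a alg_closure" where
  "Frob k x = x ^ (CARD('a) ^ k)"

lemma Frob_0 [simp]: "Frob 0 x = x" by (simp add: Frob_def)

lemma Frob_Frob: "Frob j (Frob k x) = Frob (j + k) x"
  by (simp add: Frob_def power_add power_mult[symmetric] mult.commute)

lemma Frob_Suc: "Frob (Suc k) x = Frob 1 (Frob k x)" by (simp add: Frob_Frob)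

lemma Frob_add [simp]: "Frob k (x + y) = Frob k x + Frob k y"
proof (induction k)
  case (Suc k)
  have "Frob 1 (a + b) = Frob 1 a + Frob 1 b" for a b :: "'a alg_closure"
    by (simp add: Frob_def power_CARD_add)
  then show ?case by (simp add: Frob_Suc[of k] Suc)
qed simp

lemma Frob_mult [simp]: "Frob k (x * y) = Frob k x * Frob k y"
  by (simp add: Frob_def power_mult_distrib)

lemma Frob_zero [simp]: "Frob k 0 = 0" by (simp add: Frob_def power_0_left)

lemma Frob_one [simp]: "Frob k 1 = 1" by (simp add: Frob_def)

lemma Frob_minus [simp]: "Frob k (- x) = - Frob k x"
  using Frob_add[of k x "- x"] by (simp add: eq_neg_iff_add_eq_0 add.commute)

lemma Frob_diff [simp]: "Frob k (x - y) = Frob k x - Frob k y"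
  using Frob_add[of k x "- y"] by simp

lemma Frob_power: "Frob k (x ^ j) = Frob k x ^ j"
  by (simp add: Frob_def power_mult[symmetric] mult.commute)

lemma Frob_sum: "Frob k (sum f A) = (\<Sum>x\<in>A. Frob k (f x))"
  by (induction A rule: infinite_finite_induct) auto

lemma Frob_eq_0_iff [simp]: "Frob k x = 0 \<longleftrightarrow> x = 0"
  by (auto simp: Frob_def)

lemma Frob_eq_iff [simp]: "Frob k x = Frob k y \<longleftrightarrow> x = y"
  using Frob_eq_0_iff[of k "x - y"] by simp

lemma Frob_to_ac [simp]: "Frob k (to_ac c) = to_ac c"
proof (induction k)
  case (Suc k)
  then show ?case
    by (simp add: Frob_Suc[of k]) (simp add: Frob_def power_CARD_eq_self flip: to_ac_power)
qed simp

lemma Frob_fixed_mult: "Frob a x = x \<Longrightarrow> Frob (a * k) x = x"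
  by (induction k) (simp_all add: Frob_Frob[symmetric])

text \<open>
  By Bezout some iterate of the \<open>a\<close>-th Frobenius is the composite of the \<open>gcd\<close>-th one and an
  iterate of the \<open>b\<close>-th one.
\<close>
lemma Frob_fixed_gcd:
  assumes "Frob a x = x" "Frob b x = x" shows "Frob (gcd a b) x = x"
proof (cases "a = 0")
  case False
  obtain u v where "a * u = b * v + gcd a b" using bezout_nat[OF False] by blast
  then have "Frob (gcd a b) (Frob (b * v) x) = x"
    using Frob_fixed_mult[OF assms(1), of u] by (simp add: Frob_Frob add.commute)
  then show ?thesis by (simp add: Frob_fixed_mult[OF assms(2)])
qed (use assms in simp)

text \<open>
  The polynomial \<open>x^q - x\<close> has at most \<open>q\<close> roots, and the base field supplies \<open>q\<close> of them.
\<close>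
lemma Frob_1_fixed: "Frob 1 x = x \<longleftrightarrow> x \<in> range to_ac"
proof
  assume x: "Frob 1 x = x"
  define q where "q = CARD('a)"
  define p where "p = monom (1 :: 'a alg_closure) q - [:0, 1:]"
  have q1: "q > 1" unfolding q_def by (rule CARD_gt_1)
  have "coeff p q = 1" using q1 by (simp add: p_def coeff_pCons split: nat.splits)
  then have p0: "p \<noteq> 0" by auto
  have "degree p \<le> q" unfolding p_def
    by (rule degree_diff_le) (use q1 in \<open>auto intro: degree_monom_le\<close>)
  then have "card {x. poly p x = 0} \<le> q" using card_poly_roots_bound[OF p0] by simp
  moreover have sub: "range to_ac \<subseteq> {x. poly p x = 0}"
    using Frob_to_ac[where 'a = 'a, of 1] by (auto simp: p_def poly_monom q_def Frob_def)
  moreover have "card (range (to_ac :: 'a \<Rightarrow> _)) = q"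
    unfolding q_def by (rule card_image) (rule inj_to_ac)
  moreover have "finite {x. poly p x = 0}" using p0 poly_roots_finite by blast
  ultimately have "range to_ac = {x. poly p x = 0}" by (metis card_seteq)
  moreover have "poly p x = 0" using x by (simp add: p_def poly_monom q_def Frob_def)
  ultimately show "x \<in> range to_ac" by simp
qed auto

text \<open>
  Frobenius on coefficients: \<open>twist k w = w\<close> says that \<open>w\<close> has its coefficients in the field
  with \<open>q^k\<close> elements.
\<close>
definition twist :: "nat \<Rightarrow> ('a :: {field, finite}) alg_closure poly \<Rightarrow> 'a alg_closure poly" where
  "twist k w = map_poly (Frob k) w"

abbreviation ac_poly :: "'a :: {field, finite} poly \<Rightarrow> 'a alg_closure poly" where
  "ac_poly \<equiv> map_poly to_ac"

lemma coeff_twist [simp]: "coeff (twist k w) i = Frob k (coeff w i)"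
  by (simp add: twist_def coeff_map_poly)

lemma degree_twist [simp]: "degree (twist k w) = degree w"
  unfolding twist_def by (rule degree_map_poly) simp

lemma twist_0 [simp]: "twist k 0 = 0" by (rule poly_eqI) simp
lemma twist_1 [simp]: "twist k 1 = 1" by (rule poly_eqI) simp
lemma twist_add [simp]: "twist k (u + v) = twist k u + twist k v" by (rule poly_eqI) simp
lemma twist_diff [simp]: "twist k (u - v) = twist k u - twist k v" by (rule poly_eqI) simp
lemma twist_mult [simp]: "twist k (u * v) = twist k u * twist k v"
  by (rule poly_eqI) (simp add: coeff_mult Frob_sum)
lemma twist_smult [simp]: "twist k (smult c v) = smult (Frob k c) (twist k v)"
  by (rule poly_eqI) simp
lemma twist_pCons [simp]: "twist k (pCons c w) = pCons (Frob k c) (twist k w)"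
  by (rule poly_eqI) (simp add: coeff_pCons split: nat.splits)
lemma twist_prod: "twist k (prod f A) = (\<Prod>x\<in>A. twist k (f x))"
  by (induction A rule: infinite_finite_induct) auto
lemma twist_twist: "twist j (twist k w) = twist (j + k) w"
  by (rule poly_eqI) (simp add: Frob_Frob)

lemma poly_twist: "poly (twist k w) (Frob k x) = Frob k (poly w x)"
  by (induction w) simp_all

lemma twist_fixed_gcd: "twist a w = w \<Longrightarrow> twist b w = w \<Longrightarrow> twist (gcd a b) w = w"
  by (rule poly_eqI) (metis Frob_fixed_gcd coeff_twist)

lemma twist_fixed_mult: "twist a w = w \<Longrightarrow> twist (a * k) w = w"
  by (rule poly_eqI) (metis Frob_fixed_mult coeff_twist)

lemma twist_ac_poly [simp]: "twist k (ac_poly a) = ac_poly a"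
  by (rule poly_eqI) (simp add: coeff_map_poly)

lemma twist_1_fixedE:
  assumes "twist 1 w = w" obtains a where "w = ac_poly a"
proof
  have "Frob 1 (coeff w i) = coeff w i" for i using assms by (metis coeff_twist)
  then have "coeff w i \<in> range to_ac" for i using Frob_1_fixed by blast
  then show "w = ac_poly (map_poly of_ac w)"
    by (intro poly_eqI) (simp add: coeff_map_poly to_ac_of_ac)
qed

lemma ac_poly_add [simp]: "ac_poly (a + b) = ac_poly a + ac_poly b"
  by (rule poly_eqI) (simp add: coeff_map_poly)
lemma ac_poly_diff [simp]: "ac_poly (a - b) = ac_poly a - ac_poly b"
  by (rule poly_eqI) (simp add: coeff_map_poly)
lemma ac_poly_mult [simp]: "ac_poly (a * b) = ac_poly a * ac_poly b"
  by (rule poly_eqI) (simp add: coeff_map_poly coeff_mult to_ac_sum)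
lemma degree_ac_poly [simp]: "degree (ac_poly a) = degree a"
  by (rule degree_map_poly) simp
lemma ac_poly_eq_0_iff [simp]: "ac_poly a = 0 \<longleftrightarrow> a = 0"
  by (rule map_poly_eq_0_iff) auto

lemma prod_roots_dvd:
  fixes w :: "'b :: idom poly"
  assumes "finite A" "\<And>a. a \<in> A \<Longrightarrow> poly w a = 0"
  shows "(\<Prod>a\<in>A. [:- a, 1:]) dvd w"
  using assms
proof (induction A rule: finite_induct)
  case (insert a A)
  then obtain m where m: "w = (\<Prod>a\<in>A. [:- a, 1:]) * m" by (auto elim: dvdE)
  have "poly (\<Prod>a\<in>A. [:- a, 1:]) a \<noteq> 0" using insert.hyps by (auto simp: poly_prod)
  then have "poly m a = 0" using insert.prems[of a] m by simp
  then obtain l where l: "m = [:- a, 1:] * l" by (auto simp: poly_eq_0_iff_dvd elim: dvdE)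
  have "w = ([:- a, 1:] * (\<Prod>a\<in>A. [:- a, 1:])) * l" unfolding m l by (simp only: mult_ac)
  then show ?case unfolding prod.insert[OF insert.hyps] by (rule dvdI)
qed simp

text \<open>
  A double root would be a root of the derivative, so the linear factors are distinct.
\<close>
lemma card_roots_separable:
  fixes w :: "'b :: alg_closed_field poly"
  assumes "pderiv w = [:c:]" "c \<noteq> 0"
  shows "card {x. poly w x = 0} = degree w"
proof -
  have w0: "w \<noteq> 0" using assms by auto
  obtain A where A: "size A = degree w" "w = smult (lead_coeff w) (\<Prod>x\<in>#A. [:- x, 1:])"
    using alg_closed_imp_factorization[OF w0] by blast
  have "count A x \<le> 1" for x
  proof (rule ccontr)
    assume "\<not> count A x \<le> 1"
    then have "{#x, x#} \<subseteq># A" by (simp add: subseteq_mset_def)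
    then obtain B where B: "A = {#x, x#} + B" by (metis subset_mset.le_iff_add)
    define l where "l = [:- x, 1:]"
    have "w = l * (l * Polynomial.smult (lead_coeff w) (\<Prod>x\<in>#B. [:- x, 1:]))"
      by (subst A(2)) (simp add: B l_def algebra_simps)
    then obtain v where v: "w = l * (l * v)" by blast
    have "poly (pderiv w) x = 0" unfolding v by (simp add: pderiv_mult l_def del: mult_pCons_left)
    then show False using assms by simp
  qed
  then have "A = mset_set (set_mset A)"
    by (intro multiset_eqI) (metis count_greater_eq_one_iff count_inI count_mset_set(1,3)
       finite_set_mset le_antisym)
  then have "card (set_mset A) = degree w" using A(1) by (metis size_mset_set)
  moreover have "{x. poly w x = 0} = set_mset A"
  proof -
    have "poly w x = 0 \<longleftrightarrow> (\<Prod>a\<in>#A. x - a) = 0" for x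
      by (subst A(2)) (use w0 in \<open>simp add: poly_prod_mset image_mset.compositionality o_def\<close>)
    then show ?thesis by (auto simp: prod_mset_zero_iff)
  qed
  ultimately show ?thesis by simp
qed

text \<open>
  A nonzero polynomial \<open>b\<close> of least degree vanishing at \<open>x\<close> divides every polynomial over the base
  field that vanishes at \<open>x\<close>; being a non-unit divisor of the irreducible \<open>p\<close>, it is associated
  to \<open>p\<close>.
\<close>
lemma irreducible_dvd_of_root:
  fixes p a :: "'a :: {field, finite} poly"
  assumes p: "Factorial_Ring.irreducible p"
    and x: "poly (ac_poly p) x = 0" "poly (ac_poly a) x = 0"
  shows "p dvd a"
proof -
  let ?Z = "\<lambda>b. b \<noteq> 0 \<and> poly (ac_poly b) x = 0"
  have "?Z p" using p x by auto
  then obtain b where b: "?Z b" and min: "\<And>c. ?Z c \<Longrightarrow> degree b \<le> degree c"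
    using ex_has_least_nat[of ?Z p degree] by blast
  have b_dvd: "b dvd c" if "poly (ac_poly c) x = 0" for c
  proof (rule ccontr)
    assume "\<not> b dvd c"
    then have m: "c mod b \<noteq> 0" by (simp add: dvd_eq_mod_eq_0)
    have "ac_poly c = ac_poly (c div b) * ac_poly b + ac_poly (c mod b)"
      by (simp flip: ac_poly_mult ac_poly_add)
    then have "poly (ac_poly (c mod b)) x = 0" using that b by simp
    then show False using min[of "c mod b"] m degree_mod_less'[of b c] b by simp
  qed
  obtain e where e: "p = b * e" using b_dvd[OF x(1)] by (auto elim: dvdE)
  have "\<not> b dvd 1"
  proof
    assume "b dvd 1"
    then obtain c where "b = [:c:]" by (auto simp: is_unit_poly_iff)
    then show False using b by (simp add: map_poly_pCons)
  qed
  then have "e dvd 1" using Factorial_Ring.irreducibleD[OF p e] by simp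
  then have "p dvd b" unfolding e by (rule mult_unit_dvd_iff[THEN iffD2]) simp
  then show ?thesis using b_dvd[OF x(2)] dvd_trans by blast
qed

text \<open>
  The product of \<open>X - y\<close> over the Frobenius orbit of a root \<open>x\<close> is invariant under Frobenius, hence
  defined over the base field, hence divisible by \<open>p\<close>. Conversely it divides every polynomial that
  vanishes on the orbit, in particular \<open>p\<close>. So the orbit has exactly \<open>deg p\<close> elements.
\<close>
lemma irreducible_conjugates:
  fixes p :: "'a :: {field, finite} poly" and x :: "'a alg_closure"
  assumes p: "Factorial_Ring.irreducible p" and x: "poly (ac_poly p) x = 0"
  shows "Frob (degree p) x = x"
    and "(\<And>j. poly w (Frob j x) = 0) \<Longrightarrow> ac_poly p dvd w"
proof -
  have p0: "p \<noteq> 0" using p by auto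
  have root: "poly (ac_poly p) (Frob j x) = 0" for j
    using poly_twist[of j "ac_poly p" x] x by simp
  have "finite {x. poly (ac_poly p) x = 0}" using p0 by (intro poly_roots_finite) simp
  then have "finite (range (\<lambda>j. Frob j x))"
    by (rule finite_subset[rotated]) (use root in auto)
  then have "\<not> inj (\<lambda>j. Frob j x)" using finite_imageD by fastforce
  then obtain i j where "i < j" "Frob i x = Frob j x"
    by (auto simp: inj_def) (metis linorder_neqE_nat)
  then have "Frob i (Frob (j - i) x) = Frob i x" by (simp add: Frob_Frob)
  then have ex: "j - i > 0 \<and> Frob (j - i) x = x" using \<open>i < j\<close> by simp
  define e where "e = (LEAST e. e > 0 \<and> Frob e x = x)"
  have e: "e > 0" "Frob e x = x" using LeastI[of "\<lambda>e. e > 0 \<and> Frob e x = x", OF ex] by (auto simp: e_def)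
  have min: "\<not> (k > 0 \<and> Frob k x = x)" if "k < e" for k using that not_less_Least unfolding e_def by blast
  have ne: "Frob i x \<noteq> Frob j x" if "i < j" "j < e" for i j
  proof
    assume "Frob i x = Frob j x"
    then have "Frob i (Frob (j - i) x) = Frob i x" using that by (simp add: Frob_Frob)
    then show False using min[of "j - i"] that by (simp add: less_imp_diff_less)
  qed
  then have inj: "inj_on (\<lambda>j. Frob j x) {..<e}" by (intro linorder_inj_onI) auto
  define Orb where "Orb = (\<lambda>j. Frob j x) ` {..<e}"
  have fin: "finite Orb" unfolding Orb_def by simp
  have shift: "Frob 1 ` Orb = Orb"
  proof -
    have "Frob 1 y \<in> Orb" if "y \<in> Orb" for y
    proof -
      obtain j where j: "j < e" "y = Frob j x" using \<open>y \<in> Orb\<close> by (auto simp: Orb_def)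
      show ?thesis
      proof (cases "Suc j = e")
        case True
        then have "Frob 1 y = Frob 0 x" using e(2) j by (simp add: Frob_Frob)
        then show ?thesis using e(1) unfolding Orb_def by blast
      next
        case False
        then show ?thesis using j unfolding Orb_def by (intro image_eqI[of _ _ "Suc j"]) (auto simp: Frob_Frob)
      qed
    qed
    then have "Frob 1 ` Orb \<subseteq> Orb" by blast
    moreover have "inj_on (Frob 1) Orb" by (auto intro: inj_onI)
    ultimately show ?thesis using fin by (metis endo_inj_surj)
  qed
  define T where "T = (\<Prod>a\<in>Orb. [:- a, 1:])"
  have "twist 1 T = (\<Prod>a\<in>Orb. [:- Frob 1 a, 1:])" unfolding T_def by (simp add: twist_prod)
  also have "\<dots> = (\<Prod>a\<in>Frob 1 ` Orb. [:- a, 1:])" by (subst prod.reindex) (auto intro: inj_onI)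
  finally have "twist 1 T = T" unfolding shift T_def .
  then obtain T0 where T0: "T = ac_poly T0" using twist_1_fixedE by blast
  have "x \<in> Orb" unfolding Orb_def using e(1) by (intro image_eqI[of _ _ 0]) auto
  then have "poly T x = 0" using fin by (auto simp: T_def poly_prod)
  then have "p dvd T0" using irreducible_dvd_of_root[OF p x] T0 by simp
  then have pT: "ac_poly p dvd T" unfolding T0 by (auto elim!: dvdE)
  have degT: "degree T = e"
    unfolding T_def by (subst degree_prod_eq_sum_degree) (auto simp: Orb_def card_image[OF inj])
  have T_nz: "T \<noteq> 0" unfolding T_def using fin by simp
  have "T dvd ac_poly p" unfolding T_def by (rule prod_roots_dvd[OF fin]) (use root in \<open>auto simp: Orb_def\<close>)
  then have "degree T \<le> degree p" using dvd_imp_degree_le[of T "ac_poly p"] p0 by simp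
  moreover have "degree p \<le> degree T" using dvd_imp_degree_le[OF pT T_nz] by simp
  ultimately show "Frob (degree p) x = x" using e(2) degT by simp
  assume "\<And>j. poly w (Frob j x) = 0"
  then have "T dvd w" unfolding T_def by (intro prod_roots_dvd[OF fin]) (auto simp: Orb_def)
  then show "ac_poly p dvd w" using pT dvd_trans by blast
qed

lemma no_common_root_bezout:
  fixes u v :: "'a :: {field, finite} alg_closure poly"
  assumes "\<And>x. \<not> (poly u x = 0 \<and> poly v x = 0)"
  shows "\<exists>a b. a * u + b * v = 1"
proof -
  define g where "g = gcd u v"
  have "degree g = 0"
  proof (rule ccontr)
    assume "degree g \<noteq> 0"
    then obtain x where "poly g x = 0" using alg_closed_imp_poly_has_root[of g] by auto
    moreover have "g dvd u" "g dvd v" by (simp_all add: g_def)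
    ultimately show False using assms[of x] by (metis dvd_trans poly_eq_0_iff_dvd)
  qed
  moreover have "g \<noteq> 0" unfolding g_def using assms[of 0] by auto
  ultimately have "is_unit g" by (simp add: is_unit_iff_degree)
  then have "g = 1" unfolding g_def by simp
  then show ?thesis using bezout_coefficients_fst_snd[of u v] unfolding g_def by metis
qed

text \<open>
  An irreducible \<open>p\<close> over the field with \<open>q\<close> elements stays irreducible over the field with
  \<open>q^m\<close> elements when \<open>m\<close> is prime to \<open>deg p\<close>. Concretely: the zeros of \<open>k\<close> are stable
  under the \<open>m\<close>-th Frobenius, which by coprimality reaches every conjugate of a root of \<open>p\<close>; so a
  common root would force \<open>p\<close> to divide \<open>k\<close>. Bezout gives an inverse over the algebraic closure,
  and since inverses are unique modulo \<open>p\<close>, its reduction has coefficients in the smaller field.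
\<close>
lemma inverse_mod_irreducible:
  fixes p :: "'a :: {field, finite} poly" and k :: "'a alg_closure poly"
  assumes p: "Factorial_Ring.irreducible p" and m: "coprime m (degree p)" "m \<noteq> 0"
    and k: "twist m k = k" "\<not> ac_poly p dvd k"
  shows "\<exists>u. twist m u = u \<and> ac_poly p dvd u * k - 1"
proof -
  let ?p = "ac_poly p"
  have p0: "p \<noteq> 0" using p by auto
  have no_root: "\<not> (poly k x = 0 \<and> poly ?p x = 0)" for x
  proof
    assume x: "poly k x = 0 \<and> poly ?p x = 0"
    have fx: "Frob (degree p) x = x" using irreducible_conjugates(1)[OF p] x by blast
    have step: "poly k (Frob (m * i) x) = 0" for i
    proof (induction i)
      case (Suc i)
      then show ?case using poly_twist[of m k "Frob (m * i) x"] k(1) by (simp add: Frob_Frob)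
    qed (use x in simp)
    have "poly k (Frob j x) = 0" for j
    proof -
      \<comment> \<open>The j-th conjugate of x is also a conjugate under a power of the m-th Frobenius.\<close>
      have "\<exists>i l. m * i = j + degree p * l"
      proof -
        obtain a b where "m * a = degree p * b + 1"
          using bezout_nat[OF m(2), of "degree p"] m(1) by auto
        then have "m * (a * j) = j + degree p * (b * j)" by (metis add.commute add_mult_distrib mult.assoc mult_1)
        then show ?thesis by blast
      qed
      then obtain i l where "m * i = j + degree p * l" by blast
      then have "Frob j (Frob (degree p * l) x) = Frob (m * i) x" by (simp add: Frob_Frob)
      then show ?thesis using step[of i] Frob_fixed_mult[OF fx, of l] by simp
    qed
    then show False using irreducible_conjugates(2)[OF p] x k(2) by blast
  qed
  obtain a b where ab: "a * k + b * ?p = 1" using no_common_root_bezout[OF no_root] by blast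
  have "twist m (a * k + b * ?p) = 1" unfolding ab by simp
  then have ab': "twist m a * k + twist m b * ?p = 1" using k(1) by simp
  \<comment> \<open>Both \<open>a\<close> and its twist are inverses of \<open>k\<close> modulo \<open>p\<close>.\<close>
  have "twist m a - a = (twist m a - a) * (a * k + b * ?p)" unfolding ab by simp
  also have "\<dots> = a * ((twist m a * k + twist m b * ?p) - (a * k + b * ?p)) +
       ?p * (b * (twist m a - a) - a * (twist m b - b))"
    by (simp add: algebra_simps)
  also have "\<dots> = ?p * (b * (twist m a - a) - a * (twist m b - b))" unfolding ab ab' by simp
  finally have dv: "?p dvd twist m a - a" by (metis dvd_triv_left)
  define u where "u = a mod ?p"
  have a: "a = (a div ?p) * ?p + u" unfolding u_def by (rule div_mult_mod_eq[symmetric])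
  have "twist m a = twist m (a div ?p) * ?p + twist m u" by (subst a) simp
  then have "twist m u - u = (twist m a - a) + (a div ?p - twist m (a div ?p)) * ?p"
    using a by (simp add: algebra_simps)
  then have dv': "?p dvd twist m u - u" using dv by simp
  have "twist m u = u"
  proof (rule ccontr)
    assume ne: "twist m u \<noteq> u"
    then have "u \<noteq> 0" by auto
    then have "degree u < degree p" unfolding u_def using degree_mod_less'[of ?p a] p0 by simp
    then have "degree (twist m u - u) < degree p" by (intro degree_diff_less) auto
    then show False using dvd_imp_degree_le[OF dv'] ne by simp
  qed
  moreover have "u * k - 1 = ?p * (- b - (a div ?p) * k)"
    using ab a by (simp add: algebra_simps) (metis (no_types, opaque_lifting) add.assoc add.commute distrib_right mult.commute)
  then have "?p dvd u * k - 1" by simp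
  ultimately show ?thesis by blast
qed

section \<open>Free families in vector spaces\<close>

locale vector_families = vector_space scale
  for scale :: "'a :: field \<Rightarrow> 'b :: ab_group_add \<Rightarrow> 'b" (infixr \<open>*s\<close> 75)
begin

text \<open>
  Unlike independence of the set of its members, freeness of a family forces the members to be
  distinct, so that cardinalities of index sets can be compared.
\<close>
definition free_family :: "'i set \<Rightarrow> ('i \<Rightarrow> 'b) \<Rightarrow> bool" where
  "free_family I f \<longleftrightarrow> (\<forall>c. (\<Sum>i\<in>I. c i *s f i) = 0 \<longrightarrow> (\<forall>i\<in>I. c i = 0))"

lemma free_family_iff:
  assumes "finite I"
  shows "free_family I f \<longleftrightarrow> inj_on f I \<and> independent (f ` I)"
proof
  assume free: "free_family I f"
  have inj: "inj_on f I"
  proof (rule inj_onI, rule ccontr)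
    fix i j assume ij: "i \<in> I" "j \<in> I" "f i = f j" "i \<noteq> j"
    \<comment> \<open>Two equal members would satisfy a relation with coefficients 1 and -1.\<close>
    define c where "c = (\<lambda>k. if k = i then 1 else if k = j then -1 else (0 :: 'a))"
    have "(\<Sum>k\<in>I. c k *s f k) = (\<Sum>k\<in>{i, j}. c k *s f k)"
      by (rule sum.mono_neutral_right) (use ij assms in \<open>auto simp: c_def\<close>)
    also have "\<dots> = 0" using ij by (simp add: c_def)
    finally have "c i = 0" using free ij(1) by (auto simp: free_family_def)
    then show False by (simp add: c_def)
  qed
  have "independent (f ` I)"
  proof (rule independent_if_scalars_zero)
    fix u x assume "(\<Sum>x\<in>f ` I. u x *s x) = 0" "x \<in> f ` I"
    then have "(\<Sum>i\<in>I. u (f i) *s f i) = 0" by (simp add: sum.reindex[OF inj])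
    then have "\<forall>i\<in>I. u (f i) = 0" using free[unfolded free_family_def, THEN spec, of "\<lambda>i. u (f i)"] by simp
    then show "u x = 0" using \<open>x \<in> f ` I\<close> by auto
  qed (use assms in simp)
  with inj show "inj_on f I \<and> independent (f ` I)" by simp
next
  assume *: "inj_on f I \<and> independent (f ` I)"
  show "free_family I f" unfolding free_family_def
  proof (intro allI impI ballI)
    fix c i assume "(\<Sum>i\<in>I. c i *s f i) = 0" "i \<in> I"
    moreover have "(\<Sum>x\<in>f ` I. c (inv_into I f x) *s x) = (\<Sum>i\<in>I. c i *s f i)"
      using * by (simp add: sum.reindex)
    ultimately have "c (inv_into I f (f i)) = 0"
      using independentD[of "f ` I" "f ` I" "\<lambda>x. c (inv_into I f x)" "f i"] * assms by auto
    then show "c i = 0" using * \<open>i \<in> I\<close> by simp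
  qed
qed

lemma span_image_family:
  assumes "finite I" "x \<in> span (f ` I)" "inj_on f I" shows "\<exists>c. x = (\<Sum>i\<in>I. c i *s f i)"
proof -
  obtain u where "x = (\<Sum>y\<in>f ` I. u y *s y)"
    using assms(2) span_finite[of "f ` I"] assms(1) by auto
  then have "x = (\<Sum>i\<in>I. u (f i) *s f i)" by (simp add: sum.reindex[OF assms(3)])
  then show ?thesis by (intro exI[of _ "\<lambda>i. u (f i)"])
qed

text \<open>
  Steinitz exchange. A free family contained in the span of a family that is not larger already spans
  the same space, and then the second family is free as well. It shows first that the
  powers of \<open>\<tau>\<close> span the linear maps on \<open>M\<close>, and then that the maps \<open>\<phi>\<^sub>T^a \<pi>^i\<close> are
  independent.
\<close>
lemma free_family_exchange:
  assumes fin: "finite I" "finite J" and card: "card J \<le> card I"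
    and free: "free_family I f" and sub: "\<And>i. i \<in> I \<Longrightarrow> f i \<in> span (g ` J)"
  shows "span (f ` I) = span (g ` J)" "free_family J g"
proof -
  have f: "inj_on f I" "independent (f ` I)" using free free_family_iff[OF fin(1)] by auto
  have cardf: "card (f ` I) = card I" using f(1) by (rule card_image)
  have fg: "f ` I \<subseteq> span (g ` J)" using sub by blast
  have le: "card I \<le> card B" if "finite B" "f ` I \<subseteq> span B" for B
    using independent_span_bound[OF that(1) f(2) that(2)] cardf by simp
  have cardg: "card (g ` J) = card J"
    using le[OF _ fg] fin(2) card card_image_le[OF fin(2), of g] by fastforce
  have "g ` J \<subseteq> span (f ` I)"
  proof (rule ccontr)
    assume "\<not> g ` J \<subseteq> span (f ` I)"
    then obtain x where x: "x \<in> g ` J" "x \<notin> span (f ` I)" by blast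
    then have "independent (insert x (f ` I))" using f(2) by (simp add: independent_insert)
    moreover have "insert x (f ` I) \<subseteq> span (g ` J)" using x fg by (auto intro: span_base)
    ultimately have "card (insert x (f ` I)) \<le> card (g ` J)"
      using independent_span_bound fin(2) by blast
    moreover have "x \<notin> f ` I" using x span_base by blast
    ultimately show False using cardf cardg card fin by simp
  qed
  then show span: "span (f ` I) = span (g ` J)" using fg by (metis span_eq)
  have "independent (g ` J)"
  proof
    assume "dependent (g ` J)"
    then obtain a where a: "a \<in> g ` J" "a \<in> span (g ` J - {a})" unfolding dependent_def by blast
    then have "span (g ` J) = span (g ` J - {a})"
      using span_redundant[OF a(2)] by (simp add: insert_absorb)
    then have "card I \<le> card (g ` J - {a})" using le[of "g ` J - {a}"] fg fin(2) by auto
    moreover have "card (g ` J - {a}) < card (g ` J)"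
      using a(1) fin(2) by (intro psubset_card_mono) auto
    ultimately show False using cardg card by simp
  qed
  moreover have "inj_on g J" using cardg fin(2) by (simp add: eq_card_imp_inj_on)
  ultimately show "free_family J g" using free_family_iff[OF fin(2)] by simp
qed

end

lemma fun_sum_apply: "(\<Sum>i\<in>A. f i) x = (\<Sum>i\<in>A. f i x)"
  by (induction A rule: infinite_finite_induct) auto

lemma pderiv_sum: "pderiv (\<Sum>i\<in>A. f i) = (\<Sum>i\<in>A. pderiv (f i))"
  by (induction A rule: infinite_finite_induct) (auto simp: pderiv_add)

lemma sum_const_poly: "(\<Sum>i\<in>A. [:f i:]) = [:\<Sum>i\<in>A. f i:]"
  by (induction A rule: infinite_finite_induct) auto

interpretation fun_space: vector_families "\<lambda>(c :: 'b :: field) (f :: 'c \<Rightarrow> 'b) x. c * f x"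
  by unfold_locales (auto simp: fun_eq_iff algebra_simps)

interpretation Fq_space: vector_families "\<lambda>(c :: 'a :: {field, finite}) (v :: 'a alg_closure). to_ac c * v"
  by unfold_locales (auto simp: algebra_simps)

section \<open>Polynomials in the Drinfeld operator\<close>

locale drinfeld_op =
  fixes t :: "'a :: {field, finite} alg_closure" and n r :: nat
  assumes Frob_t: "Frob r t = t"
begin

definition phiT :: "'a alg_closure \<Rightarrow> 'a alg_closure" where "phiT v = t * v + Frob n v"

text \<open>
  A polynomial \<open>w\<close> over the algebraic closure acts with its variable as \<open>\<phi>\<^sub>T\<close> and its coefficients
  as multiplications applied after \<open>\<phi>\<^sub>T\<close>. For \<open>w\<close> over the base field this is \<open>\<phi>\<^sub>w\<close>.
  Because \<open>\<phi>\<^sub>T\<close> is not linear over the algebraic closure, a product of polynomials acts as the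
  composite when the coefficients of the right factor are fixed by \<open>\<tau>^n\<close>, but not in general.
\<close>
definition opX :: "'a alg_closure poly \<Rightarrow> 'a alg_closure \<Rightarrow> 'a alg_closure" where
  "opX w v = (\<Sum>a\<le>degree w. coeff w a * (phiT ^^ a) v)"

lemma phiT_add [simp]: "phiT (u + v) = phiT u + phiT v" by (simp add: phiT_def algebra_simps)
lemma phiT_zero [simp]: "phiT 0 = 0" by (simp add: phiT_def)
lemma phiT_scale [simp]: "phiT (to_ac c * v) = to_ac c * phiT v" by (simp add: phiT_def algebra_simps)
lemma phiT_Frob: "phiT (Frob (r * i) v) = Frob (r * i) (phiT v)"
  using Frob_fixed_mult[OF Frob_t, of i] by (simp add: phiT_def Frob_Frob add.commute)
lemma opX_bound: assumes "\<And>a. a > N \<Longrightarrow> coeff w a = 0" shows "opX w v = (\<Sum>a\<le>N. coeff w a * (phiT ^^ a) v)"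
proof -
  have "degree w \<le> N" using assms by (intro degree_le) auto
  then show ?thesis unfolding opX_def
    by (intro sum.mono_neutral_left) (auto simp: coeff_eq_0)
qed

lemma opX_less: assumes "\<And>a. a \<ge> N \<Longrightarrow> coeff w a = 0" shows "opX w v = (\<Sum>a<N. coeff w a * (phiT ^^ a) v)"
proof -
  have "opX w v = (\<Sum>a\<le>N. coeff w a * (phiT ^^ a) v)" by (rule opX_bound) (use assms in auto)
  also have "\<dots> = (\<Sum>a<N. coeff w a * (phiT ^^ a) v)"
    using assms[of N] by (simp flip: lessThan_Suc_atMost)
  finally show ?thesis .
qed

lemma opX_0 [simp]: "opX 0 v = 0" by (simp add: opX_def)

lemma opX_pCons [simp]: "opX (pCons c w) v = c * v + opX w (phiT v)"
proof -
  have "opX (pCons c w) v = (\<Sum>a\<le>Suc (degree w). coeff (pCons c w) a * (phiT ^^ a) v)"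
    by (rule opX_bound) (auto simp: coeff_pCons coeff_eq_0 split: nat.splits)
  also have "\<dots> = c * v + opX w (phiT v)"
    by (subst sum.atMost_Suc_shift) (simp add: opX_def funpow_swap1)
  finally show ?thesis .
qed

lemma opX_1 [simp]: "opX 1 v = v" using opX_pCons[of 1 0 v] by (simp add: one_pCons)

lemma opX_add [simp]: "opX (u + w) v = opX u v + opX w v"
  by (induction u w arbitrary: v rule: poly_induct2) (simp_all add: algebra_simps)

lemma opX_smult [simp]: "opX (smult c w) v = c * opX w v"
  by (induction w arbitrary: v) (simp_all add: algebra_simps)

lemma opX_diff [simp]: "opX (u - w) v = opX u v - opX w v"
  using opX_add[of "u - w" w v] by simp

lemma opX_arg_add [simp]: "opX w (u + v) = opX w u + opX w v"
  by (induction w arbitrary: u v) (simp_all add: algebra_simps)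

lemma opX_arg_zero [simp]: "opX w 0 = 0"
  by (induction w) simp_all

lemma opX_arg_scale [simp]: "opX w (to_ac c * v) = to_ac c * opX w v"
  by (induction w arbitrary: v) (simp_all add: distrib_left mult.left_commute)

text \<open>
  The relation \<open>\<tau>^n = \<phi>\<^sub>T - t\<close> brings every \<open>\<tau>^n\<close> back to a polynomial in \<open>\<phi>\<^sub>T\<close>, after
  \<open>\<tau>^n\<close> has been moved to the right past the coefficients.
\<close>
lemma Frob_n_opX: "Frob n (opX w v) = opX ([:- t, 1:] * twist n w) v"
proof (induction w arbitrary: v)
  case (pCons c w)
  have "opX ([:- t, 1:] * twist n (pCons c w)) v =
      opX (smult (Frob n c) [:- t, 1:] + pCons 0 ([:- t, 1:] * twist n w)) v"
    by (simp add: algebra_simps)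
  also have "\<dots> = Frob n c * Frob n v + Frob n (opX w (phiT v))"
    unfolding pCons.IH by (simp add: phiT_def algebra_simps)
  finally show ?case by simp
qed simp

lemma phiT_opX_twist: "phiT (opX w v) = opX (smult t w + [:- t, 1:] * twist n w) v"
  using Frob_n_opX[of w v] by (simp only: phiT_def opX_add opX_smult)

lemma phiT_opX: "twist n w = w \<Longrightarrow> phiT (opX w v) = opX w (phiT v)"
  using phiT_opX_twist[of w v] by simp

text \<open>
  The hypothesis says that the coefficients of the inner factor are fixed by \<open>\<tau>^n\<close>, so that the
  inner operator commutes with \<open>\<phi>\<^sub>T\<close>.
\<close>
lemma opX_mult: "twist n a = a \<Longrightarrow> opX (w * a) v = opX w (opX a v)"
  by (induction w arbitrary: v) (simp_all add: phiT_opX)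

lemma phiT_opX_ac: "phiT (opX (ac_poly a) v) = opX (ac_poly a) (phiT v)"
  by (rule phiT_opX) simp

lemma opX_mult_ac: "opX (w * ac_poly a) v = opX w (opX (ac_poly a) v)"
  by (rule opX_mult) simp

lemma Frob_r_opX: "Frob (r * i) (opX w v) = opX (twist (r * i) w) (Frob (r * i) v)"
  by (induction w arbitrary: v) (simp_all add: phiT_Frob)

text \<open>
  The polynomial in \<open>\<phi>\<^sub>T\<close> that equals \<open>\<tau>^(n j)\<close>.
\<close>
primrec tau_poly :: "nat \<Rightarrow> 'a alg_closure poly" where
  "tau_poly 0 = 1"
| "tau_poly (Suc j) = [:- t, 1:] * twist n (tau_poly j)"

lemma opX_tau_poly: "opX (tau_poly j) v = Frob (n * j) v"
proof (induction j)
  case (Suc j)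
  have "Frob (n * Suc j) v = Frob n (opX (tau_poly j) v)" by (simp add: Suc Frob_Frob)
  then show ?case by (simp add: Frob_n_opX)
qed simp

lemma tau_poly_prod: "tau_poly j = (\<Prod>i<j. [:- Frob (n * i) t, 1:])"
proof (induction j)
  case (Suc j)
  then show ?case
    by (simp only: tau_poly.simps twist_prod prod.lessThan_Suc_shift) (simp add: Frob_Frob)
qed simp

text \<open>
  The ordinary additive polynomial whose values are those of the \<open>a\<close>-th iterate of \<open>\<phi>\<^sub>T\<close>.
\<close>
primrec phiT_poly :: "nat \<Rightarrow> 'a alg_closure poly" where
  "phiT_poly 0 = [:0, 1:]"
| "phiT_poly (Suc a) = smult t (phiT_poly a) + phiT_poly a ^ (CARD('a) ^ n)"

lemma poly_phiT_poly: "poly (phiT_poly a) v = (phiT ^^ a) v"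
  by (induction a) (simp_all add: phiT_def Frob_def)

end

section \<open>Linear maps on the torsion module\<close>

locale drinfeld_torsion = drinfeld_op t n r
  for t :: "'a :: {field, finite} alg_closure" and n r +
  fixes p :: "'a poly"
  assumes n_pos: "n \<ge> 1" and r_pos: "r \<ge> 1" and coprime_nr: "coprime n r"
    and p_nonzero: "p \<noteq> 0" and p_t: "poly (ac_poly p) t \<noteq> 0"
begin

lemma pderiv_phiT_poly: "pderiv (phiT_poly a) = [:t ^ a:]"
proof (induction a)
  case (Suc a)
  have "of_nat CARD('a) = (0 :: 'a alg_closure poly)"
    unfolding of_nat_poly of_nat_CARD_eq_0 by simp
  then show ?case using Suc n_pos by (simp add: pderiv_add pderiv_smult pderiv_power of_nat_CARD_eq_0)
qed (simp add: pderiv_pCons)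

lemma degree_phiT_poly: "degree (phiT_poly a) = CARD('a) ^ (n * a)"
proof (induction a)
  case (Suc a)
  have "1 < CARD('a) ^ n" using n_pos CARD_gt_1[where 'a = 'a] by (intro one_less_power) auto
  then have lt: "CARD('a) ^ (n * a) < CARD('a) ^ (n * Suc a)"
    using CARD_gt_1[where 'a = 'a] n_pos by (intro power_strict_increasing) auto
  have nz: "phiT_poly a \<noteq> 0" using Suc CARD_gt_1[where 'a = 'a] by auto
  have dp: "degree (phiT_poly a ^ (CARD('a) ^ n)) = CARD('a) ^ (n * Suc a)"
    using Suc by (simp add: degree_power_eq[OF nz] power_add)
  have "degree (smult t (phiT_poly a)) < degree (phiT_poly a ^ (CARD('a) ^ n))"
    unfolding dp using Suc lt degree_smult_le[of t "phiT_poly a"] by linarith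
  then show ?case using dp by (simp add: degree_add_eq_right)
qed simp

definition M :: "'a alg_closure set" where "M = {v. opX (ac_poly p) v = 0}"

definition "d = degree p"

text \<open>
  As an ordinary polynomial \<open>\<phi>\<^sub>p\<close> has degree \<open>q^(n d)\<close>, and its derivative is the constant
  \<open>p(t)\<close>, which is nonzero; so its roots are distinct.
\<close>
lemma card_M: "card M = CARD('a) ^ (n * d)"
proof -
  define W where "W = (\<Sum>a\<le>d. smult (coeff (ac_poly p) a) (phiT_poly a))"
  have "poly W v = opX (ac_poly p) v" for v
    by (simp add: W_def poly_sum poly_phiT_poly opX_def d_def)
  then have M: "M = {v. poly W v = 0}" by (simp add: M_def)
  have "pderiv W = (\<Sum>a\<le>d. smult (coeff (ac_poly p) a) [:t ^ a:])"
    by (simp add: W_def pderiv_sum pderiv_smult pderiv_phiT_poly)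
  also have "\<dots> = [:\<Sum>a\<le>d. coeff (ac_poly p) a * t ^ a:]"
    by (simp add: sum_const_poly)
  also have "(\<Sum>a\<le>d. coeff (ac_poly p) a * t ^ a) = poly (ac_poly p) t"
    by (simp add: poly_altdef d_def)
  finally have deriv: "pderiv W = [:poly (ac_poly p) t:]" .
  have "degree W = CARD('a) ^ (n * d)"
  proof (cases d)
    case 0
    then have "coeff (ac_poly p) 0 \<noteq> 0" using p_nonzero by (simp add: coeff_map_poly d_def) (metis leading_coeff_0_iff)
    then show ?thesis using 0 by (simp add: W_def)
  next
    case (Suc e)
    have lc: "coeff (ac_poly p) d \<noteq> 0" using p_nonzero by (simp add: coeff_map_poly d_def)
    have le: "degree (\<Sum>a\<le>e. smult (coeff (ac_poly p) a) (phiT_poly a)) \<le> CARD('a) ^ (n * e)"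
    proof (rule degree_sum_le)
      fix a assume "a \<in> {..e}"
      then have "CARD('a) ^ (n * a) \<le> CARD('a) ^ (n * e)"
        using CARD_gt_1[where 'a = 'a] by (intro power_increasing) auto
      then show "degree (smult (coeff (ac_poly p) a) (phiT_poly a)) \<le> CARD('a) ^ (n * e)"
        using degree_smult_le[of "coeff (ac_poly p) a" "phiT_poly a"] degree_phiT_poly[of a] by linarith
    qed simp
    have lt: "CARD('a) ^ (n * e) < CARD('a) ^ (n * d)"
      using CARD_gt_1[where 'a = 'a] n_pos Suc by (intro power_strict_increasing) auto
    have top: "degree (smult (coeff (ac_poly p) d) (phiT_poly d)) = CARD('a) ^ (n * d)"
      using lc degree_phiT_poly by simp
    \<comment> \<open>The degrees of the summands increase strictly, so the last one determines the degree.\<close>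
    have W_split: "W = (\<Sum>a\<le>e. smult (coeff (ac_poly p) a) (phiT_poly a)) + smult (coeff (ac_poly p) d) (phiT_poly d)"
      by (simp add: W_def Suc)
    have "degree (\<Sum>a\<le>e. smult (coeff (ac_poly p) a) (phiT_poly a))
        < degree (smult (coeff (ac_poly p) d) (phiT_poly d))"
      unfolding top using le lt by linarith
    then show ?thesis unfolding W_split top[symmetric] by (rule degree_add_eq_right)
  qed
  then show ?thesis unfolding M using card_roots_separable[OF deriv p_t] by simp
qed

lemma finite_M: "finite M"
  using card_M CARD_gt_1[where 'a = 'a] by (intro card_ge_0_finite) simp

lemma M_add: "u \<in> M \<Longrightarrow> v \<in> M \<Longrightarrow> u + v \<in> M" by (simp add: M_def)
lemma M_zero: "0 \<in> M" by (simp add: M_def)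
lemma M_scale: "v \<in> M \<Longrightarrow> to_ac c * v \<in> M" by (simp add: M_def)
lemma M_phiT: "v \<in> M \<Longrightarrow> phiT v \<in> M" by (simp add: M_def flip: phiT_opX_ac)
lemma M_opX: "twist n w = w \<Longrightarrow> v \<in> M \<Longrightarrow> opX w v \<in> M"
  unfolding M_def by (simp flip: opX_mult) (simp add: mult.commute[of "ac_poly p"] opX_mult_ac)
lemma M_opX_ac: "v \<in> M \<Longrightarrow> opX (ac_poly a) v \<in> M"
  by (rule M_opX) simp_all
lemma M_Frob: "v \<in> M \<Longrightarrow> Frob (r * i) v \<in> M"
  using Frob_r_opX[of i "ac_poly p" v] by (simp add: M_def)

lemma opX_mod: "v \<in> M \<Longrightarrow> opX (w mod ac_poly p) v = opX w v"
proof -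
  assume v: "v \<in> M"
  have "opX w v = opX ((w div ac_poly p) * ac_poly p + w mod ac_poly p) v"
    by (simp only: div_mult_mod_eq)
  also have "\<dots> = opX (w mod ac_poly p) v" using v unfolding opX_add opX_mult_ac by (simp add: M_def)
  finally show ?thesis by simp
qed

lemma coeff_mod: "a \<ge> d \<Longrightarrow> coeff (w mod ac_poly p) a = 0"
proof (cases "w mod ac_poly p = 0")
  case False
  then have "degree (w mod ac_poly p) < d"
    using degree_mod_less'[of "ac_poly p" w] p_nonzero by (simp add: d_def)
  then show "a \<ge> d \<Longrightarrow> coeff (w mod ac_poly p) a = 0" by (simp add: coeff_eq_0)
qed simp

text \<open>
  Two powers of \<open>\<pi>\<close> agree on the finite set \<open>M\<close>, and \<open>\<pi>\<close> is injective.
\<close>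
lemma Frob_period: "\<exists>e>0. \<forall>v\<in>M. Frob (r * e) v = v"
proof -
  define g where "g = (\<lambda>j. restrict (Frob (r * j)) M)"
  have "range g \<subseteq> M \<rightarrow>\<^sub>E M" using M_Frob by (auto simp: g_def)
  then have "finite (range g)" using finite_PiE[OF finite_M, of "\<lambda>_. M"] finite_M finite_subset by blast
  then have "\<not> inj g" using finite_imageD by fastforce
  then obtain i j where ij: "i < j" "g i = g j" by (auto simp: inj_def) (metis linorder_neqE_nat)
  have "Frob (r * (j - i)) v = v" if "v \<in> M" for v
  proof -
    have "Frob (r * i) v = Frob (r * j) v" using fun_cong[OF ij(2), of v] that by (simp add: g_def)
    also have "\<dots> = Frob (r * i) (Frob (r * (j - i)) v)"
      using ij(1) by (simp add: Frob_Frob flip: distrib_left)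
    finally show ?thesis by simp
  qed
  then show ?thesis using ij(1) by (intro exI[of _ "j - i"]) auto
qed

text \<open>
  Functions are set to zero outside \<open>M\<close>, so that equality as functions is equality on \<open>M\<close> and
  linear algebra can be done in the space of all functions.
\<close>
definition on_M :: "('a alg_closure \<Rightarrow> 'a alg_closure) \<Rightarrow> 'a alg_closure \<Rightarrow> 'a alg_closure" where
  "on_M f v = (if v \<in> M then f v else 0)"

definition tau_map :: "nat \<Rightarrow> 'a alg_closure \<Rightarrow> 'a alg_closure" where "tau_map s = on_M (Frob s)"

definition opX_map :: "nat \<times> nat \<Rightarrow> 'a alg_closure \<Rightarrow> 'a alg_closure" where
  "opX_map = (\<lambda>(i, a). on_M (\<lambda>v. (phiT ^^ a) (Frob (r * i) v)))"

text \<open>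
  A relation between \<open>1, \<tau>, \<dots>, \<tau>^(n d - 1)\<close> on \<open>M\<close> is a polynomial of degree less than
  \<open>q^(n d)\<close> with \<open>q^(n d)\<close> roots. The coefficients can be read off because the exponents \<open>q^i\<close> are
  distinct.
\<close>
lemma tau_map_free: "fun_space.free_family {..<n * d} tau_map"
  unfolding fun_space.free_family_def
proof (intro allI impI ballI)
  fix c s assume sum: "(\<Sum>i<n * d. (\<lambda>v. c i * tau_map i v)) = 0" and s: "s \<in> {..<n * d}"
  define q where "q = CARD('a)"
  have q1: "q > 1" unfolding q_def by (rule CARD_gt_1)
  define W where "W = (\<Sum>i<n * d. monom (c i) (q ^ i))"
  have "poly W v = 0" if "v \<in> M" for v
  proof -
    have "poly W v = (\<Sum>i<n * d. (\<lambda>v. c i * tau_map i v)) v"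
      using that by (simp add: W_def poly_sum poly_monom tau_map_def on_M_def Frob_def q_def fun_sum_apply)
    then show ?thesis unfolding sum by simp
  qed
  then have sub: "M \<subseteq> {v. poly W v = 0}" by blast
  have "W = 0"
  proof (rule ccontr)
    assume W: "W \<noteq> 0"
    have "card M \<le> card {v. poly W v = 0}" by (rule card_mono) (use sub poly_roots_finite[OF W] in auto)
    also have "\<dots> \<le> degree W" by (rule card_poly_roots_bound[OF W])
    also have "\<dots> \<le> q ^ (n * d - 1)" unfolding W_def
    proof (rule degree_sum_le)
      fix i assume "i \<in> {..<n * d}"
      then have "q ^ i \<le> q ^ (n * d - 1)" using q1 by (intro power_increasing) auto
      then show "degree (monom (c i) (q ^ i)) \<le> q ^ (n * d - 1)"
        using degree_monom_le[of "c i" "q ^ i"] by linarith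
    qed simp
    also have "\<dots> < q ^ (n * d)" using q1 s by (intro power_strict_increasing) auto
    finally show False using card_M by (simp add: q_def)
  qed
  moreover have "coeff W (q ^ s) = (\<Sum>i<n * d. if i = s then c i else 0)"
    unfolding W_def coeff_sum using q1 by (intro sum.cong) auto
  ultimately show "c s = 0" using s by simp
qed

text \<open>
  Indices \<open>(i, a)\<close> of the maps \<open>\<phi>\<^sub>T^a \<pi>^i\<close>.
\<close>
definition opX_index :: "(nat \<times> nat) set" where "opX_index = {..<n} \<times> {..<d}"

lemma finite_opX_index: "finite opX_index" and card_opX_index: "card opX_index = n * d" by (simp_all add: opX_index_def)

lemma on_M_opX:
  assumes "i < n"
  shows "on_M (\<lambda>v. opX w (Frob (r * i) v)) = (\<Sum>a<d. (\<lambda>v. coeff (w mod ac_poly p) a * opX_map (i, a) v))"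
proof
  fix v
  show "on_M (\<lambda>v. opX w (Frob (r * i) v)) v = (\<Sum>a<d. (\<lambda>v. coeff (w mod ac_poly p) a * opX_map (i, a) v)) v"
  proof (cases "v \<in> M")
    case True
    then have "opX w (Frob (r * i) v) = opX (w mod ac_poly p) (Frob (r * i) v)"
      by (simp add: opX_mod M_Frob)
    also have "\<dots> = (\<Sum>a<d. coeff (w mod ac_poly p) a * (phiT ^^ a) (Frob (r * i) v))"
      by (rule opX_less) (rule coeff_mod)
    finally show ?thesis using True by (simp add: on_M_def fun_sum_apply opX_map_def)
  qed (simp add: on_M_def fun_sum_apply opX_map_def)
qed

lemma opX_in_span:
  "i < n \<Longrightarrow> on_M (\<lambda>v. opX w (Frob (r * i) v)) \<in> fun_space.span (opX_map ` opX_index)"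
  unfolding on_M_opX
  by (intro fun_space.span_sum fun_space.span_scale fun_space.span_base) (auto simp: opX_index_def)

text \<open>
  On \<open>M\<close> the span of the maps \<open>\<phi>\<^sub>T^a \<pi>^i\<close> contains \<open>\<tau>^(n j) \<pi>^i = \<tau>^(n j + r i)\<close> for all \<open>j\<close>.
  As \<open>n\<close> and \<open>r\<close> are coprime, every large exponent has this form with \<open>i < n\<close>, and the exponent
  \<open>s\<close> can be made large because \<open>\<pi>\<close> has finite order on \<open>M\<close>.
\<close>
lemma tau_map_in_span: "tau_map s \<in> fun_space.span (opX_map ` opX_index)"
proof -
  obtain e where e: "e > 0" "\<forall>v\<in>M. Frob (r * e) v = v" using Frob_period by blast
  have "coprime r n" using coprime_nr by (simp add: coprime_commute)
  then obtain x where x: "[r * x = Suc 0] (mod n)" using cong_solve_coprime_nat by blast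
  define i where "i = (s * x) mod n"
  have i: "i < n" unfolding i_def using n_pos by simp
  have "[r * i = r * (s * x)] (mod n)" unfolding i_def by (simp add: cong_def mod_mult_right_eq)
  also have "r * (s * x) = s * (r * x)" by simp
  also have "[s * (r * x) = s * Suc 0] (mod n)" using x by (rule cong_scalar_left)
  finally have ri: "[r * i = s] (mod n)" by simp
  \<comment> \<open>A multiple of the period, large enough and divisible by n, is added to the exponent.\<close>
  define N where "N = s + (r * e) * (n * (r * i))"
  have "[r * i = N] (mod n)" using ri unfolding N_def by (simp add: cong_def mult.left_commute[of _ n])
  moreover have le: "r * i \<le> N"
  proof -
    have "1 \<le> r * e * n" using e(1) n_pos r_pos by (simp add: Suc_le_eq)
    then have "1 * (r * i) \<le> (r * e * n) * (r * i)" by (rule mult_le_mono1)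
    also have "\<dots> = (r * e) * (n * (r * i))" by (simp only: mult.assoc)
    finally show ?thesis unfolding N_def by linarith
  qed
  ultimately obtain j where j: "N = n * j + r * i"
    using cong_altdef_nat[of "r * i" N n] by (metis cong_diff_iff_cong_0_nat cong_0_iff cong_sym dvdE le le_add_diff_inverse2)
  have "Frob s v = opX (tau_poly j) (Frob (r * i) v)" if "v \<in> M" for v
  proof -
    have "Frob s v = Frob s (Frob ((r * e) * (n * (r * i))) v)"
      using e(2) that Frob_fixed_mult[of "r * e" v "n * (r * i)"] by simp
    also have "\<dots> = Frob N v" unfolding N_def by (simp add: Frob_Frob)
    also have "\<dots> = opX (tau_poly j) (Frob (r * i) v)" unfolding j by (simp add: opX_tau_poly Frob_Frob)
    finally show ?thesis .
  qed
  then have "tau_map s = on_M (\<lambda>v. opX (tau_poly j) (Frob (r * i) v))"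
    unfolding tau_map_def on_M_def by auto
  then show ?thesis using opX_in_span[OF i] by simp
qed

lemma span_tau_map: "fun_space.span (tau_map ` {..<n * d}) = fun_space.span (opX_map ` opX_index)" and opX_map_free: "fun_space.free_family opX_index opX_map"
  using fun_space.free_family_exchange[of "{..<n * d}" opX_index tau_map opX_map] tau_map_free tau_map_in_span finite_opX_index card_opX_index by auto

definition Fq_linear :: "('a alg_closure \<Rightarrow> 'a alg_closure) \<Rightarrow> bool" where
  "Fq_linear f \<longleftrightarrow> (\<forall>u\<in>M. \<forall>v\<in>M. f (u + v) = f u + f v) \<and> (\<forall>c. \<forall>v\<in>M. f (to_ac c * v) = to_ac c * f v)"

lemma Fq_linear_zero: "Fq_linear f \<Longrightarrow> f 0 = 0"
  using M_zero unfolding Fq_linear_def by (metis add_cancel_right_right)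

lemma M_sum: "finite A \<Longrightarrow> A \<subseteq> M \<Longrightarrow> (\<Sum>b\<in>A. to_ac (c b) * b) \<in> M"
  by (induction A rule: finite_induct) (auto intro: M_add M_scale M_zero)

lemma Fq_linear_sum:
  assumes "Fq_linear f" "finite A" "A \<subseteq> M"
  shows "f (\<Sum>b\<in>A. to_ac (c b) * b) = (\<Sum>b\<in>A. to_ac (c b) * f b)"
  using assms(2,3)
proof (induction A rule: finite_induct)
  case (insert b A)
  then have "f (to_ac (c b) * b + (\<Sum>b\<in>A. to_ac (c b) * b)) = f (to_ac (c b) * b) + f (\<Sum>b\<in>A. to_ac (c b) * b)"
    using assms(1) M_sum[of A c] M_scale[of b "c b"] unfolding Fq_linear_def by blast
  then show ?case using insert assms(1) by (simp add: Fq_linear_def)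
qed (simp add: Fq_linear_zero[OF assms(1)])

text \<open>
  The module \<open>M\<close> has a basis of at most \<open>n d\<close> elements over the base field, so the coordinate
  functionals span the linear maps from \<open>M\<close> to the algebraic closure with at most \<open>n d\<close>
  generators. The \<open>n d\<close> independent powers of \<open>\<tau>\<close> are among these maps and therefore span them.
\<close>
lemma Fq_linear_in_span: assumes "Fq_linear f" shows "on_M f \<in> fun_space.span (opX_map ` opX_index)"
proof -
  obtain Bs where Bs: "Bs \<subseteq> M" "Fq_space.independent Bs" "M \<subseteq> Fq_space.span Bs"
    using Fq_space.maximal_independent_subset[of M] by blast
  have fin: "finite Bs" using Bs(1) finite_M finite_subset by blast
  have "card (Bs \<rightarrow>\<^sub>E (UNIV :: 'a set)) \<le> card M"
  proof (rule card_inj_on_le)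
    let ?g = "\<lambda>g. \<Sum>b\<in>Bs. to_ac (g b) * b"
    show "?g ` (Bs \<rightarrow>\<^sub>E UNIV) \<subseteq> M" using M_sum[OF fin Bs(1)] by blast
    show "inj_on ?g (Bs \<rightarrow>\<^sub>E UNIV)"
    proof (rule inj_onI)
      fix g h :: "'a alg_closure \<Rightarrow> 'a"
      assume gh: "g \<in> Bs \<rightarrow>\<^sub>E UNIV" "h \<in> Bs \<rightarrow>\<^sub>E UNIV" "?g g = ?g h"
      have "(\<Sum>b\<in>Bs. to_ac (g b - h b) * b) = 0"
        using gh(3) by (simp add: left_diff_distrib sum_subtractf)
      then have "g b - h b = 0" if "b \<in> Bs" for b
        using Fq_space.independentD[OF Bs(2) fin order_refl, of "\<lambda>b. g b - h b" b] that by simp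
      then show "g = h" using gh(1,2) by (intro PiE_ext) auto
    qed
  qed (rule finite_M)
  then have "CARD('a) ^ card Bs \<le> CARD('a) ^ (n * d)"
    using card_M by (simp add: card_PiE fin)
  then have card: "card Bs \<le> card {..<n * d}"
    using CARD_gt_1[where 'a = 'a] by simp
  define D where "D = (\<lambda>b. on_M (\<lambda>v. to_ac (Fq_space.representation Bs v b)))"
  have expand: "on_M f \<in> fun_space.span (D ` Bs)" if "Fq_linear f" for f
  proof -
    have "on_M f = (\<Sum>b\<in>Bs. (\<lambda>v. f b * D b v))"
    proof
      fix v
      show "on_M f v = (\<Sum>b\<in>Bs. (\<lambda>v. f b * D b v)) v"
      proof (cases "v \<in> M")
        case True
        then have v: "(\<Sum>b\<in>Bs. to_ac (Fq_space.representation Bs v b) * b) = v"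
          using Fq_space.sum_representation_eq[OF Bs(2) _ fin order_refl] Bs(3) by blast
        have "f v = f (\<Sum>b\<in>Bs. to_ac (Fq_space.representation Bs v b) * b)" by (simp add: v)
        also have "\<dots> = (\<Sum>b\<in>Bs. to_ac (Fq_space.representation Bs v b) * f b)"
          by (rule Fq_linear_sum[OF that fin Bs(1)])
        finally show ?thesis using True by (simp add: on_M_def D_def fun_sum_apply mult.commute)
      qed (simp add: on_M_def D_def fun_sum_apply)
    qed
    then show ?thesis by (simp add: fun_space.span_sum fun_space.span_scale fun_space.span_base)
  qed
  have "tau_map s \<in> fun_space.span (D ` Bs)" for s
    unfolding tau_map_def by (rule expand) (simp add: Fq_linear_def)
  then have "fun_space.span (tau_map ` {..<n * d}) = fun_space.span (D ` Bs)"
    by (intro fun_space.free_family_exchange(1)[OF _ fin card tau_map_free]) auto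
  then show ?thesis using expand[OF assms] span_tau_map by simp
qed

lemma Fq_linear_representation:
  assumes "Fq_linear f"
  shows "\<exists>w. (\<forall>i. w i mod ac_poly p = w i) \<and> (\<forall>v\<in>M. f v = (\<Sum>i<n. opX (w i) (Frob (r * i) v)))"
proof -
  have inj: "inj_on opX_map opX_index" using opX_map_free fun_space.free_family_iff[OF finite_opX_index] by blast
  obtain c where c: "on_M f = (\<Sum>j\<in>opX_index. (\<lambda>v. c j * opX_map j v))"
    using fun_space.span_image_family[OF finite_opX_index Fq_linear_in_span[OF assms] inj] by blast
  define w where "w = (\<lambda>i. \<Sum>a<d. monom (c (i, a)) a)"
  have coeff: "coeff (w i) a = (if a < d then c (i, a) else 0)" for i a
    unfolding w_def by (simp add: coeff_sum)
  have "w i mod ac_poly p = w i" for i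
  proof (cases "w i = 0")
    case False
    have "degree (w i) < degree (ac_poly p)"
    proof (rule ccontr)
      assume "\<not> ?thesis"
      then have "lead_coeff (w i) = 0" using coeff by (simp add: d_def)
      then show False using False by simp
    qed
    then show ?thesis by (rule mod_poly_less)
  qed simp
  moreover have "f v = (\<Sum>i<n. opX (w i) (Frob (r * i) v))" if "v \<in> M" for v
  proof -
    have "f v = (\<Sum>(i, a)\<in>opX_index. c (i, a) * (phiT ^^ a) (Frob (r * i) v))"
      using fun_cong[OF c, of v] that
      by (simp add: on_M_def fun_sum_apply opX_map_def case_prod_beta)
    also have "\<dots> = (\<Sum>i<n. \<Sum>a<d. c (i, a) * (phiT ^^ a) (Frob (r * i) v))"
      by (simp add: opX_index_def sum.cartesian_product)
    also have "\<dots> = (\<Sum>i<n. opX (w i) (Frob (r * i) v))"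
      by (intro sum.cong refl, subst opX_less[of d]) (auto simp: coeff)
    finally show ?thesis .
  qed
  ultimately show ?thesis by blast
qed

text \<open>
  Uniqueness of the coordinates: the \<open>n d\<close> maps \<open>\<phi>\<^sub>T^a \<pi>^i\<close> are independent on \<open>M\<close>, so each
  coefficient polynomial, reduced modulo \<open>p\<close>, is zero.
\<close>
lemma opX_sum_zero:
  assumes "\<And>v. v \<in> M \<Longrightarrow> (\<Sum>i<n. opX (w i) (Frob (r * i) v)) = 0" and i: "i < n"
  shows "ac_poly p dvd w i"
proof -
  define c where "c = (\<lambda>(i, a). coeff (w i mod ac_poly p) a)"
  have "(\<Sum>j\<in>opX_index. (\<lambda>v. c j * opX_map j v)) = (\<Sum>i<n. \<Sum>a<d. (\<lambda>v. coeff (w i mod ac_poly p) a * opX_map (i, a) v))"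
    by (simp add: opX_index_def sum.cartesian_product c_def case_prod_beta)
  also have "\<dots> = (\<Sum>i<n. on_M (\<lambda>v. opX (w i) (Frob (r * i) v)))"
    by (intro sum.cong refl) (simp add: on_M_opX)
  also have "\<dots> = 0"
  proof
    fix x
    show "(\<Sum>i<n. on_M (\<lambda>v. opX (w i) (Frob (r * i) v))) x = 0 x"
      using assms(1)[of x] by (cases "x \<in> M") (simp_all add: fun_sum_apply on_M_def)
  qed
  finally have "\<forall>j\<in>opX_index. c j = 0" using opX_map_free unfolding fun_space.free_family_def by blast
  then have "coeff (w i mod ac_poly p) a = 0" for a
    using i coeff_mod[of a "w i"] by (cases "a < d") (auto simp: c_def opX_index_def)
  then have "w i mod ac_poly p = 0" by (intro poly_eqI) simp
  then show ?thesis by (simp add: dvd_eq_mod_eq_0)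
qed

lemma mod_unique:
  assumes "ac_poly p dvd u - w" "u mod ac_poly p = u" "w mod ac_poly p = w"
  shows "u = w"
  using assms by (metis mod_eq_dvd_iff)

lemma twist_mod: "w mod ac_poly p = w \<Longrightarrow> twist k w mod ac_poly p = twist k w"
proof -
  assume w: "w mod ac_poly p = w"
  show ?thesis
  proof (cases "w = 0")
    case False
    then have "degree w < degree (ac_poly p)"
      using degree_mod_less'[of "ac_poly p" w] p_nonzero w by simp
    then show ?thesis by (intro mod_poly_less) simp
  qed simp
qed

text \<open>
  The factor \<open>X - t\<close> is prime to \<open>p\<close> as \<open>p(t) \<noteq> 0\<close>.
\<close>
lemma dvd_cancel_linear:
  assumes "ac_poly p dvd [:- t, 1:] * k" shows "ac_poly p dvd k"
proof -
  obtain g where g: "[:- t, 1:] * k = ac_poly p * g" using assms by (auto elim: dvdE)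
  have "poly (ac_poly p) t * poly g t = poly ([:- t, 1:] * k) t" unfolding g by simp
  then have "poly g t = 0" using p_t by simp
  then obtain l where l: "g = [:- t, 1:] * l" by (auto simp: poly_eq_0_iff_dvd elim: dvdE)
  have "[:- t, 1:] * k = [:- t, 1:] * (ac_poly p * l)" unfolding g l by (simp only: mult_ac)
  then have "k = ac_poly p * l" by (simp only: mult_cancel_left) simp
  then show ?thesis by simp
qed

lemma Frob_surj_M: assumes "v \<in> M" shows "\<exists>u\<in>M. v = Frob (r * i) u"
proof -
  have "Frob (r * i) ` M = M"
    by (rule endo_inj_surj[OF finite_M]) (auto intro: M_Frob inj_onI)
  then show ?thesis using assms by blast
qed

lemma gcd_n_rm: assumes "m dvd n" shows "gcd n (r * m) = m"
proof -
  obtain k where k: "n = m * k" using assms by (auto elim: dvdE)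
  have "coprime k r" using coprime_nr k by simp
  then show ?thesis unfolding k by (simp add: mult.commute[of r] gcd_mult_distrib_nat[symmetric])
qed

text \<open>
  Every linear map is uniquely a sum of operators \<open>w\<^sub>i \<pi>^i\<close> with \<open>deg w\<^sub>i < d\<close>. Since
  \<open>\<phi>\<^sub>T w\<^sub>i = (t w\<^sub>i + (X - t) w\<^sub>i')\<close> with \<open>w\<^sub>i'\<close> the \<open>n\<close>-th twist of \<open>w\<^sub>i\<close>, commuting with
  \<open>\<phi>\<^sub>T\<close> means \<open>(X - t)(w\<^sub>i - w\<^sub>i') = 0\<close> modulo \<open>p\<close>, so \<open>w\<^sub>i\<close> has coefficients fixed by the
  \<open>n\<close>-th Frobenius. Commuting with \<open>\<pi>^m\<close> means that they are fixed by the \<open>r m\<close>-th one. As \<open>n\<close> and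
  \<open>r\<close> are coprime and \<open>m\<close> divides \<open>n\<close>, the greatest common divisor of \<open>n\<close> and \<open>r m\<close> is \<open>m\<close>.
\<close>
lemma centralizer_representation:
  assumes f: "Fq_linear f" and M: "\<And>v. v \<in> M \<Longrightarrow> f v \<in> M"
    and comm_T: "\<And>v. v \<in> M \<Longrightarrow> f (phiT v) = phiT (f v)"
    and comm_F: "\<And>v. v \<in> M \<Longrightarrow> f (Frob (r * m) v) = Frob (r * m) (f v)"
    and m: "m dvd n"
  shows "\<exists>w. (\<forall>i<n. twist m (w i) = w i) \<and> (\<forall>v\<in>M. f v = (\<Sum>i<n. opX (w i) (Frob (r * i) v)))"
proof -
  obtain w where wd: "\<And>i. w i mod ac_poly p = w i"
    and w: "\<And>v. v \<in> M \<Longrightarrow> f v = (\<Sum>i<n. opX (w i) (Frob (r * i) v))"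
    using Fq_linear_representation[OF f] by blast
  have "twist m (w i) = w i" if i: "i < n" for i
  proof -
    have "ac_poly p dvd [:- t, 1:] * (w i - twist n (w i))"
    proof (rule opX_sum_zero[OF _ i])
      fix v assume v: "v \<in> M"
      have "f (phiT v) = (\<Sum>i<n. opX (pCons 0 (w i)) (Frob (r * i) v))"
        unfolding w[OF M_phiT[OF v]] by (simp add: phiT_Frob)
      moreover have "phiT (f v) = (\<Sum>i<n. opX (smult t (w i) + [:- t, 1:] * twist n (w i)) (Frob (r * i) v))"
      proof -
        have "phiT (sum g A) = (\<Sum>x\<in>A. phiT (g x))" for g :: "nat \<Rightarrow> _" and A
          by (induction A rule: infinite_finite_induct) auto
        then show ?thesis unfolding w[OF v] by (simp only: phiT_opX_twist)
      qed
      ultimately have "(\<Sum>i<n. opX (pCons 0 (w i)) (Frob (r * i) v) -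
          opX (smult t (w i) + [:- t, 1:] * twist n (w i)) (Frob (r * i) v)) = 0"
        using comm_T[OF v] by (simp only: sum_subtractf) simp
      moreover have "opX ([:- t, 1:] * (w i - twist n (w i))) u =
          opX (pCons 0 (w i)) u - opX (smult t (w i) + [:- t, 1:] * twist n (w i)) u" for i u
        unfolding opX_diff[symmetric] by (simp add: algebra_simps)
      ultimately show "(\<Sum>i<n. opX ([:- t, 1:] * (w i - twist n (w i))) (Frob (r * i) v)) = 0"
        by (simp only:)
    qed
    then have "ac_poly p dvd w i - twist n (w i)" by (rule dvd_cancel_linear)
    then have 1: "twist n (w i) = w i" using mod_unique wd twist_mod by metis
    have "ac_poly p dvd w i - twist (r * m) (w i)"
    proof (rule opX_sum_zero[OF _ i])
      fix v assume "v \<in> M"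
      then obtain u where u: "u \<in> M" "v = Frob (r * m) u" using Frob_surj_M by blast
      have "f v = (\<Sum>i<n. opX (w i) (Frob (r * i) v))" using w[of v] \<open>v \<in> M\<close> by simp
      moreover have "f v = (\<Sum>i<n. opX (twist (r * m) (w i)) (Frob (r * i) v))"
        unfolding u(2) comm_F[OF u(1)] w[OF u(1)]
        by (simp add: Frob_sum Frob_r_opX Frob_Frob add.commute)
      ultimately show "(\<Sum>i<n. opX (w i - twist (r * m) (w i)) (Frob (r * i) v)) = 0"
        by (simp add: sum_subtractf)
    qed
    then have 2: "twist (r * m) (w i) = w i" using mod_unique wd twist_mod by metis
    show ?thesis using twist_fixed_gcd[OF 1 2] gcd_n_rm[OF m] by simp
  qed
  then show ?thesis using w by blast
qed

text \<open>
  The polynomial \<open>\<theta>\<close> with \<open>\<tau>^(n r) = \<theta>(\<phi>\<^sub>T)\<close> is the product of \<open>X - \<tau>^(n i)(t)\<close> over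
  \<open>i < r\<close>. Because \<open>\<tau>^r\<close> fixes \<open>t\<close>, the \<open>n\<close>-th Frobenius only permutes the factors and the
  \<open>r\<close>-th one fixes each of them; by coprimality \<open>\<theta>\<close> is defined over the base field. It is monic of
  degree \<open>r\<close> and vanishes at \<open>t\<close>, so it is \<open>\<pp>\<^sub>0\<close>.
\<close>
lemma opX_characteristic:
  assumes p0: "Factorial_Ring.irreducible p0" "lead_coeff p0 = 1" "degree p0 = r"
    and t: "poly (ac_poly p0) t = 0"
  shows "opX (ac_poly p0) v = Frob (r * n) v"
proof -
  let ?f = "\<lambda>i. [:- Frob (n * i) t, 1:]"
  let ?W = "tau_poly r"
  \<comment> \<open>Twisting shifts the index of each factor by one; the last factor returns to the first.\<close>
  have fr: "?f r = ?f 0" using Frob_fixed_mult[OF Frob_t, of n] by (simp add: mult.commute)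
  have "?f 0 * twist n ?W = ?f 0 * (\<Prod>i<r. ?f (Suc i))"
    by (simp add: tau_poly_prod twist_prod Frob_Frob)
  also have "\<dots> = (\<Prod>i<Suc r. ?f i)" by (simp only: prod.lessThan_Suc_shift o_def)
  also have "\<dots> = ?f 0 * ?W" unfolding prod.lessThan_Suc fr tau_poly_prod by (rule mult.commute)
  finally have "twist n ?W = ?W" by (simp only: mult_cancel_left) simp
  moreover have "twist r ?W = ?W"
  proof -
    have "Frob r (Frob i t) = Frob i t" for i
      using Frob_t by (metis Frob_Frob add.commute)
    then show ?thesis by (simp add: tau_poly_prod twist_prod)
  qed
  ultimately have "twist 1 ?W = ?W" using twist_fixed_gcd[of n ?W r] coprime_nr by simp
  then obtain T0 where T0: "?W = ac_poly T0" using twist_1_fixedE by blast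
  have "poly (ac_poly T0) t = 0"
    unfolding T0[symmetric] tau_poly_prod poly_prod using r_pos
    by (intro prod_zero) (auto intro!: bexI[of _ 0])
  then have "p0 dvd T0" using irreducible_dvd_of_root[OF p0(1) t] by simp
  then obtain c where c: "T0 = p0 * c" by (auto elim: dvdE)
  have degW: "degree ?W = r" unfolding tau_poly_prod by (subst degree_prod_eq_sum_degree) auto
  have lcW: "lead_coeff ?W = 1" unfolding tau_poly_prod lead_coeff_prod by simp
  have T0_nz: "T0 \<noteq> 0" using lcW T0 by auto
  have "degree T0 = r" using degW T0 by simp
  moreover have "degree T0 = degree p0 + degree c" using T0_nz c by (auto intro: degree_mult_eq)
  ultimately obtain e where e: "c = [:e:]" using p0(3) by (auto elim: degree_eq_zeroE)
  have "lead_coeff ?W = to_ac (lead_coeff T0)" unfolding T0 by (simp add: coeff_map_poly)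
  moreover have "lead_coeff T0 = e" using c e p0(2) by (cases "e = 0") auto
  ultimately have "to_ac e = to_ac 1" using lcW by simp
  then have "e = 1" using to_ac_eq_iff by blast
  then have "?W = ac_poly p0" using T0 c e by (simp add: one_pCons[symmetric])
  then show ?thesis using opX_tau_poly[of r v] by (simp add: mult.commute)
qed

end

section \<open>The ring of endomorphisms\<close>

lemma Fq_ext_iff: "x \<in> Fq_ext r \<longleftrightarrow> Frob r x = x"
  by (simp add: Fq_ext_def Frob_def)

lemma Fq_ext_ring_simps [simp]:
  "carrier (Fq_ext_ring r) = Fq_ext r" "monoid.mult (Fq_ext_ring r) = (*)" "monoid.one (Fq_ext_ring r) = 1"
  "ring.zero (Fq_ext_ring r) = 0" "ring.add (Fq_ext_ring r) = (+)"
  by (simp_all add: Fq_ext_ring_def ring_of_type_algebra_def)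

lemma ring_Fq_ext_ring: "ring (Fq_ext_ring r)"
proof (intro ringI abelian_groupI monoidI)
  fix x :: "'a alg_closure" assume "x \<in> carrier (Fq_ext_ring r)"
  then show "\<exists>y\<in>carrier (Fq_ext_ring r). y \<oplus>\<^bsub>Fq_ext_ring r\<^esub> x = \<zero>\<^bsub>Fq_ext_ring r\<^esub>"
    by (intro bexI[of _ "- x"]) (simp_all add: Fq_ext_iff)
qed (auto simp: Fq_ext_iff algebra_simps)

interpretation twisted: skew_poly "Fq_ext_ring r" "\<lambda>x :: 'a :: {field, finite} alg_closure. x ^ CARD('a)" for r
proof -
  have "(\<lambda>x :: 'a alg_closure. x ^ CARD('a)) \<in> ring_hom (Fq_ext_ring r) (Fq_ext_ring r)"
    by (rule ring_hom_memI) (auto simp: Fq_ext_iff Frob_power power_mult_distrib power_CARD_add)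
  then show "skew_poly (Fq_ext_ring r) (\<lambda>x :: 'a alg_closure. x ^ CARD('a))"
    by (intro skew_poly.intro skew_poly_axioms.intro ring_Fq_ext_ring)
qed

lemma q_power_funpow:
  "((\<lambda>x :: 'a :: {field, finite} alg_closure. x ^ CARD('a)) ^^ j) x = Frob j x"
  by (induction j) (simp_all add: Frob_def power_mult[symmetric] mult.commute)

lemma twisted_act_bound:
  assumes "\<And>i. i > N \<Longrightarrow> f i = 0"
  shows "twisted_act f x = (\<Sum>i\<le>N. f i * Frob i x)"
  unfolding twisted_act_def Frob_def
  by (rule sum.mono_neutral_left) (use assms not_le in auto)

lemma twisted_carrierE:
  assumes "f \<in> carrier (twisted_ring r)" obtains N where "\<And>i. i > N \<Longrightarrow> f i = 0"
  using assms twisted.carrier_iff[of f r] by (auto simp: twisted_ring_def)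

lemma twisted_act_add:
  assumes "f \<in> carrier (twisted_ring r)" "g \<in> carrier (twisted_ring r)"
  shows "twisted_act (f \<oplus>\<^bsub>twisted_ring r\<^esub> g) x = twisted_act f x + twisted_act g x"
proof -
  obtain a b where ab: "\<And>i. i > a \<Longrightarrow> f i = 0" "\<And>i. i > b \<Longrightarrow> g i = 0"
    using assms by (metis twisted_carrierE)
  have "(f \<oplus>\<^bsub>twisted_ring r\<^esub> g) i = f i + g i" for i
    by (simp add: twisted_ring_def twisted.add_coeff)
  moreover have "twisted_act (f \<oplus>\<^bsub>twisted_ring r\<^esub> g) x =
     (\<Sum>i\<le>max a b. (f \<oplus>\<^bsub>twisted_ring r\<^esub> g) i * Frob i x)"
    by (rule twisted_act_bound) (use ab in \<open>auto simp: calculation\<close>)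
  moreover have "twisted_act f x = (\<Sum>i\<le>max a b. f i * Frob i x)"
    "twisted_act g x = (\<Sum>i\<le>max a b. g i * Frob i x)"
    by (rule twisted_act_bound, use ab in simp)+
  ultimately show ?thesis by (simp add: distrib_right sum.distrib)
qed

text \<open>
  The powers of \<open>\<phi>\<^sub>T = t + \<tau>^n\<close> are built up by left multiplication by two monomials.
\<close>
lemma twisted_act_monom_mult:
  assumes "a \<in> Fq_ext r" "g \<in> carrier (twisted_ring r)"
  shows "twisted_act (skew_monom (Fq_ext_ring r) a j \<otimes>\<^bsub>twisted_ring r\<^esub> g) x = a * Frob j (twisted_act g x)"
proof -
  obtain N where N: "\<And>i. i > N \<Longrightarrow> g i = 0" using assms(2) twisted_carrierE by metis
  let ?h = "skew_monom (Fq_ext_ring r) a j \<otimes>\<^bsub>twisted_ring r\<^esub> g"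
  have h: "?h k = (if k < j then 0 else a * Frob j (g (k - j)))" for k
    using twisted.monom_mult_coeff[of a r g j k] assms
    unfolding q_power_funpow twisted_ring_def by simp
  have "twisted_act ?h x = (\<Sum>k\<le>N + j. ?h k * Frob k x)"
    by (rule twisted_act_bound) (use N in \<open>auto simp: h\<close>)
  also have "\<dots> = (\<Sum>k=0+j..N+j. ?h k * Frob k x)"
    by (rule sum.mono_neutral_right) (auto simp: h)
  also have "\<dots> = (\<Sum>k=0..N. ?h (k + j) * Frob (k + j) x)"
    by (rule sum.shift_bounds_cl_nat_ivl)
  also have "\<dots> = (\<Sum>k\<le>N. a * (Frob j (g k) * Frob (k + j) x))"
    by (simp add: h atMost_atLeast0 mult.assoc)
  also have "\<dots> = a * Frob j (twisted_act g x)"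
    by (simp add: twisted_act_bound[OF N] Frob_sum sum_distrib_left Frob_Frob add.commute)
  finally show ?thesis .
qed

lemma ring_twisted_ring: "ring (twisted_ring r)"
  unfolding twisted_ring_def by (rule twisted.is_ring)

lemma twisted_monom_closed: "a \<in> Fq_ext r \<Longrightarrow> skew_monom (Fq_ext_ring r) a j \<in> carrier (twisted_ring r)"
  unfolding twisted_ring_def by (rule twisted.monom_closed) simp

lemma twisted_act_one: "twisted_act \<one>\<^bsub>twisted_ring r\<^esub> x = x"
proof -
  have "twisted_act \<one>\<^bsub>twisted_ring r\<^esub> x = (\<Sum>i\<le>0. \<one>\<^bsub>twisted_ring r\<^esub> i * Frob i x)"
    by (rule twisted_act_bound) (simp add: twisted_ring_def twisted.one_coeff)
  then show ?thesis by (simp add: twisted_ring_def twisted.one_coeff)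
qed

lemma twisted_act_finsum:
  fixes F :: "'i \<Rightarrow> nat \<Rightarrow> 'a :: {field, finite} alg_closure"
  assumes "finite A" "F \<in> A \<rightarrow> carrier (twisted_ring r)"
  shows "twisted_act (\<Oplus>\<^bsub>twisted_ring r\<^esub>i\<in>A. F i) x = (\<Sum>i\<in>A. twisted_act (F i) x)"
proof -
  interpret W: ring "twisted_ring r :: (nat \<Rightarrow> 'a alg_closure) ring" by (rule ring_twisted_ring)
  show ?thesis using assms
  proof (induction A rule: finite_induct)
    case empty
    have "twisted_act (\<zero>\<^bsub>twisted_ring r\<^esub> :: nat \<Rightarrow> 'a alg_closure) x = 0"
      by (simp add: twisted_act_def twisted_ring_def twisted.zero_coeff)
    then show ?case by simp
  next
    case (insert i A)
    then have F: "F i \<in> carrier (twisted_ring r)" "F \<in> A \<rightarrow> carrier (twisted_ring r)" by auto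
    then show ?case using insert.hyps insert.IH
      by (simp add: twisted_act_add W.finsum_closed)
  qed
qed

context drinfeld_op
begin

lemma twisted_act_drinfeld: "twisted_act (drinfeld r n t a) v = opX (ac_poly a) v"
proof -
  interpret W: ring "twisted_ring r :: (nat \<Rightarrow> 'a alg_closure) ring" by (rule ring_twisted_ring)
  let ?D = "drinfeld_T r n t" and ?W = "twisted_ring r"
  have t: "t \<in> Fq_ext r" and one: "1 \<in> Fq_ext r" using Frob_t by (simp_all add: Fq_ext_iff)
  have D: "?D \<in> carrier ?W" unfolding drinfeld_T_def
    by (intro W.a_closed twisted_monom_closed t one)
  have act_D: "twisted_act (?D \<otimes>\<^bsub>?W\<^esub> g) v = phiT (twisted_act g v)" if "g \<in> carrier ?W" for g v
  proof -
    have m: "skew_monom (Fq_ext_ring r) t 0 \<in> carrier ?W" "skew_monom (Fq_ext_ring r) 1 n \<in> carrier ?W"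
      using t one by (auto intro: twisted_monom_closed)
    show ?thesis
      unfolding drinfeld_T_def W.l_distr[OF m that]
        twisted_act_add[OF W.m_closed[OF m(1) that] W.m_closed[OF m(2) that]]
        twisted_act_monom_mult[OF t that] twisted_act_monom_mult[OF one that]
      by (simp add: phiT_def)
  qed
  have pow: "twisted_act (?D [^]\<^bsub>?W\<^esub> i) v = (phiT ^^ i) v" for i :: nat and v
  proof (induction i)
    case 0
    show ?case by (simp add: twisted_act_one)
  next
    case (Suc i)
    have "?D [^]\<^bsub>?W\<^esub> Suc i = ?D \<otimes>\<^bsub>?W\<^esub> ?D [^]\<^bsub>?W\<^esub> i" by (rule W.nat_pow_Suc2[OF D])
    then show ?case using act_D[OF W.nat_pow_closed[OF D], of i v] Suc by simp
  qed
  have c: "to_ac c \<in> Fq_ext r" for c :: 'a by (simp add: Fq_ext_iff)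
  have "twisted_act (drinfeld r n t a) v =
     (\<Sum>i\<le>degree a. twisted_act (skew_monom (Fq_ext_ring r) (to_ac (coeff a i)) 0 \<otimes>\<^bsub>?W\<^esub> (?D [^]\<^bsub>?W\<^esub> i)) v)"
    unfolding drinfeld_def
    by (rule twisted_act_finsum) (auto intro!: W.m_closed W.nat_pow_closed D twisted_monom_closed c)
  also have "\<dots> = (\<Sum>i\<le>degree a. to_ac (coeff a i) * (phiT ^^ i) v)"
    by (intro sum.cong refl) (simp add: twisted_act_monom_mult W.nat_pow_closed D c pow)
  also have "\<dots> = opX (ac_poly a) v" unfolding opX_def by (simp add: coeff_map_poly)
  finally show ?thesis .
qed

end

lemma residue_class_iff: "b \<in> residue_class p a \<longleftrightarrow> p dvd b - a"
proof -
  have "b \<in> residue_class p a \<longleftrightarrow> (\<exists>x. b = x * p + a)"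
    by (auto simp: residue_class_def a_r_coset_def' cgenideal_def ring_of_type_algebra_def)
  also have "\<dots> \<longleftrightarrow> p dvd b - a"
    by (auto simp: dvd_def algebra_simps)
  finally show ?thesis .
qed

lemma carrier_residue_field: "carrier (residue_field p) = range (residue_class p)"
  by (auto simp: residue_field_def FactRing_def A_RCOSETS_def' residue_class_def
      ring_of_type_algebra_def a_r_coset_def')

context drinfeld_torsion
begin

abbreviation "MM \<equiv> torsion_module r n t p"
abbreviation "EE \<equiv> E_ring r n t p"

lemma carrier_torsion: "carrier MM = M"
  by (simp add: torsion_module_def M_def twisted_act_drinfeld)

lemma add_torsion: "x \<oplus>\<^bsub>MM\<^esub> y = x + y" and zero_torsion: "\<zero>\<^bsub>MM\<^esub> = 0"
  by (simp_all add: torsion_module_def)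

lemma opX_cong: "v \<in> M \<Longrightarrow> ac_poly p dvd u - w \<Longrightarrow> opX u v = opX w v"
  using opX_mod[of v u] opX_mod[of v w] by (metis mod_eq_dvd_iff)

text \<open>
  Whichever representative of the coset is chosen, it differs from \<open>a\<close> by a multiple of \<open>p\<close>, which
  acts as zero on \<open>M\<close>.
\<close>
lemma smult_torsion: assumes "v \<in> M" shows "residue_class p a \<odot>\<^bsub>MM\<^esub> v = opX (ac_poly a) v"
proof -
  define b where "b = (SOME b. b \<in> residue_class p a)"
  have "a \<in> residue_class p a" by (simp add: residue_class_iff)
  then have "b \<in> residue_class p a" unfolding b_def by (rule someI)
  then obtain c where "b - a = p * c" by (auto simp: residue_class_iff elim: dvdE)
  then have "ac_poly b - ac_poly a = ac_poly p * ac_poly c" by (metis ac_poly_diff ac_poly_mult)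
  then have "ac_poly p dvd ac_poly b - ac_poly a" by simp
  then have "opX (ac_poly b) v = opX (ac_poly a) v" by (rule opX_cong[OF assms])
  then show ?thesis by (simp add: torsion_module_def twisted_act_drinfeld b_def)
qed

lemma Fq_linear_opX: "Fq_linear f \<Longrightarrow> (\<And>v. v \<in> M \<Longrightarrow> f (phiT v) = phiT (f v)) \<Longrightarrow> v \<in> M
    \<Longrightarrow> f (opX (ac_poly a) v) = opX (ac_poly a) (f v)"
proof (induction a arbitrary: v)
  case 0
  then show ?case by (simp add: Fq_linear_zero)
next
  case (pCons c a)
  have "f (to_ac c * v + opX (ac_poly a) (phiT v)) = f (to_ac c * v) + f (opX (ac_poly a) (phiT v))"
    using pCons.prems M_scale M_opX_ac[OF M_phiT] unfolding Fq_linear_def by blast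
  also have "f (to_ac c * v) = to_ac c * f v" using pCons.prems unfolding Fq_linear_def by blast
  also have "f (opX (ac_poly a) (phiT v)) = opX (ac_poly a) (phiT (f v))"
    using pCons.IH[of "phiT v"] pCons.prems M_phiT by simp
  finally show ?case by (simp add: map_poly_pCons)
qed

text \<open>
  As \<open>T\<close> and the constants generate \<open>\<F>\<^sub>q[T]\<close>, linearity over the residue field amounts to
  linearity over \<open>\<F>\<^sub>q\<close> and commuting with \<open>\<phi>\<^sub>T\<close>.
\<close>
lemma E_carrier:
  "f \<in> carrier EE \<longleftrightarrow> f \<in> M \<rightarrow>\<^sub>E M \<and> Fq_linear f \<and> (\<forall>v\<in>M. f (phiT v) = phiT (f v))"
proof -
  have "f \<in> carrier EE \<longleftrightarrow> f \<in> M \<rightarrow>\<^sub>E M \<and> (\<forall>x\<in>M. \<forall>y\<in>M. f (x + y) = f x + f y) \<and>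
     (\<forall>a. \<forall>x\<in>M. f (opX (ac_poly a) x) = opX (ac_poly a) (f x))"
    by (auto simp: E_ring_def End_ring_def carrier_torsion add_torsion carrier_residue_field
        smult_torsion PiE_iff)
  also have "\<dots> \<longleftrightarrow> f \<in> M \<rightarrow>\<^sub>E M \<and> Fq_linear f \<and> (\<forall>v\<in>M. f (phiT v) = phiT (f v))"
  proof (intro iffI conjI; elim conjE)
    assume f: "\<forall>x\<in>M. \<forall>y\<in>M. f (x + y) = f x + f y"
      "\<forall>a. \<forall>x\<in>M. f (opX (ac_poly a) x) = opX (ac_poly a) (f x)"
    have "f (to_ac c * v) = to_ac c * f v" if "v \<in> M" for c v
      using f(2)[rule_format, OF that, of "[:c:]"] by (simp add: map_poly_pCons)
    with f(1) show "Fq_linear f" unfolding Fq_linear_def by blast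
    show "\<forall>v\<in>M. f (phiT v) = phiT (f v)"
      using f(2)[rule_format, of _ "[:0, 1:]"] by (simp add: map_poly_pCons)
  next
    assume f: "Fq_linear f" "\<forall>v\<in>M. f (phiT v) = phiT (f v)"
    then show "\<forall>x\<in>M. \<forall>y\<in>M. f (x + y) = f x + f y" by (simp add: Fq_linear_def)
    show "\<forall>a. \<forall>x\<in>M. f (opX (ac_poly a) x) = opX (ac_poly a) (f x)"
      using Fq_linear_opX f by blast
  qed
  finally show ?thesis .
qed

lemma E_mult: "f \<otimes>\<^bsub>EE\<^esub> g = compose M f g"
  and E_one: "\<one>\<^bsub>EE\<^esub> = (\<lambda>x\<in>M. x)"
  and E_zero: "\<zero>\<^bsub>EE\<^esub> = (\<lambda>x\<in>M. 0)"
  and E_add: "f \<oplus>\<^bsub>EE\<^esub> g = (\<lambda>x\<in>M. f x + g x)"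
  by (simp_all add: E_ring_def End_ring_def carrier_torsion add_torsion zero_torsion)

lemma E_mem: "f \<in> carrier EE \<Longrightarrow> v \<in> M \<Longrightarrow> f v \<in> M"
  by (auto simp: E_carrier PiE_mem)

lemma E_restrictI:
  assumes "\<And>v. v \<in> M \<Longrightarrow> f v \<in> M" "Fq_linear f" "\<And>v. v \<in> M \<Longrightarrow> f (phiT v) = phiT (f v)"
  shows "restrict f M \<in> carrier EE"
  using assms M_phiT M_add M_scale by (auto simp: E_carrier Fq_linear_def)

lemma E_Fq_linear: "f \<in> carrier EE \<Longrightarrow> Fq_linear f" and E_phiT: "f \<in> carrier EE \<Longrightarrow> v \<in> M \<Longrightarrow> f (phiT v) = phiT (f v)"
  by (auto simp: E_carrier)

lemma Fq_linearD: "Fq_linear f \<Longrightarrow> u \<in> M \<Longrightarrow> v \<in> M \<Longrightarrow> f (u + v) = f u + f v"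
  "Fq_linear f \<Longrightarrow> v \<in> M \<Longrightarrow> f (to_ac c * v) = to_ac c * f v"
  by (auto simp: Fq_linear_def)

lemma ring_E: "ring EE"
proof (intro ringI abelian_groupI monoidI)
  fix f g assume f: "f \<in> carrier EE" and g: "g \<in> carrier EE"
  note [simp] = E_mem[OF f] E_mem[OF g] M_phiT M_add M_scale Fq_linearD[OF E_Fq_linear[OF f]] Fq_linearD[OF E_Fq_linear[OF g]]
    E_phiT[OF f] E_phiT[OF g]
  show "f \<oplus>\<^bsub>EE\<^esub> g \<in> carrier EE" unfolding E_add
    by (rule E_restrictI) (simp_all add: Fq_linear_def add_ac distrib_left)
  show "f \<otimes>\<^bsub>EE\<^esub> g \<in> carrier EE" unfolding E_mult compose_def
    by (rule E_restrictI) (simp_all add: Fq_linear_def add_ac distrib_left)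
  show "f \<oplus>\<^bsub>EE\<^esub> g = g \<oplus>\<^bsub>EE\<^esub> f" by (auto simp: E_add add.commute)
next
  fix f g h assume f: "f \<in> carrier EE" and g: "g \<in> carrier EE" and h: "h \<in> carrier EE"
  note [simp] = E_mem[OF f] E_mem[OF g] E_mem[OF h] M_add Fq_linearD[OF E_Fq_linear[OF h]]
  show "f \<oplus>\<^bsub>EE\<^esub> g \<oplus>\<^bsub>EE\<^esub> h = f \<oplus>\<^bsub>EE\<^esub> (g \<oplus>\<^bsub>EE\<^esub> h)" by (auto simp: E_add add.assoc)
  show "f \<otimes>\<^bsub>EE\<^esub> g \<otimes>\<^bsub>EE\<^esub> h = f \<otimes>\<^bsub>EE\<^esub> (g \<otimes>\<^bsub>EE\<^esub> h)"
    by (auto simp: E_mult compose_def)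
  show "(f \<oplus>\<^bsub>EE\<^esub> g) \<otimes>\<^bsub>EE\<^esub> h = f \<otimes>\<^bsub>EE\<^esub> h \<oplus>\<^bsub>EE\<^esub> g \<otimes>\<^bsub>EE\<^esub> h"
    by (auto simp: E_mult E_add compose_def)
  show "h \<otimes>\<^bsub>EE\<^esub> (f \<oplus>\<^bsub>EE\<^esub> g) = h \<otimes>\<^bsub>EE\<^esub> f \<oplus>\<^bsub>EE\<^esub> h \<otimes>\<^bsub>EE\<^esub> g"
    by (auto simp: E_mult E_add compose_def)
next
  show one: "\<one>\<^bsub>EE\<^esub> \<in> carrier EE" unfolding E_one
    by (rule E_restrictI) (simp_all add: Fq_linear_def)
  show "\<zero>\<^bsub>EE\<^esub> \<in> carrier EE" unfolding E_zero
    by (rule E_restrictI) (simp_all add: Fq_linear_def M_zero)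
next
  fix f assume f: "f \<in> carrier EE"
  note [simp] = E_mem[OF f] M_phiT M_add M_scale Fq_linearD[OF E_Fq_linear[OF f]] E_phiT[OF f]
  have on_M: "f \<in> extensional M" using f by (auto simp: E_carrier PiE_def)
  show "\<one>\<^bsub>EE\<^esub> \<otimes>\<^bsub>EE\<^esub> f = f" "f \<otimes>\<^bsub>EE\<^esub> \<one>\<^bsub>EE\<^esub> = f" "\<zero>\<^bsub>EE\<^esub> \<oplus>\<^bsub>EE\<^esub> f = f"
    using on_M by (auto simp: E_mult E_one E_add E_zero compose_def extensional_def)
  have neg: "phiT (- v) = - phiT v" for v by (simp add: phiT_def)
  have negM: "- v \<in> M" if "v \<in> M" for v using M_scale[OF that, of "-1"] by simp
  have "(\<lambda>v\<in>M. - f v) \<in> carrier EE"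
    by (rule E_restrictI) (simp_all add: Fq_linear_def neg negM)
  moreover have "(\<lambda>v\<in>M. - f v) \<oplus>\<^bsub>EE\<^esub> f = \<zero>\<^bsub>EE\<^esub>" by (auto simp: E_add E_zero)
  ultimately show "\<exists>g\<in>carrier EE. g \<oplus>\<^bsub>EE\<^esub> f = \<zero>\<^bsub>EE\<^esub>" by blast
qed

sublocale E: ring EE by (rule ring_E)

lemma frob_eq: "frob r n t p = restrict (Frob r) M"
  unfolding frob_def carrier_torsion Frob_def[abs_def] ..

lemma Frob_in_E: "restrict (Frob (r * i)) M \<in> carrier EE"
  by (rule E_restrictI) (simp_all add: M_Frob Fq_linear_def phiT_Frob)

lemma frob_closed: "frob r n t p \<in> carrier EE"
  using Frob_in_E[of 1] by (simp add: frob_eq)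

lemma frob_pow: "frob r n t p [^]\<^bsub>EE\<^esub> (i :: nat) = restrict (Frob (r * i)) M"
proof (induction i)
  case (Suc i)
  have "Frob r v \<in> M" if "v \<in> M" for v using M_Frob[OF that, of 1] by simp
  then show ?case using Suc by (auto simp: E_mult frob_eq compose_def Frob_Frob add.commute)
qed (simp add: E_one)

lemma frob_Unit: "frob r n t p \<in> Units EE"
proof -
  obtain e where e: "e > 0" "\<forall>v\<in>M. Frob (r * e) v = v" using Frob_period by blast
  have one: "frob r n t p [^]\<^bsub>EE\<^esub> e = \<one>\<^bsub>EE\<^esub>"
    unfolding frob_pow E_one using e(2) by auto
  have "Suc (e - 1) = e" using e(1) by simp
  then have "frob r n t p [^]\<^bsub>EE\<^esub> (e - 1) \<otimes>\<^bsub>EE\<^esub> frob r n t p = \<one>\<^bsub>EE\<^esub>"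
    "frob r n t p \<otimes>\<^bsub>EE\<^esub> frob r n t p [^]\<^bsub>EE\<^esub> (e - 1) = \<one>\<^bsub>EE\<^esub>"
    using one E.nat_pow_Suc[of "frob r n t p" "e - 1"] E.nat_pow_Suc2[OF frob_closed, of "e - 1"] by simp_all
  then show ?thesis unfolding Units_def using frob_closed E.nat_pow_closed[OF frob_closed] by blast
qed

text \<open>
  Restricted to polynomials over the field with \<open>q^m\<close> elements, this realizes multiplication by
  elements of \<open>K\<close>: constants give \<open>L\<close>, and polynomials over \<open>\<F>\<^sub>q\<close> give the residue field.
\<close>
definition scalar_end :: "'a alg_closure poly \<Rightarrow> 'a alg_closure \<Rightarrow> 'a alg_closure" where
  "scalar_end w = restrict (opX w) M"

lemma kappa_scalar_eq: "kappa_scalar r n t p (residue_class p a) = scalar_end (ac_poly a)"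
  by (auto simp: kappa_scalar_def carrier_torsion smult_torsion scalar_end_def)

lemma scalar_end_closed: "twist n w = w \<Longrightarrow> scalar_end w \<in> carrier EE"
  unfolding scalar_end_def by (rule E_restrictI) (simp_all add: M_opX Fq_linear_def phiT_opX)

lemma scalar_end_add: "scalar_end u \<oplus>\<^bsub>EE\<^esub> scalar_end w = scalar_end (u + w)"
  by (auto simp: E_add scalar_end_def)

lemma scalar_end_zero: "scalar_end 0 = \<zero>\<^bsub>EE\<^esub>" and scalar_end_one: "scalar_end 1 = \<one>\<^bsub>EE\<^esub>"
  by (auto simp: scalar_end_def E_zero E_one)

lemma scalar_end_mult: "twist n w = w \<Longrightarrow> scalar_end u \<otimes>\<^bsub>EE\<^esub> scalar_end w = scalar_end (u * w)"
  by (auto simp: scalar_end_def E_mult compose_def opX_mult M_opX)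

lemma scalar_end_neg: "twist n w = w \<Longrightarrow> \<ominus>\<^bsub>EE\<^esub> scalar_end w = scalar_end (- w)"
proof -
  assume w: "twist n w = w"
  have w': "twist n (- w) = - w" using w twist_diff[of n 0 w] by simp
  have "scalar_end (- w) \<oplus>\<^bsub>EE\<^esub> scalar_end w = \<zero>\<^bsub>EE\<^esub>" by (simp add: scalar_end_add scalar_end_zero)
  then show ?thesis using E.minus_equality scalar_end_closed[OF w] scalar_end_closed[OF w'] by simp
qed

text \<open>
  A polynomial operator that vanishes on \<open>M\<close> is a relation that involves only \<open>\<pi>^0\<close>.
\<close>
lemma scalar_end_eq_zero_iff: "scalar_end w = \<zero>\<^bsub>EE\<^esub> \<longleftrightarrow> ac_poly p dvd w"
proof
  assume "scalar_end w = \<zero>\<^bsub>EE\<^esub>"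
  then have z: "opX w v = 0" if "v \<in> M" for v
    using that by (auto simp: scalar_end_def E_zero restrict_def fun_eq_iff) metis
  have "ac_poly p dvd (if (0::nat) = 0 then w else 0)"
  proof (rule opX_sum_zero[of "\<lambda>i. if i = 0 then w else 0"])
    fix v assume v: "v \<in> M"
    have "(\<Sum>i<n. opX (if i = 0 then w else 0) (Frob (r * i) v)) = (\<Sum>i<n. if i = 0 then opX w v else 0)"
      by (intro sum.cong) auto
    then show "(\<Sum>i<n. opX (if i = 0 then w else 0) (Frob (r * i) v)) = 0" using z[OF v] by simp
  qed (use n_pos in simp)
  then show "ac_poly p dvd w" by simp
next
  assume "ac_poly p dvd w"
  then have "scalar_end w v = \<zero>\<^bsub>EE\<^esub> v" for v
    using opX_cong[of v w 0] by (simp add: scalar_end_def E_zero)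
  then show "scalar_end w = \<zero>\<^bsub>EE\<^esub>" by blast
qed

end

section \<open>The centralizer as a cyclic quotient\<close>

context ring
begin

lemma centralizer_subring: "H \<subseteq> carrier R \<Longrightarrow> subring (centralizer R H) R"
proof (rule subringI)
  assume H: "H \<subseteq> carrier R"
  fix x y assume x: "x \<in> centralizer R H" and y: "y \<in> centralizer R H"
  then have c: "x \<in> carrier R" "y \<in> carrier R" by (auto simp: centralizer_def)
  have xh: "x \<otimes> h = h \<otimes> x" and yh: "y \<otimes> h = h \<otimes> y" if "h \<in> H" for h
    using x y that by (auto simp: centralizer_def)
  have "(x \<otimes> y) \<otimes> h = h \<otimes> (x \<otimes> y)" if h: "h \<in> H" for h
  proof -
    have "(x \<otimes> y) \<otimes> h = x \<otimes> (h \<otimes> y)" using c H h yh[OF h] by (auto simp: m_assoc)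
    also have "\<dots> = (h \<otimes> x) \<otimes> y" using c H h xh[OF h] by (auto simp flip: m_assoc)
    finally show ?thesis using c H h by (auto simp: m_assoc)
  qed
  then show "x \<otimes> y \<in> centralizer R H" using c by (simp add: centralizer_def)
  show "x \<oplus> y \<in> centralizer R H"
    using c H xh yh by (auto simp: centralizer_def l_distr r_distr subsetD)
  show "\<ominus> x \<in> centralizer R H"
    using c H xh by (auto simp: centralizer_def l_minus r_minus subsetD)
qed (auto simp: centralizer_def subsetD)

text \<open>
  The elements that commute with a given one form a subring, so commuting with generators suffices.
\<close>
lemma centralizer_generate_ring:
  assumes H: "H \<subseteq> carrier R"
  shows "centralizer R (generate_ring R H) = centralizer R H"
proof (intro equalityI subsetI)
  fix x assume "x \<in> centralizer R (generate_ring R H)"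
  then show "x \<in> centralizer R H" by (auto simp: centralizer_def intro: generate_ring.incl)
next
  fix x assume x: "x \<in> centralizer R H"
  then have c: "x \<in> carrier R" by (simp add: centralizer_def)
  have "subring (centralizer R {x}) R" by (rule centralizer_subring) (use c in simp)
  note sub = subringE[OF this]
  have "h \<in> centralizer R {x}" if "h \<in> generate_ring R H" for h
    using that
  proof induction
    case (incl h)
    then show ?case using x H by (auto simp: centralizer_def)
  qed (use sub in auto)
  then show "x \<in> centralizer R (generate_ring R H)" using c by (simp add: centralizer_def)
qed

end

locale drinfeld_endo = drinfeld_torsion t n r p
  for t :: "'a :: {field, finite} alg_closure" and n r :: nat and p :: "'a poly" +
  fixes p0 :: "'a poly" and m :: nat
  assumes p0: "Factorial_Ring.irreducible p0" "lead_coeff p0 = 1" "degree p0 = r" "poly (ac_poly p0) t = 0"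
    and p: "Factorial_Ring.irreducible p" and p_p0: "\<not> p dvd p0"
    and m_n: "m dvd n" and coprime_m: "coprime m (degree p)"
begin

abbreviation "RR \<equiv> R_ring r n t p m"
abbreviation "KK \<equiv> K_set r n t p m"
abbreviation "\<pi> \<equiv> frob r n t p"

lemma m_pos: "m \<noteq> 0" using m_n n_pos by auto

lemma twist_n: "twist m w = w \<Longrightarrow> twist n w = w"
  using m_n twist_fixed_mult by (auto elim!: dvdE)

lemma twist_rm: "twist m w = w \<Longrightarrow> twist (r * m) w = w"
  using twist_fixed_mult[of m w r] by (simp add: mult.commute)

lemma degree_p_nonzero: "degree p \<noteq> 0"
proof
  assume "degree p = 0"
  then have "p dvd 1" using p_nonzero by (simp add: is_unit_iff_degree)
  then show False using p Factorial_Ring.irreducible_not_unit by blast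
qed

lemma R0_gens: "kappa_scalar r n t p ` carrier (residue_field p) \<union> {\<pi> [^]\<^bsub>EE\<^esub> m} \<subseteq> carrier EE"
  by (auto simp: carrier_residue_field kappa_scalar_eq frob_pow intro!: scalar_end_closed Frob_in_E)

lemma carrier_RR: "carrier RR = centralizer EE
    (kappa_scalar r n t p ` carrier (residue_field p) \<union> {\<pi> [^]\<^bsub>EE\<^esub> m})"
  unfolding R_ring_def R0_def E.centralizer_generate_ring[OF R0_gens] by simp

text \<open>
  The generators of \<open>R\<^sub>0\<close> coming from the residue field commute with all of \<open>E\<close>; only \<open>\<pi>^m\<close>
  imposes a condition.
\<close>
lemma R_carrier:
  "f \<in> carrier RR \<longleftrightarrow> f \<in> carrier EE \<and> (\<forall>v\<in>M. f (Frob (r * m) v) = Frob (r * m) (f v))"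
proof -
  have kappa: "f \<otimes>\<^bsub>EE\<^esub> scalar_end (ac_poly a) = scalar_end (ac_poly a) \<otimes>\<^bsub>EE\<^esub> f" if f: "f \<in> carrier EE" for f a
    using f by (auto simp: E_mult compose_def scalar_end_def M_opX E_mem Fq_linear_opX E_Fq_linear E_phiT)
  have pow: "f \<otimes>\<^bsub>EE\<^esub> (\<pi> [^]\<^bsub>EE\<^esub> m) = (\<pi> [^]\<^bsub>EE\<^esub> m) \<otimes>\<^bsub>EE\<^esub> f \<longleftrightarrow>
      (\<forall>v\<in>M. f (Frob (r * m) v) = Frob (r * m) (f v))" if f: "f \<in> carrier EE" for f
  proof
    assume eq: "f \<otimes>\<^bsub>EE\<^esub> (\<pi> [^]\<^bsub>EE\<^esub> m) = (\<pi> [^]\<^bsub>EE\<^esub> m) \<otimes>\<^bsub>EE\<^esub> f"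
    show "\<forall>v\<in>M. f (Frob (r * m) v) = Frob (r * m) (f v)"
    proof
      fix v assume v: "v \<in> M"
      show "f (Frob (r * m) v) = Frob (r * m) (f v)"
        using fun_cong[OF eq, of v] v E_mem[OF f v] by (simp add: E_mult frob_pow compose_def)
    qed
  next
    assume "\<forall>v\<in>M. f (Frob (r * m) v) = Frob (r * m) (f v)"
    then show "f \<otimes>\<^bsub>EE\<^esub> (\<pi> [^]\<^bsub>EE\<^esub> m) = (\<pi> [^]\<^bsub>EE\<^esub> m) \<otimes>\<^bsub>EE\<^esub> f"
      using f by (auto simp: E_mult frob_pow compose_def E_mem)
  qed
  show ?thesis unfolding carrier_RR centralizer_def
    using kappa pow by (auto simp: carrier_residue_field kappa_scalar_eq)
qed

lemma R_simps:
  "f \<otimes>\<^bsub>RR\<^esub> g = f \<otimes>\<^bsub>EE\<^esub> g" "f \<oplus>\<^bsub>RR\<^esub> g = f \<oplus>\<^bsub>EE\<^esub> g" "\<one>\<^bsub>RR\<^esub> = \<one>\<^bsub>EE\<^esub>" "\<zero>\<^bsub>RR\<^esub> = \<zero>\<^bsub>EE\<^esub>"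
  by (simp_all add: R_ring_def)

lemma subring_R: "subring (carrier RR) EE"
  unfolding carrier_RR by (rule E.centralizer_subring[OF R0_gens])

lemma ring_R: "ring RR"
proof -
  have "RR = EE\<lparr>carrier := carrier RR\<rparr>" by (simp add: R_ring_def)
  then show ?thesis using E.subring_is_ring[OF subring_R] by simp
qed

sublocale R: ring RR by (rule ring_R)

lemma R_pow: "\<pi> [^]\<^bsub>RR\<^esub> (i :: nat) = restrict (Frob (r * i)) M"
proof -
  have "\<pi> [^]\<^bsub>RR\<^esub> i = \<pi> [^]\<^bsub>EE\<^esub> i" by (induction i) (simp_all add: R_simps)
  then show ?thesis by (simp add: frob_pow)
qed

lemma frob_in_R: "\<pi> \<in> carrier RR"
  unfolding R_carrier using frob_closed M_Frob[of _ m] by (auto simp: frob_eq Frob_Frob add.commute)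

lemma scalar_end_in_R: assumes "twist m w = w" shows "scalar_end w \<in> carrier RR"
proof -
  have "Frob (r * m) (opX w v) = opX w (Frob (r * m) v)" for v
    by (simp add: Frob_r_opX twist_rm[OF assms])
  then show ?thesis
    unfolding R_carrier using scalar_end_closed[OF twist_n[OF assms]] M_Frob by (auto simp: scalar_end_def)
qed

lemma R_finsum:
  assumes "finite A" "F \<in> A \<rightarrow> carrier RR"
  shows "(\<Oplus>\<^bsub>RR\<^esub>i\<in>A. F i) = restrict (\<lambda>v. \<Sum>i\<in>A. F i v) M"
  using assms
proof (induction A rule: finite_induct)
  case empty
  show ?case by (simp add: R_simps E_zero)
next
  case (insert i A)
  then have "F i \<in> carrier RR" "F \<in> A \<rightarrow> carrier RR" by auto
  then show ?case using insert.hyps insert.IH by (auto simp: R_simps E_add)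
qed

text \<open>
  A product of a scalar \<open>z\<close> and \<open>\<phi>\<^sub>a\<close> is the operator of the polynomial \<open>z a\<close>. Such polynomials
  generate additively all polynomials over the field with \<open>q^m\<close> elements, already with \<open>a\<close> running
  over the powers of the variable.
\<close>
lemma K_eq: "KK = scalar_end ` {w. twist m w = w}"
proof (intro equalityI subsetI)
  let ?G = "{l \<otimes>\<^bsub>EE\<^esub> kappa_scalar r n t p u | l u. l \<in> L_scalars r n t p m \<and> u \<in> carrier (residue_field p)}"
  have gen: "(\<lambda>v\<in>M. z * v) \<otimes>\<^bsub>EE\<^esub> scalar_end (ac_poly a) = scalar_end (smult z (ac_poly a))" for z a
    by (auto simp: E_mult compose_def scalar_end_def M_opX)
  have G: "?G = {scalar_end (smult z (ac_poly a)) | z a. Frob m z = z}"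
  proof (intro equalityI subsetI)
    fix x assume "x \<in> ?G"
    then obtain z a where "x = (\<lambda>v\<in>M. z * v) \<otimes>\<^bsub>EE\<^esub> kappa_scalar r n t p (residue_class p a)"
      and z: "Frob m z = z"
      by (auto simp: L_scalars_def carrier_torsion carrier_residue_field Fq_ext_iff)
    then have "x = scalar_end (smult z (ac_poly a))" by (simp only: kappa_scalar_eq gen)
    with z show "x \<in> {scalar_end (smult z (ac_poly a)) | z a. Frob m z = z}" by blast
  next
    fix x assume "x \<in> {scalar_end (smult z (ac_poly a)) | z a. Frob m z = z}"
    then obtain z a where x: "x = scalar_end (smult z (ac_poly a))" "Frob m z = z" by blast
    have "x = (\<lambda>v\<in>M. z * v) \<otimes>\<^bsub>EE\<^esub> kappa_scalar r n t p (residue_class p a)"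
      by (simp only: kappa_scalar_eq gen x)
    moreover have "z \<in> Fq_ext m" using x by (simp add: Fq_ext_iff)
    ultimately show "x \<in> ?G"
      unfolding L_scalars_def carrier_torsion carrier_residue_field by blast
  qed
  have K: "KK = generate (add_monoid EE) {scalar_end (smult z (ac_poly a)) | z a. Frob m z = z}"
    unfolding K_set_def G ..
  {
    fix x assume "x \<in> KK"
    then show "x \<in> scalar_end ` {w. twist m w = w}" unfolding K
    proof induction
      case one
      have "scalar_end 0 \<in> scalar_end ` {w. twist m w = w}" by (intro imageI) simp
      then show ?case by (simp add: scalar_end_zero)
    next
      case (incl h)
      then show ?case by auto
    next
      case (inv h)
      then obtain z a where h: "h = scalar_end (smult z (ac_poly a))" "Frob m z = z" by blast
      let ?w = "smult z (ac_poly a)"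
      have w: "twist m ?w = ?w" using h by simp
      have w': "twist m (- ?w) = - ?w" using w twist_diff[of m 0 ?w] by simp
      have "inv\<^bsub>add_monoid EE\<^esub> h = \<ominus>\<^bsub>EE\<^esub> scalar_end ?w" by (simp add: h a_inv_def)
      also have "\<dots> = scalar_end (- ?w)" by (rule scalar_end_neg) (rule twist_n[OF w])
      finally show ?case using w' by blast
    next
      case (eng h1 h2)
      then obtain u w where "h1 = scalar_end u" "h2 = scalar_end w" "twist m u = u" "twist m w = w" by blast
      then have "h1 \<otimes>\<^bsub>add_monoid EE\<^esub> h2 = scalar_end (u + w)" "twist m (u + w) = u + w"
        by (simp_all add: scalar_end_add)
      then show ?case by blast
    qed
  next
    fix x assume "x \<in> scalar_end ` {w. twist m w = w}"
    then obtain w where w: "twist m w = w" "x = scalar_end w" by blast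
    have fix_coeff: "Frob m (coeff w i) = coeff w i" for i using w(1) by (metis coeff_twist)
    have "scalar_end (\<Sum>i\<in>A. monom (coeff w i) i) \<in> KK" if "finite A" for A
      using that
    proof (induction A rule: finite_induct)
      case empty
      show ?case using generate.one[of "add_monoid EE"] by (simp add: scalar_end_zero K)
    next
      case (insert i A)
      have "monom (coeff w i) i = smult (coeff w i) (ac_poly (monom 1 i))"
        by (rule poly_eqI) (simp add: coeff_map_poly)
      then have "scalar_end (monom (coeff w i) i) \<in> KK"
        unfolding K using fix_coeff by (intro generate.incl) auto
      then have "scalar_end (monom (coeff w i) i) \<otimes>\<^bsub>add_monoid EE\<^esub> scalar_end (\<Sum>i\<in>A. monom (coeff w i) i) \<in> KK"
        using insert.IH unfolding K by (rule generate.eng)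
      then show ?case using insert.hyps by (simp add: scalar_end_add)
    qed
    from this[of "{..degree w}"] show "x \<in> KK" unfolding w(2) by (simp add: poly_as_sum_of_monoms)
  }
qed

lemma K_sub_R: "KK \<subseteq> carrier RR" unfolding K_eq using scalar_end_in_R by auto

text \<open>
  Through the polynomial description \<open>K\<close> is the polynomial ring over the field with \<open>q^m\<close> elements
  modulo \<open>p\<close>, and every element not divisible by \<open>p\<close> is invertible there.
\<close>
lemma subfield_K: "subfield KK RR"
proof -
  have neg: "twist m (- w) = - w" if "twist m w = w" for w
    using that twist_diff[of m 0 w] by simp
  have mult: "scalar_end u \<otimes>\<^bsub>RR\<^esub> scalar_end w = scalar_end (u * w)" if "twist m w = w" for u w
    using scalar_end_mult[OF twist_n[OF that]] by (simp add: R_simps)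
  have add: "scalar_end u \<oplus>\<^bsub>RR\<^esub> scalar_end w = scalar_end (u + w)" for u w by (simp add: R_simps scalar_end_add)
  have one: "\<one>\<^bsub>RR\<^esub> = scalar_end 1" and zero: "\<zero>\<^bsub>RR\<^esub> = scalar_end 0" by (simp_all add: R_simps scalar_end_one scalar_end_zero)
  have zero_iff: "scalar_end w = \<zero>\<^bsub>RR\<^esub> \<longleftrightarrow> ac_poly p dvd w" for w by (simp add: R_simps scalar_end_eq_zero_iff)
  have inverse: "\<exists>y\<in>KK. y \<otimes>\<^bsub>RR\<^esub> x = \<one>\<^bsub>RR\<^esub> \<and> x \<otimes>\<^bsub>RR\<^esub> y = \<one>\<^bsub>RR\<^esub>" if x: "x \<in> KK - {\<zero>\<^bsub>RR\<^esub>}" for x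
  proof -
    obtain w where w: "x = scalar_end w" "twist m w = w" using x unfolding K_eq by blast
    have w0: "\<not> ac_poly p dvd w" using x zero_iff[of w] w(1) by simp
    obtain u where u: "twist m u = u" "ac_poly p dvd u * w - 1"
      using inverse_mod_irreducible[OF p coprime_m m_pos w(2) w0] by blast
    have "scalar_end (u * w) = scalar_end 1"
      using u(2) opX_cong by (auto simp: scalar_end_def)
    then have "scalar_end u \<otimes>\<^bsub>RR\<^esub> x = \<one>\<^bsub>RR\<^esub>" "x \<otimes>\<^bsub>RR\<^esub> scalar_end u = \<one>\<^bsub>RR\<^esub>"
      using w u by (simp_all add: mult one mult.commute)
    then show ?thesis using u unfolding K_eq by blast
  qed
  have p_nonunit: "\<not> ac_poly p dvd 1"
    using is_unit_iff_degree[of "ac_poly p"] p_nonzero degree_p_nonzero by simp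
  have sub: "subring KK RR"
  proof (rule R.subringI)
    show "\<one>\<^bsub>RR\<^esub> \<in> KK" unfolding K_eq one by (intro imageI) simp
  next
    fix h assume "h \<in> KK"
    then obtain w where w: "h = scalar_end w" "twist m w = w" unfolding K_eq by blast
    have "scalar_end (- w) \<oplus>\<^bsub>RR\<^esub> scalar_end w = \<zero>\<^bsub>RR\<^esub>" by (simp add: add zero)
    then have "\<ominus>\<^bsub>RR\<^esub> h = scalar_end (- w)"
      using R.minus_equality[of "scalar_end (- w)" h] scalar_end_in_R[OF w(2)] scalar_end_in_R[OF neg[OF w(2)]] w(1) by simp
    then show "\<ominus>\<^bsub>RR\<^esub> h \<in> KK" unfolding K_eq using neg[OF w(2)] by blast
  next
    fix h1 h2 assume "h1 \<in> KK" "h2 \<in> KK"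
    then obtain u w where uw: "h1 = scalar_end u" "twist m u = u" "h2 = scalar_end w" "twist m w = w"
      unfolding K_eq by blast
    then have "h1 \<otimes>\<^bsub>RR\<^esub> h2 = scalar_end (u * w)" "twist m (u * w) = u * w"
      "h1 \<oplus>\<^bsub>RR\<^esub> h2 = scalar_end (u + w)" "twist m (u + w) = u + w" by (simp_all add: mult add)
    then show "h1 \<otimes>\<^bsub>RR\<^esub> h2 \<in> KK" "h1 \<oplus>\<^bsub>RR\<^esub> h2 \<in> KK" unfolding K_eq by blast+
  qed (rule K_sub_R)
  have comm: "x \<otimes>\<^bsub>RR\<^esub> y = y \<otimes>\<^bsub>RR\<^esub> x" if "x \<in> KK" "y \<in> KK" for x y
    using that unfolding K_eq by (auto simp: mult mult.commute)
  have one_zero: "\<one>\<^bsub>RR\<^esub> \<noteq> \<zero>\<^bsub>RR\<^esub>" using p_nonunit zero_iff[of 1] one by simp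
  have "subcring KK RR" by (rule R.subcringI[OF sub comm])
  moreover have "x = \<zero>\<^bsub>RR\<^esub> \<or> y = \<zero>\<^bsub>RR\<^esub>" if xy: "x \<in> KK" "y \<in> KK" "x \<otimes>\<^bsub>RR\<^esub> y = \<zero>\<^bsub>RR\<^esub>" for x y
  proof (rule ccontr)
    assume ne: "\<not> (x = \<zero>\<^bsub>RR\<^esub> \<or> y = \<zero>\<^bsub>RR\<^esub>)"
    then obtain z where z: "z \<in> KK" "z \<otimes>\<^bsub>RR\<^esub> x = \<one>\<^bsub>RR\<^esub>" using inverse[of x] xy by blast
    have c: "x \<in> carrier RR" "y \<in> carrier RR" "z \<in> carrier RR" using xy z K_sub_R by auto
    have "y = (z \<otimes>\<^bsub>RR\<^esub> x) \<otimes>\<^bsub>RR\<^esub> y" using z c by simp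
    also have "\<dots> = \<zero>\<^bsub>RR\<^esub>" using xy(3) c by (simp add: R.m_assoc)
    finally show False using ne by simp
  qed
  ultimately have dom: "subdomain KK RR" using one_zero by (intro R.subdomainI)
  have units: "Units (RR\<lparr>carrier := KK\<rparr>) = KK - {\<zero>\<^bsub>RR\<^esub>}"
  proof (intro equalityI subsetI)
    fix x assume "x \<in> Units (RR\<lparr>carrier := KK\<rparr>)"
    then obtain y where xy: "x \<in> KK" "y \<in> KK" "y \<otimes>\<^bsub>RR\<^esub> x = \<one>\<^bsub>RR\<^esub>" by (auto simp: Units_def)
    have "x \<noteq> \<zero>\<^bsub>RR\<^esub>" using xy one_zero K_sub_R by auto
    then show "x \<in> KK - {\<zero>\<^bsub>RR\<^esub>}" using xy by simp
  next
    fix x assume "x \<in> KK - {\<zero>\<^bsub>RR\<^esub>}"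
    then show "x \<in> Units (RR\<lparr>carrier := KK\<rparr>)" using inverse[of x] by (auto simp: Units_def)
  qed
  show ?thesis by (intro subfield.intro subfield_axioms.intro dom units)
qed

lemma frob_scalar_end: "\<pi> \<otimes>\<^bsub>EE\<^esub> scalar_end w = scalar_end (twist r w) \<otimes>\<^bsub>EE\<^esub> \<pi>" if "twist n w = w"
proof -
  have "Frob r v \<in> M" if "v \<in> M" for v using M_Frob[OF that, of 1] by simp
  then show ?thesis
    using Frob_r_opX[of 1 w] M_opX[OF that] by (auto simp: E_mult compose_def frob_eq scalar_end_def)
qed

lemma twist_twist_comm: "twist j w = w \<Longrightarrow> twist j (twist k w) = twist k w"
proof -
  assume w: "twist j w = w"
  have "twist j (twist k w) = twist k (twist j w)" by (simp add: twist_twist add.commute)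
  then show ?thesis by (simp add: w)
qed

lemma conj_scalar_end: "twist n w = w \<Longrightarrow> conj_frob r n t p (scalar_end w) = scalar_end (twist r w)"
proof -
  assume w: "twist n w = w"
  have "twist n (twist r w) = twist r w" using w by (rule twist_twist_comm)
  then have c: "scalar_end (twist r w) \<in> carrier EE" by (rule scalar_end_closed)
  have "conj_frob r n t p (scalar_end w) = (scalar_end (twist r w) \<otimes>\<^bsub>EE\<^esub> \<pi>) \<otimes>\<^bsub>EE\<^esub> inv\<^bsub>EE\<^esub> \<pi>"
    unfolding conj_frob_def using frob_scalar_end[OF w] by simp
  also have "\<dots> = scalar_end (twist r w)"
    using c frob_closed frob_Unit E.Units_inv_closed[OF frob_Unit] E.Units_r_inv[OF frob_Unit]
    by (simp add: E.m_assoc)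
  finally show ?thesis .
qed

lemma scalar_end_p0: "\<pi> [^]\<^bsub>RR\<^esub> n = scalar_end (ac_poly p0)"
  unfolding R_pow scalar_end_def opX_characteristic[OF p0, abs_def] ..

text \<open>
  The identification of \<open>R\<close> with \<open>K[y;\<sigma>]/(y^n - c)\<close>. Surjectivity is the description of the
  centralizer by coordinates \<open>w\<^sub>i\<close> over the field with \<open>q^m\<close> elements, injectivity the
  uniqueness of these coordinates modulo \<open>p\<close>, and \<open>\<pi>^n = c\<close> the identity \<open>\<tau>^(n r) = \<phi>\<^sub>a\<close> for
  \<open>a = \<pp>\<^sub>0\<close>.
\<close>
sublocale cyc: cyclic_skew RR KK "conj_frob r n t p" \<pi> "kappa_scalar r n t p (residue_class p p0)" n
proof (intro cyclic_skew.intro cyclic_skew_axioms.intro ring_R subfield_K frob_in_R n_pos)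
  show "conj_frob r n t p \<in> ring_hom (RR\<lparr>carrier := KK\<rparr>) (RR\<lparr>carrier := KK\<rparr>)"
  proof (rule ring_hom_memI)
    fix x assume "x \<in> carrier (RR\<lparr>carrier := KK\<rparr>)"
    then obtain w where w: "x = scalar_end w" "twist m w = w" unfolding K_eq by auto
    then have "conj_frob r n t p x = scalar_end (twist r w)" by (simp add: conj_scalar_end twist_n)
    then show "conj_frob r n t p x \<in> carrier (RR\<lparr>carrier := KK\<rparr>)"
      unfolding K_eq using twist_twist_comm[OF w(2)] by simp
  next
    fix x y assume "x \<in> carrier (RR\<lparr>carrier := KK\<rparr>)" "y \<in> carrier (RR\<lparr>carrier := KK\<rparr>)"
    then obtain u w where "x = scalar_end u" "y = scalar_end w" "twist m u = u" "twist m w = w" unfolding K_eq by auto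
    moreover from this have "twist n u = u" "twist n w = w" "twist n (twist r w) = twist r w"
      using twist_n twist_twist_comm by auto
    ultimately show "conj_frob r n t p (x \<otimes>\<^bsub>RR\<lparr>carrier := KK\<rparr>\<^esub> y) =
        conj_frob r n t p x \<otimes>\<^bsub>RR\<lparr>carrier := KK\<rparr>\<^esub> conj_frob r n t p y"
      "conj_frob r n t p (x \<oplus>\<^bsub>RR\<lparr>carrier := KK\<rparr>\<^esub> y) =
        conj_frob r n t p x \<oplus>\<^bsub>RR\<lparr>carrier := KK\<rparr>\<^esub> conj_frob r n t p y"
      by (simp_all add: R_simps scalar_end_mult scalar_end_add conj_scalar_end)
  next
    show "conj_frob r n t p \<one>\<^bsub>RR\<lparr>carrier := KK\<rparr>\<^esub> = \<one>\<^bsub>RR\<lparr>carrier := KK\<rparr>\<^esub>"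
      using conj_scalar_end[of 1] by (simp add: R_simps scalar_end_one)
  qed
next
  fix x assume "x \<in> KK"
  then obtain w where w: "x = scalar_end w" "twist m w = w" unfolding K_eq by auto
  show "\<pi> \<otimes>\<^bsub>RR\<^esub> x = conj_frob r n t p x \<otimes>\<^bsub>RR\<^esub> \<pi>"
    using frob_scalar_end[OF twist_n[OF w(2)]] conj_scalar_end[OF twist_n[OF w(2)]] w(1) by (simp add: R_simps)
next
  show "kappa_scalar r n t p (residue_class p p0) \<in> KK"
    unfolding K_eq kappa_scalar_eq by (intro imageI) simp
  have "\<not> ac_poly p dvd ac_poly p0"
  proof
    assume dvd: "ac_poly p dvd ac_poly p0"
    obtain x where x: "poly (ac_poly p) x = 0"
      using alg_closed_imp_poly_has_root[of "ac_poly p"] degree_p_nonzero by auto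
    then have "poly (ac_poly p0) x = 0" using dvd by (auto elim!: dvdE)
    then show False using irreducible_dvd_of_root[OF p x] p_p0 by blast
  qed
  then show "kappa_scalar r n t p (residue_class p p0) \<noteq> \<zero>\<^bsub>RR\<^esub>"
    unfolding kappa_scalar_eq R_simps scalar_end_eq_zero_iff .
  show "\<pi> [^]\<^bsub>RR\<^esub> n = kappa_scalar r n t p (residue_class p p0)"
    unfolding kappa_scalar_eq by (rule scalar_end_p0)
next
  fix x assume "x \<in> carrier RR"
  then have x: "x \<in> carrier EE" "\<And>v. v \<in> M \<Longrightarrow> x (Frob (r * m) v) = Frob (r * m) (x v)"
    by (auto simp: R_carrier)
  obtain w where w: "\<And>i. i < n \<Longrightarrow> twist m (w i) = w i"
      "\<And>v. v \<in> M \<Longrightarrow> x v = (\<Sum>i<n. opX (w i) (Frob (r * i) v))"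
    using centralizer_representation[OF E_Fq_linear[OF x(1)] E_mem[OF x(1)] E_phiT[OF x(1)] x(2) m_n]
    by blast
  define f where "f = (\<lambda>i. scalar_end (if i < n then w i else 0))"
  have fK: "f i \<in> KK" for i unfolding f_def K_eq using w(1) by (intro imageI) auto
  have "(\<Oplus>\<^bsub>RR\<^esub>i\<in>{..<n}. f i \<otimes>\<^bsub>RR\<^esub> \<pi> [^]\<^bsub>RR\<^esub> i) =
     restrict (\<lambda>v. \<Sum>i<n. (f i \<otimes>\<^bsub>RR\<^esub> \<pi> [^]\<^bsub>RR\<^esub> i) v) M"
    using fK K_sub_R frob_in_R by (intro R_finsum) auto
  also have "\<dots> = restrict x M"
    by (rule restrict_ext)
       (auto simp: w(2) R_pow R_simps(1) E_mult compose_def f_def scalar_end_def M_Frob)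
  also have "\<dots> = x" using x(1) by (auto simp: E_carrier PiE_def extensional_restrict)
  finally have "(\<Oplus>\<^bsub>RR\<^esub>i\<in>{..<n}. f i \<otimes>\<^bsub>RR\<^esub> \<pi> [^]\<^bsub>RR\<^esub> i) = x" .
  then show "\<exists>f. (\<forall>i. f i \<in> KK) \<and> x = (\<Oplus>\<^bsub>RR\<^esub>i\<in>{..<n}. f i \<otimes>\<^bsub>RR\<^esub> \<pi> [^]\<^bsub>RR\<^esub> i)"
    using fK by (intro exI[of _ f] conjI allI) simp_all
next
  fix f i assume f: "\<And>i. f i \<in> KK" and sum: "(\<Oplus>\<^bsub>RR\<^esub>i\<in>{..<n}. f i \<otimes>\<^bsub>RR\<^esub> \<pi> [^]\<^bsub>RR\<^esub> i) = \<zero>\<^bsub>RR\<^esub>"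
    and i: "i < n"
  have "\<forall>i. \<exists>w. f i = scalar_end w" using f unfolding K_eq by blast
  then obtain w where w: "\<And>i. f i = scalar_end (w i)" by metis
  have "ac_poly p dvd w i"
  proof (rule opX_sum_zero[OF _ i])
    fix v assume v: "v \<in> M"
    have "(\<Oplus>\<^bsub>RR\<^esub>i\<in>{..<n}. f i \<otimes>\<^bsub>RR\<^esub> \<pi> [^]\<^bsub>RR\<^esub> i) =
       restrict (\<lambda>v. \<Sum>i<n. (f i \<otimes>\<^bsub>RR\<^esub> \<pi> [^]\<^bsub>RR\<^esub> i) v) M"
      using f K_sub_R frob_in_R by (intro R_finsum) auto
    then have "restrict (\<lambda>v. \<Sum>i<n. (f i \<otimes>\<^bsub>RR\<^esub> \<pi> [^]\<^bsub>RR\<^esub> i) v) M v = \<zero>\<^bsub>RR\<^esub> v"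
      unfolding sum by simp
    then show "(\<Sum>i<n. opX (w i) (Frob (r * i) v)) = 0"
      using v by (simp add: w R_pow R_simps E_zero E_mult compose_def scalar_end_def M_Frob)
  qed
  then show "f i = \<zero>\<^bsub>RR\<^esub>" unfolding w R_simps scalar_end_eq_zero_iff .
qed

end

section \<open>Left ideals of the centralizer\<close>

lemma irreducible_monic_dvd_eq:
  fixes p q :: "'a :: field poly"
  assumes "Factorial_Ring.irreducible p" "Factorial_Ring.irreducible q" "p dvd q"
    "lead_coeff p = 1" "lead_coeff q = 1"
  shows "p = q"
proof -
  obtain k where k: "q = p * k" using assms(3) by (auto elim: dvdE)
  have "\<not> p dvd 1" using assms(1) Factorial_Ring.irreducible_not_unit by blast
  then have "k dvd 1" using Factorial_Ring.irreducibleD[OF assms(2) k] by simp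
  then obtain c where c: "k = [:c:]" by (auto simp: is_unit_poly_iff)
  have "lead_coeff q = lead_coeff p * lead_coeff k" unfolding k by (rule lead_coeff_mult)
  then have "c = 1" using assms(4,5) c by simp
  then show ?thesis using k c by simp
qed

context drinfeld_endo
begin

lemma K_ring_eq: "K_ring r n t p m = RR\<lparr>carrier := KK\<rparr>"
  by (simp add: K_ring_def R_ring_def)

lemma K_skew_eq: "K_skew r n t p m = cyc.P"
  by (simp add: K_skew_def K_ring_eq)

lemma skew_eval_eq: "skew_eval r n t p m = cyc.eval_pi"
  by (simp add: skew_eval_def cyc.eval_pi_def fun_eq_iff)

lemma skew_y_eq: "skew_y r n t p m = skew_monom (RR\<lparr>carrier := KK\<rparr>) \<one>\<^bsub>RR\<^esub> 1"
  by (simp add: skew_y_def K_ring_eq)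

lemma yn_minus_c_eq: "yn_minus_c r n t p0 p m = cyc.modulus"
  unfolding yn_minus_c_def cyc.modulus_def skew_y_eq K_skew_eq K_ring_eq ..

lemma min_monic_eq: "min_monic r n t p m = cyc.minimal"
  by (simp add: min_monic_def cyc.minimal_def K_skew_eq K_ring_eq skew_eval_eq fun_eq_iff)

end

theorem theorem3p5:
  fixes p0 p :: "'a :: {field, finite} poly"
    and t :: "'a alg_closure"
    and n r d m :: nat
    and C :: "('a alg_closure \<Rightarrow> 'a alg_closure) set"
  defines "R \<equiv> R_ring r n t p m"
    and "K \<equiv> K_set r n t p m"
    and "deg_y \<equiv> skew_degree (K_ring r n t p m)"
    and "P \<equiv> K_skew r n t p m"
    and "y \<equiv> skew_y r n t p m"
    and "N \<equiv> yn_minus_c r n t p0 p m"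
    and "cls \<equiv> skew_eval r n t p m"
  assumes "n \<ge> 1"
    and "Polynomial.lead_coeff p0 = 1" and "Factorial_Ring.irreducible p0"
    and "Polynomial.degree p0 = r"
    and "coprime n r"
    and "t \<in> Fq_ext r" and "poly (map_poly to_ac p0) t = 0"
    and "p \<noteq> p0"
    and "Polynomial.lead_coeff p = 1" and "Factorial_Ring.irreducible p"
    and "Polynomial.degree p = d"
    and "m dvd n"
    and "coprime m d"
    and "left_ideal C R" and "C \<noteq> {\<zero>\<^bsub>R\<^esub>}"
  shows
    "(\<exists>!g. min_monic r n t p m C g) \<and>
     (\<forall>g. min_monic r n t p m C g \<longrightarrow>
        C = {x \<otimes>\<^bsub>R\<^esub> cls g | x. x \<in> carrier R} \<and>
        (\<exists>!h. h \<in> carrier P \<and> N = h \<otimes>\<^bsub>P\<^esub> g \<and> N = g \<otimes>\<^bsub>P\<^esub> h) \<and>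
        (\<forall>f\<in>carrier P. cls f \<in> C \<longleftrightarrow> (\<exists>u\<in>carrier P. f = u \<otimes>\<^bsub>P\<^esub> g)) \<and>
        (let k = n - deg_y g;
             basis = map (\<lambda>i. cls ((y [^]\<^bsub>P\<^esub> i) \<otimes>\<^bsub>P\<^esub> g)) [0..<k]
         in ring.dimension R k K C \<and>
            ring.independent R K basis \<and> ring.Span R K basis = C) \<and>
        (\<forall>h\<in>carrier P. N = h \<otimes>\<^bsub>P\<^esub> g \<and> N = g \<otimes>\<^bsub>P\<^esub> h \<longrightarrow>
           (\<forall>x\<in>carrier R. x \<in> C \<longleftrightarrow> x \<otimes>\<^bsub>R\<^esub> cls h = \<zero>\<^bsub>R\<^esub>)))"
  proof -
  note p0 = \<open>lead_coeff p0 = 1\<close> \<open>Factorial_Ring.irreducible p0\<close> \<open>degree p0 = r\<close> \<open>poly (map_poly to_ac p0) t = 0\<close>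
  note p = \<open>lead_coeff p = 1\<close> \<open>Factorial_Ring.irreducible p\<close> \<open>degree p = d\<close> \<open>p \<noteq> p0\<close>
  have p_t: "poly (ac_poly p) t \<noteq> 0"
    using irreducible_dvd_of_root[OF p0(2,4), of p] irreducible_monic_dvd_eq[of p0 p] p0 p by auto
  have p_p0: "\<not> p dvd p0" using irreducible_monic_dvd_eq[of p p0] p0 p by auto
  have "r \<noteq> 0"
  proof
    assume "r = 0"
    then obtain c where "p0 = [:c:]" using p0(3) by (auto elim: degree_eq_zeroE)
    then have "p0 = 1" using p0(1) by (simp add: one_pCons)
    then show False using p0(2) by simp
  qed
  moreover have "Frob r t = t" using \<open>t \<in> Fq_ext r\<close> by (simp add: Fq_ext_iff)
  moreover have "p \<noteq> 0" using p(1) by auto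
  ultimately interpret drinfeld_endo t n r p p0 m
    by unfold_locales (use assms p_t p_p0 in auto)
  note defs = R_def K_def deg_y_def P_def y_def N_def cls_def K_skew_eq K_ring_eq skew_eval_eq
    skew_y_eq yn_minus_c_eq min_monic_eq
  have C: "left_ideal C RR" "C \<noteq> {\<zero>\<^bsub>RR\<^esub>}"
    using \<open>left_ideal C R\<close> \<open>C \<noteq> {\<zero>\<^bsub>R\<^esub>}\<close> by (simp_all add: R_def)
  show ?thesis
    unfolding defs Let_def
  proof (intro conjI allI impI ballI)
    show "\<exists>!g. cyc.minimal C g"
      using cyc.minimal_exists[OF C] cyc.minimal_unique[OF C] by blast
    fix g assume g: "cyc.minimal C g"
    show "C = {x \<otimes>\<^bsub>RR\<^esub> cyc.eval_pi g | x. x \<in> carrier RR}"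
      by (rule cyc.minimal_generates[OF C g])
    show "\<exists>!h. h \<in> carrier cyc.P \<and> cyc.modulus = h \<otimes>\<^bsub>cyc.P\<^esub> g \<and> cyc.modulus = g \<otimes>\<^bsub>cyc.P\<^esub> h"
      by (rule cyc.minimal_cofactor[OF C g])
    show "cyc.eval_pi f \<in> C \<longleftrightarrow> (\<exists>u\<in>carrier cyc.P. f = u \<otimes>\<^bsub>cyc.P\<^esub> g)" if "f \<in> carrier cyc.P" for f
      by (rule cyc.minimal_dvd[OF C g that])
    show "x \<in> C \<longleftrightarrow> x \<otimes>\<^bsub>RR\<^esub> cyc.eval_pi h = \<zero>\<^bsub>RR\<^esub>"
      if "h \<in> carrier cyc.P" "cyc.modulus = h \<otimes>\<^bsub>cyc.P\<^esub> g \<and> cyc.modulus = g \<otimes>\<^bsub>cyc.P\<^esub> h"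
        "x \<in> carrier RR" for h x
      using cyc.cofactor_annihilates[OF C g that(1) _ _ that(3)] that(2) by blast
  qed (use cyc.minimal_basis[OF C] in auto)
qed

end
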